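(* $${}_2F_1\left(\tfrac1{30},\tfrac8{15};\tfrac9{10};\tfrac{20736}{45125}\right)=\frac16\,\sqrt2\,\sqrt[10]{3}\,\sqrt[10]{5}\,\sqrt[15]{19}\,\sqrt{5+\sqrt5}.$$
   Context: For complex $a,b,c$ with $c\notin\{0,-1,-2,\dots\}$ and $|x|<1$, ${}_2F_1(a,b;c;x)=\sum_{n\ge 0}\frac{(a,n)(b,n)}{(c,n)(1,n)}x^n$ denotes Gauss's hypergeometric series, where $(\alpha,n)=\alpha(\alpha+1)\cdots(\alpha+n-1)$, $(\alpha,0)=1$. All roots are positive real roots. *)

theory Defs
  imports "HOL-Analysis.Analysis"
begin

(* "suminf" only has the intended meaning when the series converges, which is the case for
   norm x < 1 and c not a non-positive integer. *)
definition hyp2F1 :: "complex \<Rightarrow> complex \<Rightarrow> complex \<Rightarrow> complex \<Rightarrow> complex" where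
  "hyp2F1 a b c x =
     (\<Sum>n. pochhammer a n * pochhammer b n / (pochhammer c n * pochhammer 1 n) * x ^ n)"

lemma hyp2F1_conv_eval_fps:
  "hyp2F1 a b c x = eval_fps (fps_hypergeo [a, b] [c] 1) x"
  by (simp add: hyp2F1_def eval_fps_def pochhammer_fact [symmetric])

end

(*
  Write F for the series and x = 1/z.  Its differential equation belongs to the arithmetic (2,3,10)
  triangle group: the exponent differences at x = 0, 1, infinity are 1/10, 1/3, 1/2.  The given
  argument is the CM point to which the Hecke correspondence of degree 10 (norm 9) sends the
  elliptic point x = 0.  The correspondence lives on the elliptic curve 5 y^2 = X^3 + 158 X^2 + 6561 X:
  the map z = h^2/g^3 of degree 10 pulls the equation back to the Lame equation
  D^2 f = -(X/90 + 13/20) f, D = y d/dX, which is invariant under y -> -y.  Hence the pullbacks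
  along (X, y) and (X, -y) span the same solution space, and at X = 81 they sit over x = 0 and over
  x = 20736/45125.  The change of basis between the two pullbacks is an involution
  [[l, m], [l', -l]], and F(20736/45125) is l times an algebraic factor.

  To find l, follow the solutions along the real arc from X = 81 to infinity.  The second pullback
  meets no singularity there; the first one passes z = 1 (where sq -> -sq), then z = 0 (where
  so -> -so), and at infinity both pullbacks agree again.  Comparing traces gives
  l = 2 F(1/30,2/15;2/3;1) F(1/30,2/15;1/2;1) - 1, which by Gauss's theorem and the reflection
  formula equals 2 cos(pi/10) / sqrt 3.
*)
theory Submission
  imports Defs "HOL-Real_Asymp.Real_Asymp"
begin

subsection \<open>The real hypergeometric series\<close>

text \<open>The cover is chosen by its ramification: 10 over z = infinity, 2+2+2+2+2 over z = 0 and
  3+3+3+1 over z = 1. This matches the exponent differences 1/10, 1/2, 1/3, so the pulled-back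
  equation has one singular point, the unramified point over z = 1. It is the origin O of the curve,
  hence fixed by y -> -y. Over z = infinity lies P = (81, 648), a point of order 4.

  Why a trace: the transport from X = 81 to infinity needs the connection matrix between z =
  infinity and z = 1, but only as a conjugating matrix. Its entries cancel from the trace, which
  then depends on a product of two Gauss values and not on the normalisation of \<open>sq\<close>
  and \<open>so\<close>. Why l alone: at X = 81 the second pullback of \<open>sv\<close> vanishes,
  so the involution relates the two pullbacks of \<open>su\<close> through l.

  All solutions are real functions on intervals; continuation through a ramification point is a
  matching of value and derivative (\<open>ode_sol_cross\<close>) in place of a path in the complex
  plane.\<close>

definition hgc :: "real \<Rightarrow> real \<Rightarrow> real \<Rightarrow> nat \<Rightarrow> real" where
  "hgc a b c n = pochhammer a n * pochhammer b n / (pochhammer c n * fact n)"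

definition hgf :: "real \<Rightarrow> real \<Rightarrow> real \<Rightarrow> real \<Rightarrow> real" where
  "hgf a b c x = (\<Sum>n. hgc a b c n * x ^ n)"

definition hgf' :: "real \<Rightarrow> real \<Rightarrow> real \<Rightarrow> real \<Rightarrow> real" where
  "hgf' a b c x = (\<Sum>n. diffs (hgc a b c) n * x ^ n)"

lemma hgc_0 [simp]: "hgc a b c 0 = 1"
  by (simp add: hgc_def)

lemma hgc_pos: "a > 0 \<Longrightarrow> b > 0 \<Longrightarrow> c > 0 \<Longrightarrow> hgc a b c n > 0"
  by (simp add: hgc_def pochhammer_pos)

lemma hgc_Suc:
  assumes "c > 0"
  shows "real (Suc n) * (c + real n) * hgc a b c (Suc n) = (a + real n) * (b + real n) * hgc a b c n"
proof -
  have "pochhammer c n > 0" "c + real n > 0" using assms by (auto simp: pochhammer_pos)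
  moreover have "real (Suc n) > 0" by simp
  ultimately show ?thesis
    by (simp add: hgc_def pochhammer_Suc divide_simps del: of_nat_Suc)
qed

lemma hgc_Suc':
  assumes "c > 0"
  shows "hgc a b c (Suc n) = hgc a b c n * ((a + real n) * (b + real n) / (real (Suc n) * (c + real n)))"
proof -
  have "real (Suc n) * (c + real n) > 0" using assms by (auto intro: mult_pos_pos)
  with hgc_Suc[OF assms, of n a b] show ?thesis
    by (simp add: field_simps)
qed

lemma hgc_summable:
  assumes c: "c > 0" and x: "\<bar>x\<bar> < 1"
  shows "summable (\<lambda>n. hgc a b c n * x ^ n)"
proof -
  obtain r where r: "\<bar>x\<bar> < r" "r < 1" using x dense by blast
  hence r0: "r > 0" by linarith
  have "((\<lambda>n. \<bar>x\<bar> * (\<bar>a + real n\<bar> * \<bar>b + real n\<bar> / (real (Suc n) * (c + real n)))) \<longlonglongrightarrow> \<bar>x\<bar> * 1)"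
    by (intro tendsto_mult tendsto_const) real_asymp
  hence "eventually (\<lambda>n. \<bar>x\<bar> * (\<bar>a + real n\<bar> * \<bar>b + real n\<bar> / (real (Suc n) * (c + real n))) < r) sequentially"
    using r by (intro order_tendstoD(2)[where y = "\<bar>x\<bar> * 1"]) auto
  then obtain N where N: "\<And>n. n \<ge> N \<Longrightarrow> \<bar>x\<bar> * (\<bar>a + real n\<bar> * \<bar>b + real n\<bar> / (real (Suc n) * (c + real n))) < r"
    by (auto simp: eventually_at_top_linorder)
  show ?thesis
  proof (rule summable_ratio_test[of r N])
    fix n assume n: "n \<ge> N"
    have p: "real (Suc n) * (c + real n) > 0" using c by (auto intro: mult_pos_pos)
    have "norm (hgc a b c (Suc n) * x ^ Suc n) =
       (\<bar>x\<bar> * (\<bar>a + real n\<bar> * \<bar>b + real n\<bar> / (real (Suc n) * (c + real n)))) * norm (hgc a b c n * x ^ n)"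
      unfolding hgc_Suc'[OF c] using p c by (simp add: abs_mult power_abs)
    also have "\<dots> \<le> r * norm (hgc a b c n * x ^ n)"
      by (intro mult_right_mono less_imp_le[OF N[OF n]]) auto
    finally show "norm (hgc a b c (Suc n) * x ^ Suc n) \<le> r * norm (hgc a b c n * x ^ n)" .
  qed (use r in auto)
qed

lemma hgf_deriv:
  assumes "c > 0" "\<bar>x\<bar> < 1"
  shows "(hgf a b c has_real_derivative hgf' a b c x) (at x)"
  unfolding hgf_def[abs_def] hgf'_def
  by (rule termdiffs_strong'[where K = 1]) (use assms hgc_summable in auto)

lemma hgf'_deriv:
  assumes c: "c > 0" and x: "\<bar>x\<bar> < 1"
  shows "(hgf' a b c has_real_derivative (\<Sum>n. diffs (diffs (hgc a b c)) n * x ^ n)) (at x)"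
  unfolding hgf'_def[abs_def]
proof (rule termdiffs_strong'[where K = 1])
  fix y :: real assume "norm y < 1"
  thus "summable (\<lambda>n. diffs (hgc a b c) n * y ^ n)"
    by (intro termdiff_converges[where K = 1]) (auto intro: hgc_summable c)
qed (use x in auto)

text \<open>Coefficientwise this is the recursion \<open>hgc_Suc\<close>; \<open>shift\<close>
  translates multiplication of the coefficients by n into x d/dx.\<close>

lemma hgf_ode:
  assumes c: "c > 0" and x: "\<bar>x\<bar> < 1"
  shows "\<exists>s. (hgf' a b c has_real_derivative s) (at x) \<and>
           x * (1 - x) * s = ((a + b + 1) * x - c) * hgf' a b c x + a * b * hgf a b c x"
proof -
  let ?C = "hgc a b c"
  define s where "s = (\<Sum>n. diffs (diffs ?C) n * x ^ n)"
  have S0: "\<And>y. norm y < 1 \<Longrightarrow> summable (\<lambda>n. ?C n * y ^ n)" by (auto intro: hgc_summable c)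
  have S1: "\<And>y. norm y < 1 \<Longrightarrow> summable (\<lambda>n. diffs ?C n * y ^ n)"
    by (rule termdiff_converges[where K = 1]) (auto intro: hgc_summable c)
  have S2: "\<And>y. norm y < 1 \<Longrightarrow> summable (\<lambda>n. diffs (diffs ?C) n * y ^ n)"
    by (rule termdiff_converges[where K = 1]) (auto intro: S1)
  have x': "norm x < 1" using x by simp
  have shift: "(\<lambda>n. real n * f n * x ^ n) sums (x * (\<Sum>n. diffs f n * x ^ n))"
    if "summable (\<lambda>n. diffs f n * x ^ n)" for f
  proof -
    have "(\<lambda>n. x * (diffs f n * x ^ n)) sums (x * (\<Sum>n. diffs f n * x ^ n))"
      by (intro sums_mult summable_sums that)
    hence "(\<lambda>n. real (Suc n) * f (Suc n) * x ^ Suc n) sums (x * (\<Sum>n. diffs f n * x ^ n))"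
      by (simp add: diffs_def mult_ac)
    thus ?thesis by (subst (asm) sums_Suc_iff) simp
  qed
  have e0: "(\<lambda>n. ?C n * x ^ n) sums hgf a b c x"
    unfolding hgf_def by (intro summable_sums S0 x')
  have e1: "(\<lambda>n. diffs ?C n * x ^ n) sums hgf' a b c x"
    unfolding hgf'_def by (intro summable_sums S1 x')
  have e2: "(\<lambda>n. real n * ?C n * x ^ n) sums (x * hgf' a b c x)"
    unfolding hgf'_def by (intro shift S1 x')
  have e3: "(\<lambda>n. real n * diffs ?C n * x ^ n) sums (x * s)"
    unfolding s_def by (intro shift S2 x')
  have e4: "(\<lambda>n. real n * (real n - 1) * ?C n * x ^ n) sums (x * (x * s))"
  proof -
    have "(\<lambda>n. x * (real n * diffs ?C n * x ^ n)) sums (x * (x * s))"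
      by (intro sums_mult e3)
    moreover have "(\<lambda>n. x * (real n * diffs ?C n * x ^ n)) =
       (\<lambda>n. real (Suc n) * (real (Suc n) - 1) * ?C (Suc n) * x ^ Suc n)"
      by (simp add: diffs_def mult_ac)
    ultimately have "(\<lambda>n. real (Suc n) * (real (Suc n) - 1) * ?C (Suc n) * x ^ Suc n) sums (x * (x * s))"
      by (simp only:)
    thus ?thesis by (subst (asm) sums_Suc_iff) simp
  qed
  have "(\<lambda>n. real n * diffs ?C n * x ^ n - real n * (real n - 1) * ?C n * x ^ n
           + c * (diffs ?C n * x ^ n) - (a + b + 1) * (real n * ?C n * x ^ n) - a * b * (?C n * x ^ n))
        sums (x * s - x * (x * s) + c * hgf' a b c x - (a + b + 1) * (x * hgf' a b c x) - a * b * hgf a b c x)"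
    by (intro sums_add sums_diff sums_mult e0 e1 e2 e3 e4)
  moreover have "(\<lambda>n. real n * diffs ?C n * x ^ n - real n * (real n - 1) * ?C n * x ^ n
           + c * (diffs ?C n * x ^ n) - (a + b + 1) * (real n * ?C n * x ^ n) - a * b * (?C n * x ^ n)) = (\<lambda>n. 0)"
  proof
    fix n
    have "real n * diffs ?C n * x ^ n - real n * (real n - 1) * ?C n * x ^ n
           + c * (diffs ?C n * x ^ n) - (a + b + 1) * (real n * ?C n * x ^ n) - a * b * (?C n * x ^ n)
        = x ^ n * (real (Suc n) * (c + real n) * ?C (Suc n) - (a + real n) * (b + real n) * ?C n)"
      by (simp add: diffs_def algebra_simps)
    thus "real n * diffs ?C n * x ^ n - real n * (real n - 1) * ?C n * x ^ n
           + c * (diffs ?C n * x ^ n) - (a + b + 1) * (real n * ?C n * x ^ n) - a * b * (?C n * x ^ n) = 0"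
      by (simp only: hgc_Suc[OF c]) simp
  qed
  ultimately have "x * s - x * (x * s) + c * hgf' a b c x - (a + b + 1) * (x * hgf' a b c x) - a * b * hgf a b c x = 0"
    using sums_unique2 sums_zero by metis
  moreover have "(hgf' a b c has_real_derivative s) (at x)"
    unfolding s_def by (rule hgf'_deriv) (use assms in auto)
  ultimately show ?thesis
    by (intro exI[of _ s]) (auto simp: algebra_simps)
qed

lemma hgf_pos:
  assumes "a > 0" "b > 0" "c > 0" "0 \<le> x" "x < 1"
  shows "hgf a b c x > 0"
proof -
  have "(\<Sum>n. hgc a b c n * x ^ n) \<ge> (\<Sum>n\<in>{0}. hgc a b c n * x ^ n)"
    by (rule sum_le_suminf[OF hgc_summable]) (use assms hgc_pos in \<open>auto intro!: mult_nonneg_nonneg less_imp_le[OF hgc_pos]\<close>)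
  thus ?thesis by (simp add: hgf_def)
qed

lemma hgf_0 [simp]: "hgf a b c 0 = 1"
  unfolding hgf_def using powser_zero[of "hgc a b c"] by simp

lemma hgf_cont:
  assumes "c > 0" "\<bar>x\<bar> < 1"
  shows "isCont (hgf a b c) x"
  using hgf_deriv[OF assms] by (rule DERIV_isCont)

lemma hyp2F1_of_real:
  assumes "c > 0" "\<bar>x\<bar> < 1"
  shows "hyp2F1 (of_real a) (of_real b) (of_real c) (of_real x) = of_real (hgf a b c x)"
proof -
  have "(\<lambda>n. complex_of_real (hgc a b c n * x ^ n)) sums of_real (hgf a b c x)"
    unfolding hgf_def by (intro sums_of_real summable_sums hgc_summable assms)
  thus ?thesis
    unfolding hyp2F1_def
    by (intro sums_unique[symmetric]) (simp add: hgc_def pochhammer_of_real pochhammer_fact[symmetric])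
qed

section \<open>Convergence at the argument 1 and Gauss's summation theorem\<close>

lemma hgc_summable_1:
  assumes abc: "a > 0" "b > 0" "c > 0" and d: "c - a - b > 0"
  shows "summable (hgc a b c)"
proof (rule raabes_test_convergence[of "hgc a b c"])
  show "eventually (\<lambda>n. hgc a b c n > 0) sequentially"
    using hgc_pos abc by simp
next
  have "(\<lambda>n. real n * (real (Suc n) * (c + real n) / ((a + real n) * (b + real n)) - 1)) \<longlonglongrightarrow> 1 + c - a - b"
    using abc by real_asymp
  moreover have "(\<lambda>n. real n * (real (Suc n) * (c + real n) / ((a + real n) * (b + real n)) - 1)) =
      (\<lambda>n. real n * (hgc a b c n / hgc a b c (Suc n) - 1))"
  proof
    fix n
    have p: "hgc a b c n > 0" "hgc a b c (Suc n) > 0" "a + real n > 0" "b + real n > 0"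
      using abc hgc_pos by (auto intro: add_pos_nonneg)
    have "hgc a b c n / hgc a b c (Suc n) = real (Suc n) * (c + real n) / ((a + real n) * (b + real n))"
      using hgc_Suc[OF abc(3), of n a b] p by (simp add: divide_simps mult_ac del: of_nat_Suc)
    thus "real n * (real (Suc n) * (c + real n) / ((a + real n) * (b + real n)) - 1) =
       real n * (hgc a b c n / hgc a b c (Suc n) - 1)" by simp
  qed
  ultimately have "(\<lambda>n. real n * (hgc a b c n / hgc a b c (Suc n) - 1)) \<longlonglongrightarrow> 1 + c - a - b"
    by simp
  hence "liminf (\<lambda>n. ereal (real n * (hgc a b c n / hgc a b c (Suc n) - 1))) = ereal (1 + c - a - b)"
    by (intro lim_imp_Liminf tendsto_ereal) auto
  thus "1 < liminf (\<lambda>n. ereal (real n * (hgc a b c n / hgc a b c (Suc n) - 1)))"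
    using d by simp
qed

text \<open>The sequence \<open>G\<close> has differences bounded by a constant times the summable
  coefficients, so it converges. A positive limit would bound 1/n by a multiple of the coefficients
  and make the harmonic series converge.\<close>

lemma hgc_nat_tendsto_0:
  assumes abc: "a > 0" "b > 0" "c > 0" and d: "c - a - b > 0"
  shows "(\<lambda>n. real n * hgc a b c n) \<longlonglongrightarrow> 0"
proof -
  define t where "t = (\<lambda>n. c / (c + real n) * hgc a b c n)"
  define G where "G = (\<lambda>n. real n * c * hgc a b c n)"
  have S: "summable (hgc a b c)" by (rule hgc_summable_1) fact+
  have "summable (\<lambda>n. c / (c + real n) * ((c - a - b) * real n - a * b) * hgc a b c n)"
  proof (rule summable_comparison_test_ev[OF _ summable_mult[OF S]])
    show "eventually (\<lambda>n. norm (c / (c + real n) * ((c - a - b) * real n - a * b) * hgc a b c n)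
             \<le> (c * (c - a - b) + a * b) * hgc a b c n) sequentially"
    proof (intro always_eventually allI)
      fix n
      have "\<bar>c / (c + real n) * ((c - a - b) * real n - a * b)\<bar> \<le> c * (c - a - b) + a * b"
      proof -
        have "\<bar>(c - a - b) * real n - a * b\<bar> \<le> (c - a - b) * real n + a * b"
          using abc d by (auto simp: abs_if)
        hence "\<bar>c / (c + real n) * ((c - a - b) * real n - a * b)\<bar> \<le> c / (c + real n) * ((c - a - b) * real n + a * b)"
          using abc by (simp add: abs_mult divide_right_mono mult_left_mono)
        also have "\<dots> = (c * (c - a - b)) * (real n / (c + real n)) + (a * b) * (c / (c + real n))"
          by (simp add: add_divide_distrib [symmetric] algebra_simps)
        also have "\<dots> \<le> (c * (c - a - b)) * 1 + (a * b) * 1"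
          using abc d by (intro add_mono mult_left_mono mult_nonneg_nonneg) (auto simp: divide_le_eq_1)
        finally show ?thesis by simp
      qed
      thus "norm (c / (c + real n) * ((c - a - b) * real n - a * b) * hgc a b c n)
             \<le> (c * (c - a - b) + a * b) * hgc a b c n"
        unfolding real_norm_def abs_mult[of _ "hgc a b c n"] abs_of_pos[OF hgc_pos[OF abc]]
        by (rule mult_right_mono) (rule less_imp_le[OF hgc_pos[OF abc]])
    qed
  qed
  moreover have G: "G n - G (Suc n) = c / (c + real n) * ((c - a - b) * real n - a * b) * hgc a b c n" for n
  proof -
    have cn: "c + real n > 0" using abc by (intro add_pos_nonneg) auto
    have "(c + real n) * G (Suc n) = c * ((a + real n) * (b + real n) * hgc a b c n)"
      unfolding hgc_Suc[OF abc(3), symmetric] G_def by (simp add: algebra_simps)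
    hence "G (Suc n) = c * ((a + real n) * (b + real n) * hgc a b c n) / (c + real n)"
      using cn by (simp add: field_simps)
    thus ?thesis using cn by (simp add: G_def field_simps)
  qed
  ultimately have "summable (\<lambda>n. G n - G (Suc n))" by simp
  hence "convergent G"
  proof -
    assume "summable (\<lambda>n. G n - G (Suc n))"
    then obtain s where "(\<lambda>n. G n - G (Suc n)) sums s" by (auto simp: summable_def)
    hence "(\<lambda>N. \<Sum>n<N. G n - G (Suc n)) \<longlonglongrightarrow> s" by (simp add: sums_def)
    moreover have "(\<Sum>n<N. G n - G (Suc n)) = G 0 - G N" for N by (rule sum_lessThan_telescope')
    ultimately have "(\<lambda>N. G 0 - G N) \<longlonglongrightarrow> s" by simp
    hence "(\<lambda>N. G 0 - (G 0 - G N)) \<longlonglongrightarrow> G 0 - s" by (intro tendsto_intros)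
    thus ?thesis by (auto simp: convergent_def)
  qed
  then obtain L where L: "G \<longlonglongrightarrow> L" by (auto simp: convergent_def)
  have "L = 0"
  proof (rule ccontr)
    assume "L \<noteq> 0"
    moreover have "L \<ge> 0"
      by (rule LIMSEQ_le_const[OF L]) (use abc less_imp_le[OF hgc_pos[OF abc]] in \<open>auto simp: G_def\<close>)
    ultimately have "L > 0" by simp
    hence "eventually (\<lambda>n. G n > L / 2) sequentially"
      by (intro order_tendstoD(1)[OF L]) auto
    hence ev: "eventually (\<lambda>n. norm (1 / real n) \<le> 2 * c / L * hgc a b c n) sequentially"
      using eventually_gt_at_top[of 0]
    proof eventually_elim
      case (elim n)
      thus ?case using \<open>L > 0\<close> by (simp add: G_def field_simps)
    qed
    have "summable (\<lambda>n. 1 / real n)"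
      by (rule summable_comparison_test_ev[OF ev summable_mult[OF S]])
    thus False using not_summable_harmonic[where 'a = real] by (simp add: inverse_eq_divide)
  qed
  hence "(\<lambda>n. G n / c) \<longlonglongrightarrow> 0 / c" using L by (intro tendsto_intros) (use abc in auto)
  thus ?thesis using abc by (simp add: G_def)
qed

definition hgf_sum1 :: "real \<Rightarrow> real \<Rightarrow> real \<Rightarrow> real" where
  "hgf_sum1 a b c = (\<Sum>n. hgc a b c n)"

text \<open>Abel's limit theorem for positive coefficients: the full sum bounds the values from
  above, a fixed partial sum, continuous at 1, from below.\<close>

lemma hgf_tendsto_sum1:
  assumes abc: "a > 0" "b > 0" "c > 0" and d: "c - a - b > 0"
  shows "(hgf a b c \<longlongrightarrow> hgf_sum1 a b c) (at_left 1)"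
proof -
  have S: "summable (hgc a b c)" by (rule hgc_summable_1) fact+
  have nn: "hgc a b c n \<ge> 0" for n using hgc_pos[OF abc] by (simp add: less_imp_le)
  have le: "hgf a b c x \<le> hgf_sum1 a b c" if "0 \<le> x" "x < 1" for x
    unfolding hgf_def hgf_sum1_def
  proof (rule suminf_le[OF _ hgc_summable S])
    show "hgc a b c n * x ^ n \<le> hgc a b c n" for n
      using mult_left_mono[OF power_le_one, of x "hgc a b c n" n] nn[of n] that by simp
  qed (use abc that in auto)
  show ?thesis
  proof (rule tendstoI)
    fix e :: real assume "e > 0"
    have "(\<lambda>N. \<Sum>n<N. hgc a b c n) \<longlonglongrightarrow> hgf_sum1 a b c"
      unfolding hgf_sum1_def using summable_LIMSEQ[OF S] .
    hence "eventually (\<lambda>N. (\<Sum>n<N. hgc a b c n) > hgf_sum1 a b c - e) sequentially"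
      using \<open>e > 0\<close> by (intro order_tendstoD(1)) auto
    then obtain N where N: "(\<Sum>n<N. hgc a b c n) > hgf_sum1 a b c - e"
      by (auto simp: eventually_at_top_linorder)
    have "((\<lambda>x. \<Sum>n<N. hgc a b c n * x ^ n) \<longlongrightarrow> (\<Sum>n<N. hgc a b c n * 1 ^ n)) (at_left 1)"
      by (intro tendsto_intros)
    hence "eventually (\<lambda>x. (\<Sum>n<N. hgc a b c n * x ^ n) > hgf_sum1 a b c - e) (at_left 1)"
      using N by (intro order_tendstoD(1)) auto
    moreover have "eventually (\<lambda>x::real. x \<in> {0<..<1}) (at_left 1)"
      by (rule eventually_at_leftI[of 0]) auto
    ultimately show "eventually (\<lambda>x. dist (hgf a b c x) (hgf_sum1 a b c) < e) (at_left 1)"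
    proof eventually_elim
      case (elim x)
      have "(\<Sum>n<N. hgc a b c n * x ^ n) \<le> hgf a b c x"
        unfolding hgf_def
        by (rule sum_le_suminf[OF hgc_summable]) (use elim abc nn in auto)
      with elim le[of x] show ?case by (auto simp: dist_real_def abs_if)
    qed
  qed
qed

text \<open>Contiguous relation at 1: termwise the two sides differ by
  \<open>G n - G (Suc n)\<close>, which telescopes, and the boundary term vanishes by
  \<open>hgc_nat_tendsto_0\<close>.\<close>

lemma hgf_sum1_step:
  assumes abc: "a > 0" "b > 0" "c > 0" and d: "c - a - b > 0"
  shows "c * (c - a - b) * hgf_sum1 a b c = (c - a) * (c - b) * hgf_sum1 a b (c + 1)"
proof -
  have S: "summable (hgc a b c)" by (rule hgc_summable_1) fact+
  have S': "summable (hgc a b (c + 1))" by (rule hgc_summable_1) (use assms in auto)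
  define G where "G = (\<lambda>n. real n * c * hgc a b c n)"
  have t: "hgc a b (c + 1) n = c / (c + real n) * hgc a b c n" for n
  proof -
    have "pochhammer c (Suc n) = c * pochhammer (c + 1) n" by (simp add: pochhammer_rec)
    moreover have "pochhammer c (Suc n) = pochhammer c n * (c + real n)" by (simp add: pochhammer_Suc)
    moreover have "pochhammer c n > 0" "pochhammer (c + 1) n > 0" "c + real n > 0"
      using abc by (auto simp: pochhammer_pos)
    ultimately show ?thesis
      by (simp add: hgc_def divide_simps) (simp add: mult_ac)
  qed
  have G: "c * (c - a - b) * hgc a b c n - (c - a) * (c - b) * hgc a b (c + 1) n = G n - G (Suc n)" for n
  proof -
    have cn: "c + real n > 0" using abc by (intro add_pos_nonneg) auto
    have "(c + real n) * G (Suc n) = c * ((a + real n) * (b + real n) * hgc a b c n)"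
      unfolding hgc_Suc[OF abc(3), symmetric] G_def by (simp add: algebra_simps)
    hence "G (Suc n) = c * ((a + real n) * (b + real n) * hgc a b c n) / (c + real n)"
      using cn by (simp add: field_simps)
    thus ?thesis unfolding t G_def using cn by (simp add: field_simps)
  qed
  have "(\<lambda>n. c * (real n * hgc a b c n)) \<longlonglongrightarrow> c * 0"
    by (intro tendsto_mult tendsto_const hgc_nat_tendsto_0 assms)
  hence "G \<longlonglongrightarrow> 0" by (simp add: G_def mult_ac)
  hence "(\<lambda>n. G n - G (Suc n)) sums (G 0 - 0)" by (rule telescope_sums')
  moreover have "(\<lambda>n. c * (c - a - b) * hgc a b c n - (c - a) * (c - b) * hgc a b (c + 1) n) sums
      (c * (c - a - b) * hgf_sum1 a b c - (c - a) * (c - b) * hgf_sum1 a b (c + 1))"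
    unfolding hgf_sum1_def by (intro sums_diff sums_mult summable_sums S S')
  ultimately have "c * (c - a - b) * hgf_sum1 a b c - (c - a) * (c - b) * hgf_sum1 a b (c + 1) = 0"
    unfolding G using sums_unique2 by (fastforce simp: G_def)
  thus ?thesis by simp
qed

lemma hgf_sum1_shift:
  assumes abc: "a > 0" "b > 0" "c > 0" and d: "c - a - b > 0"
  shows "hgf_sum1 a b c * (pochhammer c m * pochhammer (c - a - b) m) = pochhammer (c - a) m * pochhammer (c - b) m * hgf_sum1 a b (c + real m)"
proof (induction m)
  case (Suc m)
  have "hgf_sum1 a b c * (pochhammer c (Suc m) * pochhammer (c - a - b) (Suc m)) =
     (hgf_sum1 a b c * (pochhammer c m * pochhammer (c - a - b) m)) * ((c + real m) * (c - a - b + real m))"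
    by (simp add: pochhammer_Suc)
  also have "\<dots> = pochhammer (c - a) m * pochhammer (c - b) m * ((c + real m) * (c + real m - a - b) * hgf_sum1 a b (c + real m))"
    unfolding Suc.IH by (simp add: algebra_simps)
  also have "(c + real m) * (c + real m - a - b) * hgf_sum1 a b (c + real m) =
     (c + real m - a) * (c + real m - b) * hgf_sum1 a b (c + real m + 1)"
    by (rule hgf_sum1_step) (use assms in auto)
  finally show ?case by (simp add: pochhammer_Suc algebra_simps)
qed simp

text \<open>Every term after the constant one is at most c/(c+m) times the corresponding term for m
  = 0, because the first factor of the Pochhammer denominator grows from c to c+m.\<close>

lemma hgf_sum1_tendsto_1:
  assumes abc: "a > 0" "b > 0" "c > 0" and d: "c - a - b > 0"
  shows "(\<lambda>m. hgf_sum1 a b (c + real m)) \<longlonglongrightarrow> 1"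
proof (rule tendsto_sandwich)
  have S: "summable (hgc a b (c + real m))" for m by (rule hgc_summable_1) (use assms in auto)
  have S0: "summable (hgc a b c)" using S[of 0] by simp
  have nn: "hgc a b (c + real m) n \<ge> 0" for m n using hgc_pos[of a b "c + real m" n] abc by simp
  have split: "hgf_sum1 a b (c + real m) = 1 + (\<Sum>n. hgc a b (c + real m) (Suc n))" for m
    unfolding hgf_sum1_def using suminf_split_head[OF S[of m]] by simp
  have nn1: "hgc a b c n \<ge> 0" for n using nn[of 0] by simp
  have le: "hgc a b (c + real m) (Suc n) \<le> c / (c + real m) * hgc a b c (Suc n)" for m n
  proof -
    have A: "pochhammer (c + real m) (Suc n) \<ge> (c + real m) / c * pochhammer c (Suc n)"
    proof -
      have "pochhammer (c + 1) n \<le> pochhammer (c + real m + 1) n"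
        unfolding pochhammer_prod using abc by (intro prod_mono) auto
      hence "(c + real m) * pochhammer (c + 1) n \<le> (c + real m) * pochhammer (c + real m + 1) n"
        using abc by (intro mult_left_mono) auto
      thus ?thesis using abc by (simp add: pochhammer_rec)
    qed
    have p: "pochhammer c (Suc n) > 0" "pochhammer (c + real m) (Suc n) > 0"
       "(c + real m) / c * pochhammer c (Suc n) > 0" using abc by (auto intro!: pochhammer_pos mult_pos_pos divide_pos_pos)
    have "hgc a b (c + real m) (Suc n) = (pochhammer a (Suc n) * pochhammer b (Suc n) / fact (Suc n)) / pochhammer (c + real m) (Suc n)"
      by (simp add: hgc_def)
    also have "\<dots> \<le> (pochhammer a (Suc n) * pochhammer b (Suc n) / fact (Suc n)) / ((c + real m) / c * pochhammer c (Suc n))"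
      using p abc by (intro divide_left_mono A) (auto intro!: divide_nonneg_nonneg mult_nonneg_nonneg less_imp_le[OF pochhammer_pos] mult_pos_pos)
    also have "\<dots> = c / (c + real m) * hgc a b c (Suc n)"
      using abc by (simp add: hgc_def field_simps)
    finally show ?thesis .
  qed
  show "eventually (\<lambda>m. 1 \<le> hgf_sum1 a b (c + real m)) sequentially"
    unfolding split using nn S by (intro always_eventually allI) (auto intro!: suminf_nonneg simp: summable_Suc_iff)
  show "eventually (\<lambda>m. hgf_sum1 a b (c + real m) \<le> 1 + c / (c + real m) * (\<Sum>n. hgc a b c (Suc n))) sequentially"
  proof (intro always_eventually allI)
    fix m
    have s: "summable (\<lambda>n. hgc a b c (Suc n))" using S0 by (simp add: summable_Suc_iff)
    have "(\<Sum>n. hgc a b (c + real m) (Suc n)) \<le> (\<Sum>n. c / (c + real m) * hgc a b c (Suc n))"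
      by (intro suminf_le le summable_mult s) (use S in \<open>simp add: summable_Suc_iff\<close>)
    also have "\<dots> = c / (c + real m) * (\<Sum>n. hgc a b c (Suc n))"
      by (rule suminf_mult[OF s])
    finally show "hgf_sum1 a b (c + real m) \<le> 1 + c / (c + real m) * (\<Sum>n. hgc a b c (Suc n))"
      unfolding split by simp
  qed
  have "(\<lambda>m. 1 + c / (c + real m) * (\<Sum>n. hgc a b c (Suc n))) \<longlonglongrightarrow> 1 + 0 * (\<Sum>n. hgc a b c (Suc n))"
    by (intro tendsto_intros) real_asymp
  thus "(\<lambda>m. 1 + c / (c + real m) * (\<Sum>n. hgc a b c (Suc n))) \<longlonglongrightarrow> 1" by simp
qed (rule tendsto_const)

text \<open>The limit of \<open>hgf_sum1_shift\<close>: the Pochhammer products turn into reciprocal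
  Gamma functions, while the shifted sum tends to 1.\<close>

theorem gauss_sum:
  assumes abc: "a > 0" "b > 0" "c > 0" and d: "c - a - b > 0"
  shows "hgf_sum1 a b c = Gamma c * Gamma (c - a - b) / (Gamma (c - a) * Gamma (c - b))"
proof -
  have nz: "x > 0 \<Longrightarrow> x \<notin> \<int>\<^sub>\<le>\<^sub>0" for x :: real by (auto elim!: nonpos_Ints_cases)
  have R: "(\<lambda>m. rGamma_series x m) \<longlonglongrightarrow> rGamma x" for x :: real by (rule rGamma_series_LIMSEQ)
  \<comment> \<open>\<open>rGamma_series x m\<close> contains \<open>pochhammer x (Suc m)\<close>,
    hence the shift by \<open>Suc m\<close>.\<close>
  have "(\<lambda>m. hgf_sum1 a b (c + real (Suc m)) * (rGamma_series (c - a) m * rGamma_series (c - b) m))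
          \<longlonglongrightarrow> 1 * (rGamma (c - a) * rGamma (c - b))"
    by (intro tendsto_mult R LIMSEQ_Suc[OF hgf_sum1_tendsto_1] assms)
  moreover have "(\<lambda>m. hgf_sum1 a b c * (rGamma_series c m * rGamma_series (c - a - b) m))
          \<longlonglongrightarrow> hgf_sum1 a b c * (rGamma c * rGamma (c - a - b))"
    by (intro tendsto_mult R tendsto_const)
  moreover have "eventually (\<lambda>m. hgf_sum1 a b c * (rGamma_series c m * rGamma_series (c - a - b) m) =
      hgf_sum1 a b (c + real (Suc m)) * (rGamma_series (c - a) m * rGamma_series (c - b) m)) sequentially"
    using eventually_gt_at_top[of 0]
  proof eventually_elim
    case (elim m)
    have f: "rGamma_series x m = pochhammer x (Suc m) / (fact m * real m powr x)" for x :: real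
      using elim by (simp add: rGamma_series_def powr_def)
    \<comment> \<open>The powers of m on the two sides agree because c + (c - a - b) = (c - a) + (c
      - b).\<close>
    have pw: "real m powr c * real m powr (c - a - b) = real m powr (c - a) * real m powr (c - b)"
      by (simp flip: powr_add add: algebra_simps)
    have "hgf_sum1 a b c * (rGamma_series c m * rGamma_series (c - a - b) m) =
       (hgf_sum1 a b c * (pochhammer c (Suc m) * pochhammer (c - a - b) (Suc m))) / (fact m * fact m * (real m powr c * real m powr (c - a - b)))"
      unfolding f by (simp only: times_divide_eq_right times_divide_eq_left divide_divide_eq_left times_divide_times_eq mult_ac)
    also have "\<dots> = hgf_sum1 a b (c + real (Suc m)) * (rGamma_series (c - a) m * rGamma_series (c - b) m)"
      unfolding f hgf_sum1_shift[OF assms] pw by (simp only: times_divide_eq_right times_divide_eq_left divide_divide_eq_left times_divide_times_eq mult_ac)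
    finally show ?case .
  qed
  ultimately have "hgf_sum1 a b c * (rGamma c * rGamma (c - a - b)) = 1 * (rGamma (c - a) * rGamma (c - b))"
    using LIMSEQ_unique tendsto_cong by fast
  thus ?thesis using assms
    by (simp add: Gamma_def field_simps rGamma_eq_zero_iff nz)
qed

subsection \<open>The connection coefficient\<close>

lemma Gamma_reflection_real:
  "Gamma x * Gamma (1 - x) = pi / sin (pi * x)" for x :: real
proof -
  have "Gamma (1 - complex_of_real x) = of_real (Gamma (1 - x))"
    by (metis Gamma_complex_of_real of_real_1 of_real_diff)
  hence "complex_of_real (Gamma x * Gamma (1 - x)) = Gamma (of_real x) * Gamma (1 - of_real x)"
    by (simp add: Gamma_complex_of_real)
  also have "\<dots> = of_real (pi / sin (pi * x))"
    by (subst Gamma_reflection_complex) (simp flip: sin_of_real)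
  finally show ?thesis by (simp only: of_real_eq_iff)
qed

text \<open>For t = pi/5 the angles 3t and 2t add up to pi, so cos 3t = - cos 2t; this cubic in cos
  t has the factor x + 1, and the remaining quadratic has one positive root.\<close>

lemma cos_pi_5: "cos (pi / 5) = (1 + sqrt 5) / 4"
proof -
  define x where "x = cos (pi / 5)"
  have x0: "x > 0" unfolding x_def by (rule cos_gt_zero) auto
  have "cos (3 * (pi / 5)) = - cos (2 * (pi / 5))"
    using cos_pi_minus[of "2 * (pi / 5)"] by (simp add: field_simps)
  hence "4 * x ^ 3 - 3 * x = - (2 * x\<^sup>2 - 1)"
    unfolding cos_treble_cos cos_double_cos x_def .
  hence "(x + 1) * (4 * x\<^sup>2 - 2 * x - 1) = 0" by (simp add: algebra_simps power2_eq_square power3_eq_cube)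
  hence "4 * x\<^sup>2 - 2 * x - 1 = 0" using x0 by simp
  hence "(4 * x - 1)\<^sup>2 = 5" by (simp add: power2_eq_square algebra_simps)
  hence "\<bar>4 * x - 1\<bar> = sqrt 5" by (metis real_sqrt_abs)
  moreover have "4 * x - 1 > 0"
  proof (rule ccontr)
    assume "\<not> 4 * x - 1 > 0"
    hence "x \<le> 1/4" by simp
    hence "x * (4 * x - 2) \<le> 0" using x0 by (intro mult_nonneg_nonpos) auto
    with \<open>4 * x\<^sup>2 - 2 * x - 1 = 0\<close> show False by (simp add: power2_eq_square algebra_simps)
  qed
  ultimately show ?thesis by (simp add: x_def)
qed

lemma cos_pi_10: "cos (pi / 10) = sqrt 2 * sqrt (5 + sqrt 5) / 4"
proof -
  have "cos (2 * (pi / 10)) = 2 * (cos (pi / 10))\<^sup>2 - 1" by (rule cos_double_cos)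
  hence "(cos (pi / 10))\<^sup>2 = 2 * (5 + sqrt 5) / 16" using cos_pi_5 by simp
  moreover have "cos (pi / 10) > 0" by (rule cos_gt_zero) auto
  ultimately have "cos (pi / 10) = sqrt (2 * (5 + sqrt 5) / 16)"
    by (metis less_eq_real_def real_sqrt_abs abs_of_pos)
  also have "\<dots> = sqrt 2 * sqrt (5 + sqrt 5) / 4"
    by (simp only: real_sqrt_divide real_sqrt_mult) simp
  finally show ?thesis .
qed

text \<open>The Gamma arguments of the two Gauss values pair off to sums 1, so reflection turns
  their product into sines. The product-to-sum formula yields cos(pi/10) + cos(pi/6), and since
  cos(pi/6) = sin(pi/3) the second summand is cancelled by the -1.\<close>

lemma connection_value:
  "2 * hgf_sum1 (1/30) (2/15) (2/3) * hgf_sum1 (1/30) (2/15) (1/2) - 1 = sqrt 2 * sqrt (5 + sqrt 5) / (2 * sqrt 3)"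
proof -
  have nz: "Gamma x \<noteq> 0" if "x > 0" for x :: real using Gamma_real_pos[OF that] by simp
  have G: "hgf_sum1 (1/30) (2/15) (2/3) = Gamma (2/3) * Gamma (1/2) / (Gamma (19/30) * Gamma (8/15))"
          "hgf_sum1 (1/30) (2/15) (1/2) = Gamma (1/2) * Gamma (1/3) / (Gamma (7/15) * Gamma (11/30))"
    by (subst gauss_sum; simp)+
  have R: "Gamma (1/2) * Gamma (1/2) = pi" "Gamma (1/3) * Gamma (2/3) = pi / sin (pi / 3)"
     "Gamma (7/15) * Gamma (8/15) = pi / sin (pi * (7/15))"
     "Gamma (11/30) * Gamma (19/30) = pi / sin (pi * (11/30))"
    using Gamma_reflection_real[of "1/2"] Gamma_reflection_real[of "1/3"]
      Gamma_reflection_real[of "7/15"] Gamma_reflection_real[of "11/30"] by simp_all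
  have s: "sin (pi * (7/15)) > 0" "sin (pi * (11/30)) > 0"
    by (intro sin_gt_zero; simp)+
  have "hgf_sum1 (1/30) (2/15) (2/3) * hgf_sum1 (1/30) (2/15) (1/2) =
    (Gamma (1/2) * Gamma (1/2)) * (Gamma (1/3) * Gamma (2/3)) / ((Gamma (7/15) * Gamma (8/15)) * (Gamma (11/30) * Gamma (19/30)))"
    unfolding G by (simp add: mult_ac)
  also have "\<dots> = sin (pi * (7/15)) * sin (pi * (11/30)) / sin (pi / 3)"
    unfolding R using s by (simp add: field_simps)
  also have "sin (pi * (7/15)) * sin (pi * (11/30)) = (cos (pi / 10) + cos (pi / 6)) / 2"
  proof -
    have "sin (pi * (7/15)) * sin (pi * (11/30)) = (cos (pi * (7/15) - pi * (11/30)) - cos (pi * (7/15) + pi * (11/30))) / 2"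
      by (rule sin_times_sin)
    also have "pi * (7/15) - pi * (11/30) = pi / 10" by simp
    also have "pi * (7/15) + pi * (11/30) = pi - pi / 6" by simp
    also have "cos (pi - pi / 6) = - cos (pi / 6)" by (rule cos_pi_minus)
    finally show ?thesis by simp
  qed
  finally have "2 * (hgf_sum1 (1/30) (2/15) (2/3) * hgf_sum1 (1/30) (2/15) (1/2)) - 1 = 2 * cos (pi / 10) / sqrt 3"
    by (simp add: cos_30 sin_60 field_simps)
  thus ?thesis by (simp add: cos_pi_10 mult.assoc)
qed

subsection \<open>Second order linear equations\<close>

definition ode_sol where
  "ode_sol P Q f f1 x \<longleftrightarrow> (f has_real_derivative f1 x) (at x) \<and>
     (f1 has_real_derivative (P x * f1 x + Q x * f x)) (at x)"

text \<open>Abel's identity, with the integrating factor \<open>m\<close> given explicitly.\<close>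

lemma wronskian_const:
  assumes I: "open I" "connected I" "x0 \<in> I"
    and S: "\<And>x. x \<in> I \<Longrightarrow> ode_sol P Q f f1 x" and T: "\<And>x. x \<in> I \<Longrightarrow> ode_sol P Q g g1 x"
    and m: "\<And>x. x \<in> I \<Longrightarrow> (m has_real_derivative - P x * m x) (at x)"
    and x: "x \<in> I"
  shows "m x * (f x * g1 x - f1 x * g x) = m x0 * (f x0 * g1 x0 - f1 x0 * g x0)"
proof -
  let ?W = "\<lambda>x. m x * (f x * g1 x - f1 x * g x)"
  have D: "(?W has_real_derivative 0) (at x)" if "x \<in> I" for x
  proof -
    have "(?W has_real_derivative
       (- P x * m x) * (f x * g1 x - f1 x * g x) +
       ((f1 x * g1 x + (P x * g1 x + Q x * g x) * f x) - ((P x * f1 x + Q x * f x) * g x + g1 x * f1 x)) * m x) (at x)"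
      using S[OF that] T[OF that] m[OF that] unfolding ode_sol_def
      by (intro DERIV_mult DERIV_diff) auto
    thus ?thesis by (simp add: algebra_simps)
  qed
  have C: "continuous_on I ?W"
    by (intro continuous_at_imp_continuous_on ballI DERIV_isCont[OF D])
  obtain c where c: "\<And>x. x \<in> I \<Longrightarrow> ?W x = c"
    by (rule DERIV_zero_connected_constant[OF I(2,1) finite.emptyI C]) (use D in auto)
  show ?thesis using c[OF x] c[OF I(3)] by simp
qed

text \<open>The coefficients are those of Cramer's rule at \<open>x0\<close>; they are constant
  because each weighted Wronskian in them is.\<close>

lemma ode_sol_span:
  assumes I: "open I" "connected I" "x0 \<in> I"
    and S: "\<And>x. x \<in> I \<Longrightarrow> ode_sol P Q f f1 x" and T: "\<And>x. x \<in> I \<Longrightarrow> ode_sol P Q g g1 x"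
    and R: "\<And>x. x \<in> I \<Longrightarrow> ode_sol P Q r r1 x"
    and m: "\<And>x. x \<in> I \<Longrightarrow> (m has_real_derivative - P x * m x) (at x)" "\<And>x. x \<in> I \<Longrightarrow> m x \<noteq> 0"
    and W: "f x0 * g1 x0 - f1 x0 * g x0 \<noteq> 0"
  shows "\<exists>a b. \<forall>x\<in>I. r x = a * f x + b * g x \<and> r1 x = a * f1 x + b * g1 x"
proof -
  let ?w = "m x0 * (f x0 * g1 x0 - f1 x0 * g x0)"
  define a where "a = m x0 * (r x0 * g1 x0 - r1 x0 * g x0) / ?w"
  define b where "b = m x0 * (f x0 * r1 x0 - f1 x0 * r x0) / ?w"
  have w: "?w \<noteq> 0" using W m(2)[OF I(3)] by simp
  show ?thesis
  proof (rule exI[of _ a], rule exI[of _ b], rule ballI)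
    fix x assume x: "x \<in> I"
    have 1: "m x * (f x * g1 x - f1 x * g x) = ?w"
      by (rule wronskian_const[OF I S T m(1) x])
    have 2: "m x * (r x * g1 x - r1 x * g x) = a * ?w"
      using wronskian_const[OF I R T m(1) x] w by (simp add: a_def)
    have 3: "m x * (f x * r1 x - f1 x * r x) = b * ?w"
      using wronskian_const[OF I S R m(1) x] w by (simp add: b_def)
    have "(a * f x + b * g x) * ?w = (a * ?w) * f x + (b * ?w) * g x" by (simp add: algebra_simps)
    also have "\<dots> = (m x * (r x * g1 x - r1 x * g x)) * f x + (m x * (f x * r1 x - f1 x * r x)) * g x"
      by (simp only: 2 3)
    also have "\<dots> = r x * (m x * (f x * g1 x - f1 x * g x))" by (simp add: algebra_simps)
    also have "\<dots> = r x * ?w" by (simp only: 1)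
    finally have A: "r x = a * f x + b * g x" using w by simp
    have "(a * f1 x + b * g1 x) * ?w = (a * ?w) * f1 x + (b * ?w) * g1 x" by (simp add: algebra_simps)
    also have "\<dots> = (m x * (r x * g1 x - r1 x * g x)) * f1 x + (m x * (f x * r1 x - f1 x * r x)) * g1 x"
      by (simp only: 2 3)
    also have "\<dots> = r1 x * (m x * (f x * g1 x - f1 x * g x))" by (simp add: algebra_simps)
    also have "\<dots> = r1 x * ?w" by (simp only: 1)
    finally have "r1 x = a * f1 x + b * g1 x" using w by simp
    with A show "r x = a * f x + b * g x \<and> r1 x = a * f1 x + b * g1 x" ..
  qed
qed

text \<open>Both difference functions vanish at \<open>c\<close> together with their derivative, so
  the two coefficient pairs solve the same linear system, whose determinant is the Wronskian. At
  \<open>c\<close> itself \<open>f\<close> is only assumed differentiable, which suits functions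
  given there by an explicit formula.\<close>

lemma ode_sol_cross:
  fixes f :: "real \<Rightarrow> real"
  assumes ab: "l < c" "c < u"
    and G: "(G has_real_derivative G1) (at c)" and H: "(H has_real_derivative H1) (at c)"
    and f: "(f has_real_derivative f1) (at c)"
    and W: "G c * H1 - G1 * H c \<noteq> 0"
    and L: "\<And>x. l < x \<Longrightarrow> x < c \<Longrightarrow> f x = a * G x + b * H x"
    and R: "\<And>x. c < x \<Longrightarrow> x < u \<Longrightarrow> f x = a' * G x + b' * H x"
  shows "a = a' \<and> b = b' \<and> f c = a * G c + b * H c"
proof -
  let ?d = "\<lambda>a b x. f x - a * G x - b * H x"
  have D: "(?d a b has_real_derivative f1 - a * G1 - b * H1) (at c)" for a b
    by (intro DERIV_diff DERIV_cmult f G H)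
  have C: "(?d a b \<longlongrightarrow> ?d a b c) (at c)" for a b
    using DERIV_isCont[OF D[of a b]] by (simp add: isCont_def)
  have eL: "eventually (\<lambda>x. ?d a b x = 0) (at_left c)"
    using L ab by (intro eventually_at_leftI[of l]) auto
  have eR: "eventually (\<lambda>x. ?d a' b' x = 0) (at_right c)"
    using R ab by (intro eventually_at_rightI[of _ u]) auto
  have vL: "?d a b c = 0"
    using tendsto_unique[OF _ tendsto_mono[OF at_le[of "{..<c}" UNIV] C[of a b]] tendsto_eventually[OF eL]] by simp
  have vR: "?d a' b' c = 0"
    using tendsto_unique[OF _ tendsto_mono[OF at_le[of "{c<..}" UNIV] C[of a' b']] tendsto_eventually[OF eR]] by simp
  have DL: "((\<lambda>x. (?d a b x - ?d a b c) / (x - c)) \<longlongrightarrow> f1 - a * G1 - b * H1) (at c)"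
    using D[of a b] by (simp only: has_field_derivative_iff)
  have DR: "((\<lambda>x. (?d a' b' x - ?d a' b' c) / (x - c)) \<longlongrightarrow> f1 - a' * G1 - b' * H1) (at c)"
    using D[of a' b'] by (simp only: has_field_derivative_iff)
  have zL: "((\<lambda>x. (?d a b x - ?d a b c) / (x - c)) \<longlongrightarrow> 0) (at_left c)"
    by (rule tendsto_eventually) (use eL vL in \<open>auto elim: eventually_mono\<close>)
  have zR: "((\<lambda>x. (?d a' b' x - ?d a' b' c) / (x - c)) \<longlongrightarrow> 0) (at_right c)"
    by (rule tendsto_eventually) (use eR vR in \<open>auto elim: eventually_mono\<close>)
  have dL: "f1 - a * G1 - b * H1 = 0"
    using tendsto_unique[OF _ tendsto_mono[OF at_le[of "{..<c}" UNIV] DL] zL] by simp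
  have dR: "f1 - a' * G1 - b' * H1 = 0"
    using tendsto_unique[OF _ tendsto_mono[OF at_le[of "{c<..}" UNIV] DR] zR] by simp
  have 1: "(a - a') * G c + (b - b') * H c = 0" using vL vR by (simp add: algebra_simps)
  have 2: "(a - a') * G1 + (b - b') * H1 = 0" using dL dR by (simp add: algebra_simps)
  have "(a - a') * (G c * H1 - G1 * H c) = ((a - a') * G c + (b - b') * H c) * H1 - ((a - a') * G1 + (b - b') * H1) * H c"
    by (simp add: algebra_simps)
  hence "a = a'" unfolding 1 2 using W by simp
  have "(b - b') * (G c * H1 - G1 * H c) = ((a - a') * G1 + (b - b') * H1) * G c - ((a - a') * G c + (b - b') * H c) * G1"
    by (simp add: algebra_simps)
  hence "b = b'" unfolding 1 2 using W by simp
  with \<open>a = a'\<close> vL show ?thesis by simp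
qed

subsection \<open>Local solutions of the hypergeometric equation\<close>

text \<open>
  The equation for the parameters 1/30, 2/15; 1/2 in z. The local solutions are su, sv at infinity,
  sp, sq at 1 (exponents 0 and 1/3) and se, so at 0 (exponents 0 and 1/2); su is the
  series of the theorem in 1/z, up to a power of z.
\<close>

definition HP :: "real \<Rightarrow> real" where "HP z = (7/6 * z - 1/2) / (z * (1 - z))"
definition HQ :: "real \<Rightarrow> real" where "HQ z = 1 / (225 * z * (1 - z))"

abbreviation "hsol \<equiv> ode_sol HP HQ"

text \<open>The weight that makes Wronskians constant (\<open>Hm_deriv\<close>); the absolute value
  serves both sides of z = 1.\<close>

definition Hm :: "real \<Rightarrow> real" where "Hm z = sqrt z * \<bar>1 - z\<bar> powr (2/3)"

lemma inverse_pf: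
  "z \<noteq> 0 \<Longrightarrow> z \<noteq> 1 \<Longrightarrow> inverse z * inverse (1 - z) = inverse z + inverse (1 - z)" for z :: real
  by (simp add: field_simps)

lemma HP_pf: "z \<noteq> 0 \<Longrightarrow> z \<noteq> 1 \<Longrightarrow> HP z = 2/3 * inverse (1 - z) - inverse z / 2"
  and HQ_pf: "z \<noteq> 0 \<Longrightarrow> z \<noteq> 1 \<Longrightarrow> HQ z = (inverse z + inverse (1 - z)) / 225"
  by (simp_all add: HP_def HQ_def field_simps)

lemma abs_powr_deriv:
  fixes z :: real assumes "z \<noteq> 1"
  shows "((\<lambda>z. \<bar>1 - z\<bar> powr e) has_real_derivative - (e * \<bar>1 - z\<bar> powr e / (1 - z))) (at z)"
proof (cases "z < 1")
  case True
  have "((\<lambda>z. (1 - z) powr e) has_real_derivative - (e * (1 - z) powr e / (1 - z))) (at z)"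
    by (rule derivative_eq_intros refl | use True in \<open>simp add: powr_diff\<close>)+
  thus ?thesis
    by (rule DERIV_cong_ev[THEN iffD1, rotated -1])
       (use True in \<open>auto intro!: eventually_mono[OF eventually_nhds_in_open[of "{..<1}" z]]\<close>)
next
  case False
  hence z: "z > 1" using assms by simp
  have "((\<lambda>z. (z - 1) powr e) has_real_derivative (e * (z - 1) powr e / (z - 1))) (at z)"
    by (rule derivative_eq_intros refl | use z in \<open>simp add: powr_diff\<close>)+
  hence "((\<lambda>z. (z - 1) powr e) has_real_derivative - (e * \<bar>1 - z\<bar> powr e / (1 - z))) (at z)"
    by (rule DERIV_cong) (use z in \<open>simp add: abs_if field_simps\<close>)
  thus ?thesis
    by (rule DERIV_cong_ev[THEN iffD1, rotated -1])
       (use z in \<open>auto intro!: eventually_mono[OF eventually_nhds_in_open[of "{1<..}" z]]\<close>)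
qed

lemma Hm_deriv:
  assumes "z > 0" "z \<noteq> 1"
  shows "(Hm has_real_derivative - HP z * Hm z) (at z)"
proof -
  define i k where "i = inverse z" and "k = inverse (1 - z)"
  have ik: "z * i = 1" "(1 - z) * k = 1" using assms by (auto simp: i_def k_def)
  have sq: "(sqrt has_real_derivative sqrt z * i / 2) (at z)"
    by (rule DERIV_cong[OF DERIV_real_sqrt]) (use assms in \<open>auto simp: field_simps i_def\<close>)
  have ab: "((\<lambda>z. \<bar>1 - z\<bar> powr (2/3)) has_real_derivative - (2/3 * \<bar>1 - z\<bar> powr (2/3) * k)) (at z)"
    by (rule DERIV_cong[OF abs_powr_deriv]) (use assms in \<open>simp_all add: k_def field_simps\<close>)
  have "sqrt z * i / 2 * \<bar>1 - z\<bar> powr (2/3) + - (2/3 * \<bar>1 - z\<bar> powr (2/3) * k) * sqrt z = - HP z * Hm z"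
    unfolding HP_pf[OF less_imp_neq[OF assms(1), symmetric] assms(2)] Hm_def i_def[symmetric] k_def[symmetric] by (simp add: algebra_simps)
  thus ?thesis
    unfolding Hm_def[abs_def] by (intro DERIV_cong[OF DERIV_mult[OF sq ab]]) (simp only: Hm_def)
qed

lemma Hm_nz: "z > 0 \<Longrightarrow> z \<noteq> 1 \<Longrightarrow> Hm z \<noteq> 0"
  by (simp add: Hm_def)

definition "se = hgf (1/30) (2/15) (1/2)"
definition "se1 = hgf' (1/30) (2/15) (1/2)"

definition "so z = sqrt z * hgf (8/15) (19/30) (3/2) z"
definition "so1 z = sqrt z * (hgf (8/15) (19/30) (3/2) z * inverse z / 2 + hgf' (8/15) (19/30) (3/2) z)"

lemma hgf_ode_pf:
  assumes "c > 0" "\<bar>x\<bar> < 1" "x \<noteq> 0"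
  shows "(hgf' a b c has_real_derivative
     ((a + b + 1 - c) * inverse (1 - x) - c * inverse x) * hgf' a b c x +
     a * b * (inverse x + inverse (1 - x)) * hgf a b c x) (at x)"
proof -
  obtain s where s: "(hgf' a b c has_real_derivative s) (at x)"
    "x * (1 - x) * s = ((a + b + 1) * x - c) * hgf' a b c x + a * b * hgf a b c x"
    using hgf_ode[OF assms(1,2)] by blast
  define i k where "i = inverse x" and "k = inverse (1 - x)"
  have "x \<noteq> 1" using assms by auto
  hence ik: "x * i = 1" "(1 - x) * k = 1" using assms(3) by (simp_all add: i_def k_def)
  have "s = (x * i) * ((1 - x) * k) * s" by (simp add: ik)
  also have "\<dots> = (x * (1 - x) * s) * (i * k)" by (simp only: mult_ac)
  also have "\<dots> = ((a + b + 1) * ((x * i) * k) - c * (i * k)) * hgf' a b c x + a * b * (i * k) * hgf a b c x"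
    unfolding s(2) by (simp add: algebra_simps)
  also have "i * k = i + k" using inverse_pf[OF assms(3) \<open>x \<noteq> 1\<close>] by (simp add: i_def k_def)
  finally have "s = ((a + b + 1 - c) * k - c * i) * hgf' a b c x + a * b * (i + k) * hgf a b c x"
    unfolding ik by (simp add: algebra_simps)
  with s show ?thesis by (simp add: i_def k_def)
qed

lemma se_sol: assumes "0 < z" "z < 1" shows "hsol se se1 z"
proof -
  have z: "z \<noteq> 0" "z \<noteq> 1" using assms by auto
  have "(hgf' (1/30) (2/15) (1/2) has_real_derivative HP z * se1 z + HQ z * se z) (at z)"
    by (rule DERIV_cong[OF hgf_ode_pf]) (use assms in \<open>auto simp: HP_pf HQ_pf z se_def se1_def algebra_simps\<close>)
  thus ?thesis
    using hgf_deriv[of "1/2" z] assms by (simp add: ode_sol_def se_def se1_def)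
qed

lemma sqrt_deriv: "z > 0 \<Longrightarrow> (sqrt has_real_derivative sqrt z * inverse z / 2) (at z)"
  by (rule DERIV_cong[OF DERIV_real_sqrt]) (auto simp: field_simps)

lemma inverse_deriv: "z \<noteq> 0 \<Longrightarrow> (inverse has_real_derivative - (inverse z)\<^sup>2) (at (z::real))"
  using DERIV_inverse[of z] by (simp add: numeral_2_eq_2)

text \<open>With i = 1/z and k = 1/(1-z) the differential equation becomes a polynomial identity
  modulo \<open>i * k = i + k\<close>; the intermediate claim displays the cofactor of this
  relation. \<open>aux_sq\<close> and \<open>aux_si\<close> work the same way.\<close>

lemma aux_so:
  fixes m i k F F' :: real assumes ik: "i * k = i + k"
  shows "m * i / 2 * (F * i / 2 + F') + ((F' * i + - i\<^sup>2 * F) / 2 + ((2/3 * k - 3/2 * i) * F' + 76/225 * (i + k) * F)) * m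
    = (2/3 * k - i / 2) * (m * (F * i / 2 + F')) + (i + k) / 225 * (m * F)" (is "?L = ?R")
proof -
  have "?L - ?R = - (1/3) * m * F * (i * k - (i + k))"
    by (simp add: field_simps power2_eq_square)
  thus ?thesis by (simp only: ik) simp
qed

lemma aux_sq:
  fixes m i k F F' :: real assumes ik: "i * k = i + k"
  shows "- (m * k / 3) * (- (F * k / 3) - F') + (- ((- F' * k + k\<^sup>2 * F) / 3) - - ((1/2 * i - 4/3 * k) * F' + 77/450 * (i + k) * F)) * m
    = (2/3 * k - i / 2) * (m * (- (F * k / 3) - F')) + (i + k) / 225 * (m * F)" (is "?L = ?R")
proof -
  have "?L - ?R = - (1/6) * m * F * (i * k - (i + k))"
    by (simp add: field_simps power2_eq_square)
  thus ?thesis by (simp only: ik) simp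
qed

lemma aux_si:
  fixes m i k F F' a c :: real
  assumes ik: "i * k = i + k" and ac: "a = 1/30 \<and> c = 9/10 \<or> a = 2/15 \<and> c = 11/10"
  shows "m * (- a * i) * (- a * (F * i) - F' * i\<^sup>2) +
      (- a * (F' * - i\<^sup>2 * i + - i\<^sup>2 * F) -
       (- (((- (2 * a + 3/2 - c) * k - c) * F' + a * (a + 1/2) * (1 - k) * F) * i) * i\<^sup>2 + 2 * i * - i\<^sup>2 * F')) * m
     = (2/3 * k - i / 2) * (m * (- a * (F * i) - F' * i\<^sup>2)) + (i + k) / 225 * (m * F)" (is "?L = ?R")
proof -
  have "?L - ?R = m * (- (2/3) * i\<^sup>2 * F' + (2/3 * a - a * (a + 1/2) * (i\<^sup>2 + i + 1)) * F) * (i * k - (i + k))"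
    using ac by (elim disjE conjE; hypsubst; simp add: field_simps power2_eq_square)
  thus ?thesis by (simp only: ik) simp
qed

lemma so_sol: assumes "0 < z" "z < 1" shows "hsol so so1 z"
proof -
  let ?F = "hgf (8/15) (19/30) (3/2)" and ?F' = "hgf' (8/15) (19/30) (3/2)"
  have z: "z \<noteq> 0" "z \<noteq> 1" using assms by auto
  define i k where "i = inverse z" and "k = inverse (1 - z)"
  have ik: "i * k = i + k" unfolding i_def k_def by (rule inverse_pf[OF z])
  define s where "s = (2/3 * k - 3/2 * i) * ?F' z + 76/225 * (i + k) * ?F z"
  have s: "(?F' has_real_derivative s) (at z)"
    by (rule DERIV_cong[OF hgf_ode_pf]) (use assms in \<open>auto simp: s_def i_def k_def algebra_simps\<close>)
  have F: "(?F has_real_derivative ?F' z) (at z)" using hgf_deriv[of "3/2" z] assms by simp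
  have inv: "(inverse has_real_derivative - i\<^sup>2) (at z)" unfolding i_def by (rule inverse_deriv) (use assms in simp)
  have sq: "(sqrt has_real_derivative sqrt z * i / 2) (at z)" unfolding i_def by (rule sqrt_deriv) fact
  have 1: "(so has_real_derivative so1 z) (at z)"
    unfolding so_def[abs_def] by (rule DERIV_cong[OF DERIV_mult[OF sq F]]) (simp add: so1_def i_def algebra_simps)
  have "(so1 has_real_derivative (sqrt z * i / 2) * (?F z * inverse z / 2 + ?F' z) +
      ((?F' z * inverse z + - i\<^sup>2 * ?F z) / 2 + s) * sqrt z) (at z)"
    unfolding so1_def[abs_def]
    by (intro DERIV_mult sq DERIV_add DERIV_cdivide F s inv)
  moreover have "(sqrt z * i / 2) * (?F z * inverse z / 2 + ?F' z) +
      ((?F' z * inverse z + - i\<^sup>2 * ?F z) / 2 + s) * sqrt z = HP z * so1 z + HQ z * so z"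
    unfolding s_def HP_pf[OF z] HQ_pf[OF z] so_def so1_def i_def[symmetric] k_def[symmetric] by (rule aux_so[OF ik])
  ultimately show ?thesis using 1 by (simp add: ode_sol_def)
qed

definition "sp z = hgf (1/30) (2/15) (2/3) (1 - z)"
definition "sp1 z = - hgf' (1/30) (2/15) (2/3) (1 - z)"

lemma sp_sol: assumes "0 < z" "z < 2" "z \<noteq> 1" shows "hsol sp sp1 z"
proof -
  let ?F = "hgf (1/30) (2/15) (2/3)" and ?F' = "hgf' (1/30) (2/15) (2/3)"
  have a: "\<bar>1 - z\<bar> < 1" using assms by auto
  have z: "z \<noteq> 0" "z \<noteq> 1" using assms by auto
  define s where "s = - HP z * ?F' (1 - z) + HQ z * ?F (1 - z)"
  have s: "(?F' has_real_derivative s) (at (1 - z))"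
    by (rule DERIV_cong[OF hgf_ode_pf]) (use a assms in \<open>auto simp: s_def HP_pf HQ_pf z algebra_simps\<close>)
  have F: "(?F has_real_derivative ?F' (1 - z)) (at (1 - z))" using hgf_deriv[of "2/3" "1 - z"] a by simp
  have d: "((\<lambda>z. 1 - z) has_real_derivative -1) (at z)" by (auto intro!: derivative_eq_intros)
  have 1: "(sp has_real_derivative sp1 z) (at z)"
    using DERIV_chain2[OF F d] by (simp add: sp_def[abs_def] sp1_def)
  have 2: "(sp1 has_real_derivative s) (at z)"
    using DERIV_minus[OF DERIV_chain2[OF s(1) d]] by (simp add: sp1_def[abs_def])
  have "s = HP z * sp1 z + HQ z * sp z"
    unfolding s_def sp_def sp1_def by simp
  with 1 2 show ?thesis by (simp add: ode_sol_def)
qed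

text \<open>The absolute value gives a real solution on both sides of z = 1; passing a triple point
  over 1 therefore costs a sign, which \<open>sq_signed\<close> records.\<close>

definition "sq z = \<bar>1 - z\<bar> powr (1/3) * hgf (11/30) (7/15) (4/3) (1 - z)"
definition "sq1 z = \<bar>1 - z\<bar> powr (1/3) * (- (hgf (11/30) (7/15) (4/3) (1 - z) * inverse (1 - z) / 3) - hgf' (11/30) (7/15) (4/3) (1 - z))"

lemma sq_sol: assumes "0 < z" "z < 2" "z \<noteq> 1" shows "hsol sq sq1 z"
proof -
  let ?F = "hgf (11/30) (7/15) (4/3)" and ?F' = "hgf' (11/30) (7/15) (4/3)"
  let ?m = "\<bar>1 - z\<bar> powr (1/3)"
  have a: "\<bar>1 - z\<bar> < 1" using assms by auto
  have z: "z \<noteq> 0" "z \<noteq> 1" using assms by auto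
  define i k where "i = inverse z" and "k = inverse (1 - z)"
  have ik: "i * k = i + k" unfolding i_def k_def by (rule inverse_pf[OF z])
  define s where "s = (1/2 * i - 4/3 * k) * ?F' (1 - z) + 77/450 * (i + k) * ?F (1 - z)"
  have s: "(?F' has_real_derivative s) (at (1 - z))"
    by (rule DERIV_cong[OF hgf_ode_pf]) (use a assms in \<open>auto simp: s_def i_def k_def algebra_simps\<close>)
  have d: "((\<lambda>z. 1 - z) has_real_derivative -1) (at z)" by (auto intro!: derivative_eq_intros)
  have F: "((\<lambda>z. ?F (1 - z)) has_real_derivative - ?F' (1 - z)) (at z)"
    using DERIV_chain2[OF hgf_deriv d, of "4/3"] a by simp
  have F': "((\<lambda>z. ?F' (1 - z)) has_real_derivative - s) (at z)"
    using DERIV_chain2[OF s(1) d] by simp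
  have inv: "((\<lambda>z. inverse (1 - z)) has_real_derivative k\<^sup>2) (at z)"
    using DERIV_chain2[OF inverse_deriv d] assms by (simp add: k_def)
  have m: "((\<lambda>z. \<bar>1 - z\<bar> powr (1/3)) has_real_derivative - (?m * k / 3)) (at z)"
    by (rule DERIV_cong[OF abs_powr_deriv]) (use assms in \<open>simp_all add: k_def field_simps\<close>)
  have 1: "(sq has_real_derivative sq1 z) (at z)"
    unfolding sq_def[abs_def] by (rule DERIV_cong[OF DERIV_mult[OF m F]]) (simp add: sq1_def k_def algebra_simps)
  have "(sq1 has_real_derivative - (?m * k / 3) * (- (?F (1 - z) * inverse (1 - z) / 3) - ?F' (1 - z)) +
      (- ((- ?F' (1 - z) * inverse (1 - z) + k\<^sup>2 * ?F (1 - z)) / 3) - - s) * ?m) (at z)"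
    unfolding sq1_def[abs_def]
    by (intro DERIV_mult m DERIV_diff DERIV_cdivide DERIV_minus F F' inv)
  moreover have "- (?m * k / 3) * (- (?F (1 - z) * inverse (1 - z) / 3) - ?F' (1 - z)) +
      (- ((- ?F' (1 - z) * inverse (1 - z) + k\<^sup>2 * ?F (1 - z)) / 3) - - s) * ?m = HP z * sq1 z + HQ z * sq z"
    unfolding s_def HP_pf[OF z] HQ_pf[OF z] sq_def sq1_def i_def[symmetric] k_def[symmetric] by (rule aux_sq[OF ik])
  ultimately show ?thesis using 1 by (simp add: ode_sol_def)
qed

text \<open>Kummer's solution at infinity for the exponent \<alpha>: the second parameter is
  \<alpha> - 1/2 + 1, and \<open>c\<close> stands for 1 plus the difference of the two
  exponents.\<close>

definition "si \<alpha> c z = z powr (-\<alpha>) * hgf \<alpha> (\<alpha> + 1/2) c (inverse z)"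
definition "si1 \<alpha> c z = z powr (-\<alpha>) * (- \<alpha> * (hgf \<alpha> (\<alpha> + 1/2) c (inverse z) * inverse z) - hgf' \<alpha> (\<alpha> + 1/2) c (inverse z) * (inverse z)\<^sup>2)"

lemma si_sol:
  assumes z: "1 < z" and ac: "(\<alpha>, c) \<in> {(1/30, 9/10), (2/15, 11/10)}"
  shows "hsol (si \<alpha> c) (si1 \<alpha> c) z"
proof -
  let ?F = "hgf \<alpha> (\<alpha> + 1/2) c" and ?F' = "hgf' \<alpha> (\<alpha> + 1/2) c"
  let ?m = "z powr (-\<alpha>)"
  have c: "c > 0" using ac by auto
  have z01: "z \<noteq> 0" "z \<noteq> 1" using assms by auto
  define i k where "i = inverse z" and "k = inverse (1 - z)"
  have ik: "i * k = i + k" unfolding i_def k_def by (rule inverse_pf[OF z01])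
  have a: "\<bar>i\<bar> < 1" "i \<noteq> 0" using z by (auto simp: i_def field_simps)
  define t where "t = (- (2 * \<alpha> + 3/2 - c) * k - c) * ?F' i + \<alpha> * (\<alpha> + 1/2) * (1 - k) * ?F i"
  \<comment> \<open>1/(1 - 1/z) = - z/(1 - z).\<close>
  have wi: "inverse (1 - i) = - (z * k)"
    using z unfolding i_def k_def by (simp add: field_simps)
  have zk: "z * k = k - 1" using z by (simp add: k_def field_simps)
  have s: "(?F' has_real_derivative z * t) (at i)"
    by (rule DERIV_cong[OF hgf_ode_pf[OF c a]]) (use z in \<open>simp add: wi t_def i_def[symmetric], simp add: i_def algebra_simps\<close>)
  have inv: "(inverse has_real_derivative - i\<^sup>2) (at z)" unfolding i_def by (rule inverse_deriv) (use assms in simp)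
  have F: "((\<lambda>z. ?F (inverse z)) has_real_derivative ?F' i * - i\<^sup>2) (at z)"
    using DERIV_chain2[OF hgf_deriv inv, of c \<alpha> "\<alpha> + 1/2"] a c by (simp add: i_def)
  have F': "((\<lambda>z. ?F' (inverse z)) has_real_derivative - (t * i)) (at z)"
  proof (rule DERIV_cong[OF DERIV_chain2[OF _ inv]])
    show "(?F' has_real_derivative z * t) (at (inverse z))" using s by (simp add: i_def)
    have "z * t * - i\<^sup>2 = - ((z * i) * (t * i))" by (simp add: power2_eq_square)
    also have "z * i = 1" using z by (simp add: i_def)
    finally show "z * t * - i\<^sup>2 = - (t * i)" by simp
  qed
  have m: "((\<lambda>z. z powr (-\<alpha>)) has_real_derivative ?m * (- \<alpha> * i)) (at z)"
    by (rule derivative_eq_intros refl | use z in \<open>simp add: powr_diff i_def field_simps\<close>)+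
  have p2: "((\<lambda>z. (inverse z)\<^sup>2) has_real_derivative 2 * i * - i\<^sup>2) (at z)"
    using DERIV_power[OF inv, of 2] by (simp add: i_def mult_ac)
  have 1: "(si \<alpha> c has_real_derivative si1 \<alpha> c z) (at z)"
    unfolding si_def[abs_def] by (rule DERIV_cong[OF DERIV_mult[OF m F]]) (simp add: si1_def i_def algebra_simps)
  have "(si1 \<alpha> c has_real_derivative ?m * (- \<alpha> * i) * (- \<alpha> * (?F (inverse z) * inverse z) - ?F' (inverse z) * (inverse z)\<^sup>2) +
      (- \<alpha> * (?F' i * - i\<^sup>2 * inverse z + - i\<^sup>2 * ?F (inverse z)) -
       (- (t * i) * (inverse z)\<^sup>2 + 2 * i * - i\<^sup>2 * ?F' (inverse z))) * ?m) (at z)"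
    unfolding si1_def[abs_def]
    by (intro DERIV_mult m DERIV_diff DERIV_cmult F F' p2 inv)
  moreover have "?m * (- \<alpha> * i) * (- \<alpha> * (?F (inverse z) * inverse z) - ?F' (inverse z) * (inverse z)\<^sup>2) +
      (- \<alpha> * (?F' i * - i\<^sup>2 * inverse z + - i\<^sup>2 * ?F (inverse z)) -
       (- (t * i) * (inverse z)\<^sup>2 + 2 * i * - i\<^sup>2 * ?F' (inverse z))) * ?m
     = HP z * si1 \<alpha> c z + HQ z * si \<alpha> c z"
    unfolding t_def HP_pf[OF z01] HQ_pf[OF z01] si_def si1_def i_def[symmetric] k_def[symmetric]
    by (rule aux_si[OF ik]) (use ac in auto)
  ultimately show ?thesis using 1 by (simp add: ode_sol_def)
qed

abbreviation "su \<equiv> si (1/30) (9/10)"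
abbreviation "su1 \<equiv> si1 (1/30) (9/10)"
abbreviation "sv \<equiv> si (2/15) (11/10)"
abbreviation "sv1 \<equiv> si1 (2/15) (11/10)"

subsection \<open>Pullback to the Lame equation\<close>

text \<open>
  The curve is y^2 = cubic X. The functions gg, hh, rr have the divisors
  4 P - 4 O, D0 + P - 6 O and D1 + 2 P - 5 O, where P = (81, 648), O is the point at infinity, and D0
  and D1 are reduced of degrees 5 and 3. The derivation is D = y d/dX; Dg, Dh, Dr, DDg are the
  derivatives of gg, hh, rr, Dg.
\<close>

definition cubic :: "real \<Rightarrow> real" where "cubic X = X * (X\<^sup>2 + 158 * X + 6561) / 5"
definition cubic' :: "real \<Rightarrow> real" where "cubic' X = (3 * X\<^sup>2 + 316 * X + 6561) / 5"
definition gg :: "real \<Rightarrow> real \<Rightarrow> real" where "gg X y = X\<^sup>2 + 478 * X + 6561 - 80 * y"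
definition hh :: "real \<Rightarrow> real \<Rightarrow> real" where
  "hh X y = X^3 + 697 * X\<^sup>2 - 157957 * X - 16933941 + (380 * X + 7220) * y"
definition rr :: "real \<Rightarrow> real \<Rightarrow> real" where
  "rr X y = 3 * X\<^sup>2 + 722 * X + 72171 + (X - 313) * y"

definition Dg :: "real \<Rightarrow> real \<Rightarrow> real" where "Dg X y = (2 * X + 478) * y - 40 * cubic' X"
definition Dh :: "real \<Rightarrow> real \<Rightarrow> real" where
  "Dh X y = (3 * X\<^sup>2 + 1394 * X - 157957) * y + 380 * cubic X + (190 * X + 3610) * cubic' X"
definition Dr :: "real \<Rightarrow> real \<Rightarrow> real" where
  "Dr X y = (6 * X + 722) * y + cubic X + (X - 313) * cubic' X / 2"
definition DDg :: "real \<Rightarrow> real \<Rightarrow> real" where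
  "DDg X y = 2 * cubic X + (X + 239) * cubic' X - (48 * X + 2528) * y"

text \<open>This is z - 1 = 5000 r^3/g^4 with denominators cleared: z has divisor 2 D0 - 10 P and z
  - 1 has divisor 3 D1 + O - 10 P.\<close>

lemma cover_identity:
  assumes "y\<^sup>2 = cubic X"
  shows "gg X y * (hh X y)\<^sup>2 = gg X y ^ 4 + 5000 * rr X y ^ 3"
  using assms unfolding cubic_def gg_def hh_def rr_def by algebra

text \<open>Equivalent to D z = -500 h r^2/g^4 for z = h^2/g^3; the zeros are the ramification
  points over 0 and 1. \<open>Dr_identity\<close> is the same derivative computed from z - 1 = 5000
  r^3/g^4.\<close>

lemma Dh_identity:
  assumes "y\<^sup>2 = cubic X"
  shows "2 * gg X y * Dh X y = 3 * hh X y * Dg X y - 500 * (rr X y)\<^sup>2"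
  using assms unfolding cubic_def cubic'_def gg_def hh_def rr_def Dh_def Dg_def by algebra

lemma Dr_identity:
  assumes "y\<^sup>2 = cubic X"
  shows "gg X y * hh X y = 40 * rr X y * Dg X y - 30 * gg X y * Dr X y"
  using assms unfolding cubic_def cubic'_def gg_def hh_def rr_def Dr_def Dg_def by algebra

text \<open>The coefficient of S in D^2 (g^(-1/12) S(z)), which produces the Lame potential. Here
  13/144 = 1/144 + 1/12 collects the contributions of D g/g, and r enters through the term
  \<open>HQ z\<close> * (D z)^2.\<close>

lemma lame_identity:
  assumes "y\<^sup>2 = cubic X"
  shows "13 / 144 * (Dg X y)\<^sup>2 - gg X y * DDg X y / 12 - 2 / 9 * rr X y * gg X y = (- X / 90 - 13 / 20) * (gg X y)\<^sup>2"
  using assms unfolding cubic_def cubic'_def gg_def hh_def rr_def DDg_def Dg_def by algebra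

text \<open>The conjugate has divisor 4 (-P) - 4 O, so the norm of \<open>gg\<close> is a fourth
  power; on the positive real arc \<open>gg\<close> can vanish at X = 81 only.\<close>

lemma gg_conj:
  assumes "y\<^sup>2 = cubic X"
  shows "gg X y * gg X (- y) = (X - 81) ^ 4"
  using assms unfolding cubic_def gg_def by algebra

text \<open>\<open>A\<close> stands for dz/dX, \<open>l\<close> for a twelfth of the logarithmic
  derivative of g, \<open>A'\<close> and \<open>l'\<close> for their derivatives, \<open>c\<close>
  for \<open>cubic'\<close>. The first two conclusions are the coefficients of S' and S in the
  pulled-back equation minus the Lame equation. The inverses \<open>gi\<close>, \<open>yi\<close>
  are variables, so that everything is polynomial.\<close>

lemma pullback_algebra:
  fixes g gi h r D Dh D2 Dr y yi c q A A' l l' z hp hq :: real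
  assumes g: "g * gi = 1"
    and i1: "g * h\<^sup>2 = g ^ 4 + 5000 * r ^ 3"
    and i2: "2 * g * Dh = 3 * h * D - 500 * r\<^sup>2"
    and i3: "g * h = 40 * r * D - 30 * g * Dr"
    and i4: "13 / 144 * D\<^sup>2 - g * D2 / 12 - 2 / 9 * r * g = q * g\<^sup>2"
    and z: "z = h\<^sup>2 * gi ^ 3" and hr: "h \<noteq> 0" "r \<noteq> 0"
    and A: "A = - 500 * h * r\<^sup>2 * gi ^ 4 * yi"
    and A': "A' = - 500 * yi\<^sup>2 * (Dh * r\<^sup>2 * gi ^ 4 + 2 * h * r * Dr * gi ^ 4 - 4 * h * r\<^sup>2 * D * gi ^ 5) + 250 * h * r\<^sup>2 * gi ^ 4 * yi ^ 3 * c"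
    and l: "l = D * gi * yi / 12"
    and l': "l' = (D2 * gi - D\<^sup>2 * gi\<^sup>2) * yi\<^sup>2 / 12 - D * gi * yi ^ 3 * c / 24"
    and yi: "yi \<noteq> 0"
  shows "HP z * A\<^sup>2 + A' - 2 * A * l - (- (c * yi\<^sup>2 / 2)) * A = 0"
    and "HQ z * A\<^sup>2 + l\<^sup>2 - l' - (q * yi\<^sup>2 - (- (c * yi\<^sup>2 / 2)) * l) = 0"
    and "1 - z = - 5000 * r ^ 3 * gi ^ 4"
    and "2 * h * Dh * yi * gi ^ 3 - 3 * h\<^sup>2 * gi ^ 4 * D * yi = A"
proof -
  have gi: "gi \<noteq> 0" using g by auto
  have g5: "gi ^ 4 = g * gi ^ 5" "gi = g ^ 4 * gi ^ 5" "gi ^ 3 = g * gi ^ 4"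
    using g by algebra+
  show z1: "1 - z = - 5000 * r ^ 3 * gi ^ 4" unfolding z using g i1 by algebra
  \<comment> \<open>The square of dz/dX is divisible by z (1 - z), which cancels the denominators of
    \<open>HP\<close> and \<open>HQ\<close>.\<close>
  have A2: "A\<^sup>2 = (z * (1 - z)) * (- 50 * r * gi * yi\<^sup>2)"
    unfolding z1 unfolding A z by algebra
  have nz: "z * (1 - z) \<noteq> 0" unfolding z1 unfolding z using hr gi by simp
  have hp: "HP z * A\<^sup>2 = (7/6 * z - 1/2) * (- 50 * r * gi * yi\<^sup>2)"
    unfolding HP_def A2 using nz by simp
  have hq: "HQ z * A\<^sup>2 = - 50 * r * gi * yi\<^sup>2 / 225"
  proof -
    have "HQ z = 1 / (225 * (z * (1 - z)))" by (simp add: HQ_def mult.assoc)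
    thus ?thesis unfolding A2 using nz by simp
  qed
  have T: "- 50 * r * (7/6 * h\<^sup>2 * g - g ^ 4 / 2) - 500 * (Dh * r\<^sup>2 * g + 2 * h * r * Dr * g - 4 * h * r\<^sup>2 * D) + 250 / 3 * h * r\<^sup>2 * D = 0"
    using i1 i2 i3 by algebra
  have "- 50 * r * (7/6 * h\<^sup>2 * gi ^ 4 - gi / 2) - 500 * (Dh * r\<^sup>2 * gi ^ 4 + 2 * h * r * Dr * gi ^ 4 - 4 * h * r\<^sup>2 * D * gi ^ 5) + 250 / 3 * h * r\<^sup>2 * D * gi ^ 5
     = gi ^ 5 * (- 50 * r * (7/6 * h\<^sup>2 * g - g ^ 4 / 2) - 500 * (Dh * r\<^sup>2 * g + 2 * h * r * Dr * g - 4 * h * r\<^sup>2 * D) + 250 / 3 * h * r\<^sup>2 * D)"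
    using g5(1,2) by algebra
  hence T': "- 50 * r * (7/6 * h\<^sup>2 * gi ^ 4 - gi / 2) - 500 * (Dh * r\<^sup>2 * gi ^ 4 + 2 * h * r * Dr * gi ^ 4 - 4 * h * r\<^sup>2 * D * gi ^ 5) + 250 / 3 * h * r\<^sup>2 * D * gi ^ 5 = 0"
    unfolding T by simp
  have "HP z * A\<^sup>2 + A' - 2 * A * l - (- (c * yi\<^sup>2 / 2)) * A =
    yi\<^sup>2 * (- 50 * r * (7/6 * h\<^sup>2 * gi ^ 4 - gi / 2) - 500 * (Dh * r\<^sup>2 * gi ^ 4 + 2 * h * r * Dr * gi ^ 4 - 4 * h * r\<^sup>2 * D * gi ^ 5) + 250 / 3 * h * r\<^sup>2 * D * gi ^ 5)"
    unfolding hp unfolding z A A' l by algebra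
  thus "HP z * A\<^sup>2 + A' - 2 * A * l - (- (c * yi\<^sup>2 / 2)) * A = 0"
    unfolding T' by simp
  have "HQ z * A\<^sup>2 + l\<^sup>2 - l' - (q * yi\<^sup>2 - (- (c * yi\<^sup>2 / 2)) * l) =
     yi\<^sup>2 * (13 / 144 * D\<^sup>2 * gi\<^sup>2 - gi * D2 / 12 - 2 / 9 * r * gi - q)"
    unfolding hq unfolding l l' by (simp add: field_simps power2_eq_square power3_eq_cube)
  also have "13 / 144 * D\<^sup>2 * gi\<^sup>2 - gi * D2 / 12 - 2 / 9 * r * gi - q = 0"
    using g i4 by algebra
  finally show "HQ z * A\<^sup>2 + l\<^sup>2 - l' - (q * yi\<^sup>2 - (- (c * yi\<^sup>2 / 2)) * l) = 0" by simp
  show "2 * h * Dh * yi * gi ^ 3 - 3 * h\<^sup>2 * gi ^ 4 * D * yi = A"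
    unfolding A using i2 g5(3) by algebra
qed

section \<open>The two real branches and the pulled-back equation\<close>

text \<open>The sign s = 1 or -1 selects the branch of y; s = -1 gives the pullback lying over 20736/45125 at X = 81.\<close>

definition Yc :: "real \<Rightarrow> real \<Rightarrow> real" where "Yc s X = s * sqrt (cubic X)"

lemma cubic_pos: "X > 0 \<Longrightarrow> cubic X > 0"
  unfolding cubic_def by (intro divide_pos_pos mult_pos_pos add_pos_pos) auto

lemma Yc_sq: "s\<^sup>2 = 1 \<Longrightarrow> X \<ge> 0 \<Longrightarrow> (Yc s X)\<^sup>2 = cubic X"
  using cubic_pos[of X] by (cases "X = 0") (auto simp: Yc_def power_mult_distrib cubic_def)

lemma Yc_nz: "s\<^sup>2 = 1 \<Longrightarrow> X > 0 \<Longrightarrow> Yc s X \<noteq> 0"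
  using Yc_sq[of s X] cubic_pos[of X] by auto

lemma cubic_deriv: "(cubic has_real_derivative cubic' X) (at X)"
  unfolding cubic_def[abs_def] cubic'_def by (auto intro!: derivative_eq_intros simp: power2_eq_square algebra_simps)

lemma cubic'_deriv: "(cubic' has_real_derivative (6 * X + 316) / 5) (at X)"
  unfolding cubic'_def[abs_def] by (auto intro!: derivative_eq_intros)

lemma Yc_deriv:
  assumes "s\<^sup>2 = 1" "X > 0"
  shows "(Yc s has_real_derivative cubic' X * inverse (Yc s X) / 2) (at X)"
proof -
  have "(Yc s has_real_derivative s * (cubic' X * (inverse (sqrt (cubic X)) / 2))) (at X)"
    unfolding Yc_def[abs_def]
    by (intro DERIV_cmult DERIV_chain2[OF DERIV_real_sqrt cubic_deriv, THEN DERIV_cong]) (use cubic_pos assms in auto)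
  moreover have "s = inverse s" using assms by (auto simp: power2_eq_1_iff)
  ultimately show ?thesis unfolding Yc_def inverse_mult_distrib
    by (metis (no_types, lifting) mult.assoc mult.left_commute times_divide_eq_right)
qed

text \<open>D^2 f = q f written in X: with D = y d/dX it reads \<open>cubic\<close> f'' +
  \<open>cubic'\<close> f'/2 = q f.\<close>

definition LP :: "real \<Rightarrow> real" where "LP X = - cubic' X / (2 * cubic X)"
definition LQ :: "real \<Rightarrow> real" where "LQ X = (- X / 90 - 13 / 20) / cubic X"

abbreviation "lame \<equiv> ode_sol LP LQ"

lemma LPQ_inverse:
  assumes "s\<^sup>2 = 1" "X > 0"
  shows "LP X = - (cubic' X * (inverse (Yc s X))\<^sup>2 / 2)" "LQ X = (- X / 90 - 13 / 20) * (inverse (Yc s X))\<^sup>2"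
  unfolding LP_def LQ_def power_inverse Yc_sq[OF assms(1) less_imp_le[OF assms(2)]]
  by (simp_all add: field_simps)

definition zz :: "real \<Rightarrow> real \<Rightarrow> real" where
  "zz s X = (hh X (Yc s X))\<^sup>2 * inverse (gg X (Yc s X)) ^ 3"
text \<open>dz/dX in the factored form given by \<open>Dh_identity\<close>, which shows where it
  vanishes.\<close>

definition zz' :: "real \<Rightarrow> real \<Rightarrow> real" where
  "zz' s X = - 500 * hh X (Yc s X) * (rr X (Yc s X))\<^sup>2 * inverse (gg X (Yc s X)) ^ 4 * inverse (Yc s X)"
definition gg_logderiv :: "real \<Rightarrow> real \<Rightarrow> real" where
  "gg_logderiv s X = Dg X (Yc s X) * inverse (gg X (Yc s X)) * inverse (Yc s X) / 12"
text \<open>The power -1/12 normalises exponents. At P, where z has a pole of order 10 and g a zero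
  of order 4, those of \<open>su\<close> and \<open>sv\<close> become 0 and 1, so P is an ordinary
  point; at O those of \<open>sp\<close> and \<open>sq\<close> become 1/3 and 2/3.\<close>

definition pullback :: "real \<Rightarrow> (real \<Rightarrow> real) \<Rightarrow> real \<Rightarrow> real" where
  "pullback s S X = gg X (Yc s X) powr (-1/12) * S (zz s X)"
definition pullback' :: "real \<Rightarrow> (real \<Rightarrow> real) \<Rightarrow> (real \<Rightarrow> real) \<Rightarrow> real \<Rightarrow> real" where
  "pullback' s S S1 X = gg X (Yc s X) powr (-1/12) * (S1 (zz s X) * zz' s X - S (zz s X) * gg_logderiv s X)"

context
  fixes s X :: real
  assumes s: "s\<^sup>2 = 1" and X: "X > 0"
begin

lemma gY_deriv: "((\<lambda>X. gg X (Yc s X)) has_real_derivative Dg X (Yc s X) * inverse (Yc s X)) (at X)"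
  unfolding gg_def
  by (rule derivative_eq_intros Yc_deriv[OF s X] refl)+
     (use Yc_nz[OF s X] in \<open>simp add: Dg_def cubic'_def field_simps power2_eq_square\<close>)

lemma hY_deriv: "((\<lambda>X. hh X (Yc s X)) has_real_derivative Dh X (Yc s X) * inverse (Yc s X)) (at X)"
  unfolding hh_def
  by (rule derivative_eq_intros Yc_deriv[OF s X] refl)+
     (use Yc_nz[OF s X] in \<open>simp add: Dh_def Yc_sq[OF s, of X, symmetric] X less_imp_le cubic'_def field_simps power2_eq_square\<close>)

lemma rY_deriv: "((\<lambda>X. rr X (Yc s X)) has_real_derivative Dr X (Yc s X) * inverse (Yc s X)) (at X)"
  unfolding rr_def
  by (rule derivative_eq_intros Yc_deriv[OF s X] refl)+
     (use Yc_nz[OF s X] in \<open>simp add: Dr_def Yc_sq[OF s, of X, symmetric] X less_imp_le cubic'_def field_simps power2_eq_square\<close>)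

lemma DgY_deriv: "((\<lambda>X. Dg X (Yc s X)) has_real_derivative DDg X (Yc s X) * inverse (Yc s X)) (at X)"
  unfolding Dg_def
  by (rule derivative_eq_intros Yc_deriv[OF s X] cubic'_deriv refl)+
     (use Yc_nz[OF s X] in \<open>simp add: DDg_def Yc_sq[OF s, of X, symmetric] X less_imp_le cubic'_def field_simps power2_eq_square\<close>)

lemma pullback_sol:
  assumes g: "gg X (Yc s X) > 0" and hr: "hh X (Yc s X) \<noteq> 0" "rr X (Yc s X) \<noteq> 0"
    and S: "hsol S S1 (zz s X)"
  shows "lame (pullback s S) (pullback' s S S1) X"
proof -
  let ?y = "Yc s X"
  let ?g = "gg X ?y" and ?h = "hh X ?y" and ?r = "rr X ?y"
  define gi yi where "gi = inverse ?g" and "yi = inverse ?y"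
  have ggi: "?g * gi = 1" using g by (simp add: gi_def)
  have yn: "?y \<noteq> 0" by (rule Yc_nz[OF s X])
  have y2: "?y\<^sup>2 = cubic X" using Yc_sq s X by simp
  define A where "A = - 500 * ?h * ?r\<^sup>2 * gi ^ 4 * yi"
  define A' where "A' = - 500 * yi\<^sup>2 * (Dh X ?y * ?r\<^sup>2 * gi ^ 4 + 2 * ?h * ?r * Dr X ?y * gi ^ 4 - 4 * ?h * ?r\<^sup>2 * Dg X ?y * gi ^ 5) + 250 * ?h * ?r\<^sup>2 * gi ^ 4 * yi ^ 3 * cubic' X"
  define l where "l = Dg X ?y * gi * yi / 12"
  define l' where "l' = (DDg X ?y * gi - (Dg X ?y)\<^sup>2 * gi\<^sup>2) * yi\<^sup>2 / 12 - Dg X ?y * gi * yi ^ 3 * cubic' X / 24"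
  have zA: "zz s X = ?h\<^sup>2 * gi ^ 3" "zz' s X = A" "gg_logderiv s X = l"
    by (simp_all add: zz_def zz'_def gg_logderiv_def gi_def yi_def A_def l_def)
  note alg = pullback_algebra[OF ggi cover_identity[OF y2] Dh_identity[OF y2] Dr_identity[OF y2] lame_identity[OF y2] zA(1) hr A_def A'_def l_def l'_def]
  have yi0: "yi \<noteq> 0" using yn by (simp add: yi_def)
  have dgi: "((\<lambda>X. inverse (gg X (Yc s X))) has_real_derivative - (gi\<^sup>2) * (Dg X ?y * yi)) (at X)"
    using DERIV_chain2[OF inverse_deriv gY_deriv] g by (simp add: gi_def yi_def)
  have dyi: "((\<lambda>X. inverse (Yc s X)) has_real_derivative - (yi\<^sup>2) * (cubic' X * yi / 2)) (at X)"
    using DERIV_chain2[OF inverse_deriv Yc_deriv[OF s X]] yn by (simp add: yi_def)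
  have dG: "((\<lambda>X. gg X (Yc s X) powr (-1/12)) has_real_derivative - (?g powr (-1/12)) * l) (at X)"
  proof -
    have "((\<lambda>X. gg X (Yc s X) powr (-1/12)) has_real_derivative (-1/12) * ?g powr (-1/12 - 1) * (Dg X ?y * yi)) (at X)"
      using DERIV_fun_powr[OF gY_deriv g, of "-1/12"] by (simp add: yi_def)
    moreover have "?g powr (-1/12 - 1) = ?g powr (-1/12) * gi"
      using powr_diff[of ?g "-1/12" 1] g by (simp add: gi_def field_simps)
    ultimately show ?thesis by (simp add: l_def mult_ac)
  qed
  have dz: "(zz s has_real_derivative A) (at X)"
  proof -
    have "(zz s has_real_derivative (2 * ?h * (Dh X ?y * yi)) * gi ^ 3 + (3 * gi\<^sup>2 * (- (gi\<^sup>2) * (Dg X ?y * yi))) * ?h\<^sup>2) (at X)"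
      unfolding zz_def[abs_def]
      using DERIV_mult[OF DERIV_power[OF hY_deriv, of 2] DERIV_power[OF dgi, of 3]]
      by (rule DERIV_cong) (simp add: gi_def yi_def)
    moreover have "(2 * ?h * (Dh X ?y * yi)) * gi ^ 3 + (3 * gi\<^sup>2 * (- (gi\<^sup>2) * (Dg X ?y * yi))) * ?h\<^sup>2 = A"
      unfolding alg(4)[OF yi0, symmetric] by algebra
    ultimately show ?thesis by simp
  qed
  have dA: "(zz' s has_real_derivative A') (at X)"
  proof -
    have "(zz' s has_real_derivative
      ((- 500 * (Dh X ?y * yi)) * ?r\<^sup>2 + (2 * ?r * (Dr X ?y * yi)) * (- 500 * ?h)) * gi ^ 4 * yi +
       (4 * gi ^ 3 * (- (gi\<^sup>2) * (Dg X ?y * yi))) * (- 500 * ?h * ?r\<^sup>2) * yi +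
       (- (yi\<^sup>2) * (cubic' X * yi / 2)) * (- 500 * ?h * ?r\<^sup>2 * gi ^ 4)) (at X)"
      unfolding zz'_def[abs_def]
      using DERIV_mult[OF DERIV_mult[OF DERIV_mult[OF DERIV_cmult[OF hY_deriv, of "-500"] DERIV_power[OF rY_deriv, of 2]] DERIV_power[OF dgi, of 4]] dyi]
      by (rule DERIV_cong) (simp add: gi_def[symmetric] yi_def[symmetric], simp add: algebra_simps)
    moreover have "((- 500 * (Dh X ?y * yi)) * ?r\<^sup>2 + (2 * ?r * (Dr X ?y * yi)) * (- 500 * ?h)) * gi ^ 4 * yi +
       (4 * gi ^ 3 * (- (gi\<^sup>2) * (Dg X ?y * yi))) * (- 500 * ?h * ?r\<^sup>2) * yi +
       (- (yi\<^sup>2) * (cubic' X * yi / 2)) * (- 500 * ?h * ?r\<^sup>2 * gi ^ 4) = A'"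
      unfolding A'_def by algebra
    ultimately show ?thesis by simp
  qed
  have dl: "(gg_logderiv s has_real_derivative l') (at X)"
  proof -
    have "(gg_logderiv s has_real_derivative
      (((DDg X ?y * yi) * gi + (- (gi\<^sup>2) * (Dg X ?y * yi)) * Dg X ?y) * yi + (- (yi\<^sup>2) * (cubic' X * yi / 2)) * (Dg X ?y * gi)) / 12) (at X)"
      unfolding gg_logderiv_def[abs_def]
      using DERIV_cdivide[OF DERIV_mult[OF DERIV_mult[OF DgY_deriv dgi] dyi], of 12]
      by (rule DERIV_cong) (simp add: gi_def[symmetric] yi_def[symmetric])
    moreover have "(((DDg X ?y * yi) * gi + (- (gi\<^sup>2) * (Dg X ?y * yi)) * Dg X ?y) * yi + (- (yi\<^sup>2) * (cubic' X * yi / 2)) * (Dg X ?y * gi)) / 12 = l'"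
      unfolding l'_def by algebra
    ultimately show ?thesis by simp
  qed
  let ?G = "?g powr (-1/12)" and ?S = "S (zz s X)" and ?S1 = "S1 (zz s X)"
  let ?hp = "HP (zz s X)" and ?hq = "HQ (zz s X)"
  have dS: "((\<lambda>X. S (zz s X)) has_real_derivative ?S1 * A) (at X)"
    using S DERIV_chain2[OF _ dz] by (auto simp: ode_sol_def)
  have dS1: "((\<lambda>X. S1 (zz s X)) has_real_derivative (?hp * ?S1 + ?hq * ?S) * A) (at X)"
    using S DERIV_chain2[OF _ dz] by (auto simp: ode_sol_def)
  have 1: "(pullback s S has_real_derivative pullback' s S S1 X) (at X)"
    unfolding pullback_def[abs_def]
    by (rule DERIV_cong[OF DERIV_mult[OF dG dS]]) (simp add: pullback'_def zA algebra_simps)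
  have 2: "(pullback' s S S1 has_real_derivative
     - ?G * l * (?S1 * A - ?S * l) +
     (((?hp * ?S1 + ?hq * ?S) * A * A + A' * ?S1) - (?S1 * A * l + l' * ?S)) * ?G) (at X)"
    unfolding pullback'_def[abs_def]
    by (rule DERIV_cong[OF DERIV_mult[OF dG DERIV_diff[OF DERIV_mult[OF dS1 dA] DERIV_mult[OF dS dl]]]])
       (simp only: zA(2,3))
  \<comment> \<open>Grouped by S' and S, the two brackets are the first two conclusions of
    \<open>pullback_algebra\<close>.\<close>
  have "- ?G * l * (?S1 * A - ?S * l) +
     (((?hp * ?S1 + ?hq * ?S) * A * A + A' * ?S1) - (?S1 * A * l + l' * ?S)) * ?G
     - (LP X * (?G * (?S1 * A - ?S * l)) + LQ X * (?G * ?S))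
     = ?G * (?S1 * (?hp * A\<^sup>2 + A' - 2 * A * l - LP X * A) + ?S * (?hq * A\<^sup>2 + l\<^sup>2 - l' - (LQ X - LP X * l)))"
    by (simp add: algebra_simps power2_eq_square)
  also have "?hp * A\<^sup>2 + A' - 2 * A * l - LP X * A = 0"
    unfolding LPQ_inverse[OF s X] yi_def[symmetric] by (rule alg(1)[OF yi0])
  also have "?hq * A\<^sup>2 + l\<^sup>2 - l' - (LQ X - LP X * l) = 0"
    unfolding LPQ_inverse[OF s X] yi_def[symmetric] by (rule alg(2)[OF yi0])
  finally have "- ?G * l * (?S1 * A - ?S * l) +
     (((?hp * ?S1 + ?hq * ?S) * A * A + A' * ?S1) - (?S1 * A * l + l' * ?S)) * ?G = LP X * pullback' s S S1 X + LQ X * pullback s S X"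
    by (simp add: pullback'_def pullback_def zA(2,3))
  with 1 2 show ?thesis by (simp add: ode_sol_def)
qed

end

subsection \<open>Signs along the real arc\<close>

text \<open>The roots are the X-coordinates of D1: this is the norm of \<open>rr\<close>, up to a
  constant, without the factor (X - 81)^2 coming from P. Likewise \<open>hh_norm\<close> belongs to
  D0.\<close>

definition rr_norm :: "real \<Rightarrow> real" where "rr_norm X = X^3 - 351 * X\<^sup>2 - 79461 * X - 3969405"
definition hh_norm :: "real \<Rightarrow> real" where
  "hh_norm X = X^5 - 27405 * X^4 - 7710390 * X^3 - 1251904410 * X\<^sup>2 - 108907318395 * X - 3540226639401"

lemma rr_conj: "y\<^sup>2 = cubic X \<Longrightarrow> rr X y * rr X (- y) = - ((X - 81)\<^sup>2 * rr_norm X / 5)"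
  unfolding cubic_def rr_def rr_norm_def by algebra

lemma hh_conj: "y\<^sup>2 = cubic X \<Longrightarrow> hh X y * hh X (- y) = (X - 81) * hh_norm X"
  unfolding cubic_def hh_def hh_norm_def by algebra

text \<open>Descartes' rule of signs made explicit. Subtracting X^3 times
  \<open>rr_norm T = 0\<close> from T^3 times \<open>rr_norm X\<close> leaves X - T times the
  polynomial \<open>Q\<close>, whose coefficients are positive. The bound 313 is the zero of the
  coefficient of y in \<open>rr\<close>. \<open>hh_norm_root\<close> uses the same device in degree
  5.\<close>

lemma rr_norm_root:
  obtains T where "T > 313" "rr_norm T = 0" "\<And>X. 0 < X \<Longrightarrow> X < T \<Longrightarrow> rr_norm X < 0" "\<And>X. T < X \<Longrightarrow> rr_norm X > 0"
proof -
  have "\<exists>T\<ge>313. T \<le> 1000 \<and> rr_norm T = 0"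
    by (rule IVT) (auto simp: rr_norm_def intro!: continuous_intros)
  then obtain T where T: "T \<ge> 313" "rr_norm T = 0" by blast
  moreover have "T \<noteq> 313" using T(2) by (auto simp: rr_norm_def)
  ultimately have T3: "T > 313" by simp
  define Q where "Q = (\<lambda>X. 351 * X\<^sup>2 * T\<^sup>2 + 79461 * X * T * (X + T) + 3969405 * (X\<^sup>2 + X * T + T\<^sup>2))"
  have Q: "T ^ 3 * rr_norm X = (X - T) * Q X" for X
    using T(2) unfolding rr_norm_def Q_def by algebra
  have Qp: "Q X > 0" if "X > 0" for X
    unfolding Q_def using that T3 by (intro add_pos_pos mult_pos_pos) auto
  have T3p: "T ^ 3 > 0" using T3 by simp
  show ?thesis
  proof (rule that[OF T3 T(2)])
    fix X :: real assume X: "0 < X" "X < T"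
    hence "T ^ 3 * rr_norm X < 0" unfolding Q using Qp[of X] by (intro mult_neg_pos) auto
    thus "rr_norm X < 0" using T3p by (simp add: mult_less_0_iff)
  next
    fix X :: real assume X: "T < X"
    hence "T ^ 3 * rr_norm X > 0" unfolding Q using Qp[of X] T3 by (intro mult_pos_pos) auto
    thus "rr_norm X > 0" using T3p by (simp add: zero_less_mult_iff)
  qed
qed

lemma hh_norm_root:
  obtains T where "T > 81" "hh_norm T = 0" "\<And>X. 0 < X \<Longrightarrow> X < T \<Longrightarrow> hh_norm X < 0" "\<And>X. T < X \<Longrightarrow> hh_norm X > 0"
proof -
  have "\<exists>T\<ge>81. T \<le> 100000 \<and> hh_norm T = 0"
    by (rule IVT) (auto simp: hh_norm_def intro!: continuous_intros)
  then obtain T where T: "T \<ge> 81" "hh_norm T = 0" by blast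
  moreover have "T \<noteq> 81" using T(2) by (auto simp: hh_norm_def)
  ultimately have T3: "T > 81" by simp
  define Q where "Q = (\<lambda>X. 27405 * X^4 * T^4 + 7710390 * X^3 * T^3 * (X + T) +
     1251904410 * X\<^sup>2 * T\<^sup>2 * (X\<^sup>2 + X * T + T\<^sup>2) +
     108907318395 * X * T * (X^3 + X\<^sup>2 * T + X * T\<^sup>2 + T^3) +
     3540226639401 * (X^4 + X^3 * T + X\<^sup>2 * T\<^sup>2 + X * T^3 + T^4))"
  have Q: "T ^ 5 * hh_norm X = (X - T) * Q X" for X
    using T(2) unfolding hh_norm_def Q_def by algebra
  have Qp: "Q X > 0" if "X > 0" for X
    unfolding Q_def using that T3 by (intro add_pos_pos mult_pos_pos) auto
  have T3p: "T ^ 5 > 0" using T3 by simp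
  show ?thesis
  proof (rule that[OF T3 T(2)])
    fix X :: real assume X: "0 < X" "X < T"
    hence "T ^ 5 * hh_norm X < 0" unfolding Q using Qp[of X] by (intro mult_neg_pos) auto
    thus "hh_norm X < 0" using T3p by (simp add: mult_less_0_iff)
  next
    fix X :: real assume X: "T < X"
    hence "T ^ 5 * hh_norm X > 0" unfolding Q using Qp[of X] T3 by (intro mult_pos_pos) auto
    thus "hh_norm X > 0" using T3p by (simp add: zero_less_mult_iff)
  qed
qed

lemma Yc_minus: "Yc (- 1) X = - Yc 1 X" by (simp add: Yc_def)

lemma Yc_nonneg: "X \<ge> 0 \<Longrightarrow> Yc 1 X \<ge> 0"
  using cubic_pos[of X] by (cases "X = 0") (auto simp: Yc_def cubic_def)

lemma Yc_sq1: "X \<ge> 0 \<Longrightarrow> (Yc 1 X)\<^sup>2 = cubic X" by (rule Yc_sq) auto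

lemma gg1_pos: assumes "X \<ge> 0" shows "gg X (Yc (-1) X) > 0"
  unfolding gg_def Yc_minus using Yc_nonneg[OF assms] zero_le_power2[of X] assms by linarith

lemma gg2_pos: assumes "X \<ge> 0" "X \<noteq> 81" shows "gg X (Yc 1 X) > 0"
proof -
  have "gg X (Yc 1 X) * gg X (Yc (-1) X) > 0"
    unfolding Yc_minus gg_conj[OF Yc_sq1[OF assms(1)]] using assms by simp
  thus ?thesis using gg1_pos[OF assms(1)] by (simp add: zero_less_mult_iff)
qed

text \<open>The quotient of \<open>hh\<close> by X - 81 on the branch y > 0. The line y = 8 X is
  tangent to the curve at P, so y - 8 X contributes a factor (X - 81)^2, exposed by multiplying with
  y + 8 X.\<close>

definition hh_cofactor :: "real \<Rightarrow> real" where
  "hh_cofactor X = X\<^sup>2 + 3818 * X + 209061 + 76 * X * (X + 19) * (X - 81) / (Yc 1 X + 8 * X)"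

lemma hh_eq_cofactor: assumes "X > 0" shows "hh X (Yc 1 X) = (X - 81) * hh_cofactor X"
proof -
  let ?y = "Yc 1 X"
  have p: "?y + 8 * X > 0" using assms Yc_nonneg[of X] by simp
  have "(?y - 8 * X) * (?y + 8 * X) = X * (X - 81)\<^sup>2 / 5"
    using Yc_sq1[of X] assms unfolding cubic_def by (simp add: power2_eq_square algebra_simps)
  hence y: "?y - 8 * X = X * (X - 81)\<^sup>2 / (5 * (?y + 8 * X))" using p by (simp add: field_simps)
  have "hh X ?y = (X - 81) * (X\<^sup>2 + 3818 * X + 209061) + (380 * X + 7220) * (?y - 8 * X)"
    unfolding hh_def by algebra
  also have "(380 * X + 7220) * (?y - 8 * X) = (X - 81) * (76 * X * (X + 19) * (X - 81) / (?y + 8 * X))"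
    unfolding y using p by (simp add: divide_simps) algebra
  finally show ?thesis by (simp add: hh_cofactor_def algebra_simps)
qed

lemma hh_cofactor_pos: assumes "X > 0" shows "hh_cofactor X > 0"
proof -
  let ?y = "Yc 1 X"
  have p: "?y + 8 * X \<ge> 8 * X" using assms Yc_nonneg[of X] by simp
  show ?thesis
  proof (cases "X \<ge> 81")
    case True
    have "76 * X * (X + 19) * (X - 81) / (?y + 8 * X) \<ge> 0"
      using True p by (intro divide_nonneg_nonneg mult_nonneg_nonneg) auto
    thus ?thesis unfolding hh_cofactor_def using assms by (simp add: add_pos_nonneg)
  next
    case False
    have "76 * X * (X + 19) * (81 - X) / (?y + 8 * X) \<le> 76 * X * (X + 19) * (81 - X) / (8 * X)"
      using p assms False by (intro divide_left_mono mult_nonneg_nonneg mult_pos_pos) auto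
    also have "\<dots> = 19 / 2 * ((X + 19) * (81 - X))" using assms by (simp add: field_simps)
    \<comment> \<open>The resulting bound 76950 lies below the constant 209061 of
      \<open>hh_cofactor\<close>.\<close>
    also have "\<dots> \<le> 19 / 2 * (100 * 81)" using assms False by (intro mult_left_mono mult_mono) auto
    finally have "76 * X * (X + 19) * (81 - X) / (?y + 8 * X) \<le> 76950" by simp
    moreover have "76 * X * (X + 19) * (X - 81) / (?y + 8 * X) = - (76 * X * (X + 19) * (81 - X) / (?y + 8 * X))"
    proof -
      have "76 * X * (X + 19) * (X - 81) = - (76 * X * (X + 19) * (81 - X))" by (simp add: algebra_simps)
      thus ?thesis by (simp only: minus_divide_left)
    qed
    moreover have "X\<^sup>2 + 3818 * X \<ge> 0" using assms by simp
    ultimately show ?thesis unfolding hh_cofactor_def by linarith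
  qed
qed

lemma Yc_81: "Yc 1 81 = 648"
  by (simp add: Yc_def cubic_def real_sqrt_unique)

lemma hh2_nz: "X > 0 \<Longrightarrow> X \<noteq> 81 \<Longrightarrow> hh X (Yc 1 X) \<noteq> 0"
  using hh_eq_cofactor[of X] hh_cofactor_pos[of X] by simp

lemma hh1_sgn:
  assumes "X > 0" "X \<noteq> 81"
  shows "hh_cofactor X * hh X (Yc (-1) X) = hh_norm X"
proof -
  have "(X - 81) * (hh_cofactor X * hh X (Yc (-1) X)) = (X - 81) * hh_norm X"
    using hh_conj[OF Yc_sq1, of X] assms unfolding hh_eq_cofactor[OF assms(1)] Yc_minus by (simp add: mult_ac)
  thus ?thesis using assms by simp
qed

lemma rr1_pos_le_313: assumes "0 < X" "X \<le> 313" shows "rr X (Yc (-1) X) > 0"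
proof -
  have "(X - 313) * - Yc 1 X \<ge> 0" using assms Yc_nonneg[of X] by (intro mult_nonpos_nonpos) auto
  moreover have "X\<^sup>2 > 0" using assms by simp
  ultimately show ?thesis unfolding rr_def Yc_minus using assms by linarith
qed

lemma zz_one:
  assumes s: "s\<^sup>2 = 1" and X: "X \<ge> 0" and g: "gg X (Yc s X) > 0"
  shows "zz s X - 1 = 5000 * rr X (Yc s X) ^ 3 * inverse (gg X (Yc s X)) ^ 4"
proof -
  define gi where "gi = inverse (gg X (Yc s X))"
  have gi: "gg X (Yc s X) * gi = 1" using g by (simp add: gi_def)
  show ?thesis using cover_identity[OF Yc_sq[OF s X]] gi unfolding zz_def gi_def[symmetric] by algebra
qed

lemma zz_gt_1: "s\<^sup>2 = 1 \<Longrightarrow> X \<ge> 0 \<Longrightarrow> gg X (Yc s X) > 0 \<Longrightarrow> rr X (Yc s X) > 0 \<Longrightarrow> zz s X > 1"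
  using zz_one[of s X] by (smt (verit) zero_less_power inverse_positive_iff_positive mult_pos_pos)

lemma zz_lt_1: assumes "s\<^sup>2 = 1" "X \<ge> 0" "gg X (Yc s X) > 0" "rr X (Yc s X) < 0" shows "zz s X < 1"
proof -
  have "rr X (Yc s X) ^ 3 < 0" using assms(4) by (simp add: power_less_zero_eq)
  hence "5000 * rr X (Yc s X) ^ 3 * inverse (gg X (Yc s X)) ^ 4 < 0"
    using assms(3) by (intro mult_neg_pos mult_pos_neg zero_less_power) auto
  thus ?thesis using zz_one[OF assms(1-3)] by linarith
qed

lemma zz_pos: "gg X (Yc s X) > 0 \<Longrightarrow> hh X (Yc s X) \<noteq> 0 \<Longrightarrow> zz s X > 0"
  unfolding zz_def by (rule mult_pos_pos) (simp_all add: zero_less_power)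

text \<open>Keeps z > 1 on the whole upper branch. Up to X = 313 the sign comes from the norm and
  the conjugate, beyond it every summand of \<open>rr\<close> is nonnegative.\<close>

lemma rr2_pos:
  assumes X: "X > 0" "X \<noteq> 81" shows "rr X (Yc 1 X) > 0"
proof (cases "X \<le> 313")
  case True
  obtain T where T: "T > 313" "\<And>X. 0 < X \<Longrightarrow> X < T \<Longrightarrow> rr_norm X < 0" by (rule rr_norm_root) blast
  have "rr X (Yc 1 X) * rr X (Yc (-1) X) > 0"
    unfolding Yc_minus rr_conj[OF Yc_sq1[OF less_imp_le[OF X(1)]]]
    using T(2)[of X] T(1) True X by (simp add: mult_pos_neg)
  thus ?thesis using rr1_pos_le_313[OF X(1) True] by (simp add: zero_less_mult_iff)
next
  case False
  hence "(X - 313) * Yc 1 X \<ge> 0" using X Yc_nonneg[of X] by (intro mult_nonneg_nonneg) auto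
  moreover have "X\<^sup>2 > 0" using X by simp
  ultimately show ?thesis unfolding rr_def using X by linarith
qed

text \<open>On the lower branch z = 1 at \<open>T1\<close> and z = 0 at \<open>T2\<close>. The signs
  of \<open>rr\<close> and \<open>hh\<close> are read off from their norms, since \<open>rr\<close>
  on the upper branch and \<open>hh_cofactor\<close> are positive.\<close>

lemma crossing_points:
  obtains T1 T2 where "313 < T1" "T1 < T2"
    "\<And>X. 0 < X \<Longrightarrow> X < T1 \<Longrightarrow> rr X (Yc (-1) X) > 0"
    "\<And>X. T1 < X \<Longrightarrow> rr X (Yc (-1) X) < 0" "rr T1 (Yc (-1) T1) = 0"
    "\<And>X. 0 < X \<Longrightarrow> X < T2 \<Longrightarrow> hh X (Yc (-1) X) < 0"
    "\<And>X. T2 < X \<Longrightarrow> hh X (Yc (-1) X) > 0" "hh T2 (Yc (-1) T2) = 0"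
proof -
  obtain T1 where T1: "T1 > 313" "rr_norm T1 = 0" "\<And>X. 0 < X \<Longrightarrow> X < T1 \<Longrightarrow> rr_norm X < 0" "\<And>X. T1 < X \<Longrightarrow> rr_norm X > 0"
    by (rule rr_norm_root) blast
  obtain T2 where T2: "T2 > 81" "hh_norm T2 = 0" "\<And>X. 0 < X \<Longrightarrow> X < T2 \<Longrightarrow> hh_norm X < 0" "\<And>X. T2 < X \<Longrightarrow> hh_norm X > 0"
    by (rule hh_norm_root) blast
  have R: "rr X (Yc 1 X) * rr X (Yc (-1) X) = - ((X - 81)\<^sup>2 * rr_norm X / 5)" if "X > 0" for X
    unfolding Yc_minus using that by (intro rr_conj Yc_sq1) auto
  have r1: "rr X (Yc (-1) X) > 0" if "0 < X" "X < T1" for X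
  proof (cases "X \<le> 313")
    case True thus ?thesis using rr1_pos_le_313 that by simp
  next
    case False
    have "rr X (Yc 1 X) * rr X (Yc (-1) X) > 0"
      unfolding R[OF that(1)] using T1(3)[OF that] False by (simp add: mult_pos_neg)
    thus ?thesis using rr2_pos[of X] that False by (simp add: zero_less_mult_iff)
  qed
  have r2: "rr X (Yc (-1) X) < 0" if "T1 < X" for X
  proof -
    have X: "X > 313" using that T1 by simp
    have "rr X (Yc 1 X) * rr X (Yc (-1) X) < 0"
      using R[of X] T1(4)[OF that] X by (simp add: mult_pos_pos)
    thus ?thesis using rr2_pos[of X] X by (simp add: mult_less_0_iff)
  qed
  have r0: "rr T1 (Yc (-1) T1) = 0"
    using R[of T1] T1(1,2) rr2_pos[of T1] by simp
  have h1: "hh X (Yc (-1) X) < 0" if "0 < X" "X < T2" for X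
  proof (cases "X = 81")
    case True
    show ?thesis unfolding True Yc_minus Yc_81 hh_def by simp
  next
    case False
    have "hh_cofactor X * hh X (Yc (-1) X) < 0" unfolding hh1_sgn[OF that(1) False] by (rule T2(3)) fact+
    thus ?thesis using hh_cofactor_pos[of X] that by (simp add: mult_less_0_iff)
  qed
  have h2: "hh X (Yc (-1) X) > 0" if "T2 < X" for X
  proof -
    have X: "X > 81" using that T2 by simp
    have "hh_cofactor X * hh X (Yc (-1) X) > 0" using hh1_sgn[of X] X T2(4)[OF that] by simp
    thus ?thesis using hh_cofactor_pos[of X] X by (simp add: zero_less_mult_iff)
  qed
  have h0: "hh T2 (Yc (-1) T2) = 0"
    using hh1_sgn[of T2] T2(1,2) hh_cofactor_pos[of T2] by simp
  \<comment> \<open>z = 0 at \<open>T2\<close>, but z is at least 1 wherever \<open>rr\<close> is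
    nonnegative.\<close>
  have "T1 < T2"
  proof (rule ccontr)
    assume "\<not> T1 < T2"
    hence "rr T2 (Yc (-1) T2) \<ge> 0" using r1[of T2] r0 T2(1) by (cases "T2 = T1") auto
    moreover have "gg T2 (Yc (-1) T2) > 0" using gg1_pos[of T2] T2(1) by simp
    ultimately have "zz (-1) T2 - 1 \<ge> 0"
      using zz_one[of "-1" T2] T2(1) by (simp add: )
    thus False by (simp add: zz_def h0)
  qed
  thus ?thesis using that T1(1) r1 r2 r0 h1 h2 h0 by blast
qed

subsection \<open>Connection formulas\<close>

text \<open>By Abel's identity one zero of the Wronskian makes it vanish throughout, so g/f is
  constant. In the contrapositive, different boundary behaviour of two solutions yields a nonzero
  Wronskian.\<close>

lemma wronskian_zero_prop:
  assumes I: "open I" "connected I" "x0 \<in> I"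
    and S: "\<And>x. x \<in> I \<Longrightarrow> ode_sol P Q f f1 x" and T: "\<And>x. x \<in> I \<Longrightarrow> ode_sol P Q g g1 x"
    and m: "\<And>x. x \<in> I \<Longrightarrow> (m has_real_derivative - P x * m x) (at x)" "\<And>x. x \<in> I \<Longrightarrow> m x \<noteq> 0"
    and f: "\<And>x. x \<in> I \<Longrightarrow> f x > 0"
    and W: "f x0 * g1 x0 - f1 x0 * g x0 = 0"
  shows "\<exists>\<kappa>. \<forall>x\<in>I. g x = \<kappa> * f x"
proof -
  have W0: "f x * g1 x - f1 x * g x = 0" if "x \<in> I" for x
    using wronskian_const[OF I S T m(1) that] m(2)[OF that] W by simp
  have D: "((\<lambda>x. g x / f x) has_real_derivative 0) (at x)" if "x \<in> I" for x
  proof -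
    have "((\<lambda>x. g x / f x) has_real_derivative (g1 x * f x - g x * f1 x) / (f x * f x)) (at x)"
      using S[OF that] T[OF that] f[OF that] unfolding ode_sol_def by (intro DERIV_divide) auto
    moreover have "g1 x * f x - g x * f1 x = 0" using W0[OF that] by (simp add: mult_ac)
    ultimately show ?thesis by simp
  qed
  have C: "continuous_on I (\<lambda>x. g x / f x)"
    by (intro continuous_at_imp_continuous_on ballI DERIV_isCont[OF D])
  obtain c where c: "\<And>x. x \<in> I \<Longrightarrow> g x / f x = c"
    by (rule DERIV_zero_connected_constant[OF I(2,1) finite.emptyI C]) (use D in auto)
  show ?thesis
    by (rule exI[of _ c]) (use c f in \<open>force simp: field_simps\<close>)
qed

lemma hgf_lim_0:
  assumes "c > 0" shows "(hgf a b c \<longlongrightarrow> 1) (at 0)"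
  using hgf_cont[OF assms, of 0 a b] by (simp add: isCont_def)

section \<open>Signs and boundary values of the local solutions\<close>

lemma se_pos: "0 \<le> z \<Longrightarrow> z < 1 \<Longrightarrow> se z > 0"
  unfolding se_def by (rule hgf_pos) auto
lemma so_pos: "0 < z \<Longrightarrow> z < 1 \<Longrightarrow> so z > 0"
  unfolding so_def by (intro mult_pos_pos hgf_pos) auto
lemma sp_pos: "0 < z \<Longrightarrow> z \<le> 1 \<Longrightarrow> sp z > 0"
  unfolding sp_def by (rule hgf_pos) auto
lemma sq_pos: "0 < z \<Longrightarrow> z < 1 \<Longrightarrow> sq z > 0"
  unfolding sq_def by (intro mult_pos_pos hgf_pos) auto
lemma si_pos: "1 < z \<Longrightarrow> \<alpha> > 0 \<Longrightarrow> c > 0 \<Longrightarrow> si \<alpha> c z > 0"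
  unfolding si_def by (intro mult_pos_pos hgf_pos) (auto simp: field_simps)

lemma se_lim: "(se \<longlongrightarrow> 1) (at_right 0)"
  unfolding se_def by (rule tendsto_mono[OF at_le hgf_lim_0]) auto

lemma so_lim: "(so \<longlongrightarrow> 0) (at_right 0)"
proof -
  have "((\<lambda>z. sqrt z * hgf (8/15) (19/30) (3/2) z) \<longlongrightarrow> sqrt 0 * 1) (at_right 0)"
    by (intro tendsto_mult tendsto_real_sqrt tendsto_ident_at tendsto_mono[OF at_le hgf_lim_0]) auto
  thus ?thesis by (simp add: so_def[abs_def])
qed

lemma hgf_lim_1m:
  assumes "c > 0" shows "((\<lambda>z. hgf a b c (1 - z)) \<longlongrightarrow> 1) (at 1)"
proof -
  have "((\<lambda>z::real. 1 - z) \<longlongrightarrow> 1 - 1) (at 1)" by (intro tendsto_intros)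
  hence "((\<lambda>z. hgf a b c (1 - z)) \<longlongrightarrow> hgf a b c 0) (at 1)"
    by (intro isCont_tendsto_compose[OF hgf_cont[OF assms]]) auto
  thus ?thesis by simp
qed

lemma sp_lim: "(sp \<longlongrightarrow> 1) (at 1)"
  unfolding sp_def[abs_def] by (rule hgf_lim_1m) auto

lemma sq_lim: "(sq \<longlongrightarrow> 0) (at 1)"
proof -
  have "((\<lambda>z::real. \<bar>1 - z\<bar> powr (1/3)) \<longlongrightarrow> \<bar>1 - 1\<bar> powr (1/3)) (at 1)"
    by (intro tendsto_powr' tendsto_intros) auto
  hence "((\<lambda>z. \<bar>1 - z\<bar> powr (1/3) * hgf (11/30) (7/15) (4/3) (1 - z)) \<longlongrightarrow> \<bar>1 - 1\<bar> powr (1/3) * 1) (at 1)"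
    by (intro tendsto_mult hgf_lim_1m) auto
  thus ?thesis by (simp add: sq_def[abs_def])
qed

lemma sq_nz_near_1: "eventually (\<lambda>z. sq z > 0) (at 1)"
proof -
  have "eventually (\<lambda>z. hgf (11/30) (7/15) (4/3) (1 - z) > 0) (at 1)"
    by (rule order_tendstoD(1)[OF hgf_lim_1m]) auto
  moreover have "eventually (\<lambda>z::real. z \<noteq> 1) (at 1)" by (simp add: eventually_at_filter)
  ultimately show ?thesis
    by eventually_elim (auto simp: sq_def intro!: mult_pos_pos)
qed

lemma sp_lim_0: "(sp \<longlongrightarrow> hgf_sum1 (1/30) (2/15) (2/3)) (at_right 0)"
proof -
  have "filterlim (\<lambda>z::real. 1 - z) (at_left 1) (at_right 0)"
    by real_asymp
  thus ?thesis unfolding sp_def[abs_def]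
    by (intro filterlim_compose[OF hgf_tendsto_sum1]) auto
qed

lemma se_lim_1: "(se \<longlongrightarrow> hgf_sum1 (1/30) (2/15) (1/2)) (at_left 1)"
  unfolding se_def by (rule hgf_tendsto_sum1) auto

section \<open>Independence of the local solutions and their connection matrices\<close>

lemma eventually_at_right_0_Ioo: "eventually (\<lambda>z::real. z \<in> {0<..<1}) (at_right 0)"
  by (rule eventually_at_rightI[of _ 1]) auto
lemma eventually_at_left_1_Ioo: "eventually (\<lambda>z::real. z \<in> {0<..<1}) (at_left 1)"
  by (rule eventually_at_leftI[of 0]) auto

text \<open>Proportional solutions are excluded at 0, where \<open>se\<close> tends to 1 and
  \<open>so\<close> to 0 while \<open>so\<close> is positive inside. The next lemmas argue alike at
  1, and at infinity, where \<open>sv\<close>/\<open>su\<close> behaves like z^(-1/10).\<close>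

lemma wronskian_se_so: "se (1/2) * so1 (1/2) - se1 (1/2) * so (1/2) \<noteq> 0"
proof
  assume W: "se (1/2) * so1 (1/2) - se1 (1/2) * so (1/2) = 0"
  have "\<exists>k. \<forall>z\<in>{0<..<1}. so z = k * se z"
    by (rule wronskian_zero_prop[where P = HP and Q = HQ and m = Hm and ?x0.0 = "1/2" and ?f1.0 = se1 and ?g1.0 = so1])
       (use W in \<open>auto intro!: se_sol so_sol Hm_deriv[simplified] connected_Ioo connected_Ioi simp: Hm_nz se_pos\<close>)
  then obtain k where k: "\<And>z. z \<in> {0<..<1} \<Longrightarrow> so z = k * se z" by blast
  have "((\<lambda>z. k * se z) \<longlongrightarrow> k * 1) (at_right 0)" by (intro tendsto_intros se_lim)
  moreover have "((\<lambda>z. k * se z) \<longlongrightarrow> 0) (at_right 0)"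
    by (rule Lim_transform_eventually[OF so_lim]) (use eventually_at_right_0_Ioo in \<open>eventually_elim, use k in auto\<close>)
  ultimately have "k = 0" using tendsto_unique[OF trivial_limit_at_right_real] by fastforce
  thus False using k[of "1/2"] so_pos[of "1/2"] by simp
qed

lemma wronskian_sp_sq: "sp (1/2) * sq1 (1/2) - sp1 (1/2) * sq (1/2) \<noteq> 0"
proof
  assume W: "sp (1/2) * sq1 (1/2) - sp1 (1/2) * sq (1/2) = 0"
  have "\<exists>k. \<forall>z\<in>{0<..<1}. sq z = k * sp z"
    by (rule wronskian_zero_prop[where P = HP and Q = HQ and m = Hm and ?x0.0 = "1/2" and ?f1.0 = sp1 and ?g1.0 = sq1])
       (use W in \<open>auto intro!: sp_sol sq_sol Hm_deriv[simplified] connected_Ioo connected_Ioi simp: Hm_nz sp_pos\<close>)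
  then obtain k where k: "\<And>z. z \<in> {0<..<1} \<Longrightarrow> sq z = k * sp z" by blast
  have "((\<lambda>z. k * sp z) \<longlongrightarrow> k * 1) (at_left 1)" by (intro tendsto_intros tendsto_mono[OF at_le sp_lim]) auto
  moreover have "((\<lambda>z. k * sp z) \<longlongrightarrow> 0) (at_left 1)"
    by (rule Lim_transform_eventually[OF tendsto_mono[OF at_le sq_lim]]) (use eventually_at_left_1_Ioo in \<open>auto elim!: eventually_mono simp: k\<close>)
  ultimately have "k = 0" using tendsto_unique[OF trivial_limit_at_left_real] by fastforce
  thus False using k[of "1/2"] sq_pos[of "1/2"] by simp
qed

lemma si_lim: "c > 0 \<Longrightarrow> ((\<lambda>z. hgf a b c (inverse z)) \<longlongrightarrow> 1) at_top"
  using isCont_tendsto_compose[OF hgf_cont[of c 0 a b] tendsto_inverse_0_at_top[OF filterlim_ident]] by simp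

lemma wronskian_su_sv_2: "su 2 * sv1 2 - su1 2 * sv 2 \<noteq> 0"
proof
  assume W: "su 2 * sv1 2 - su1 2 * sv 2 = 0"
  have "\<exists>k. \<forall>z\<in>{1<..}. sv z = k * su z"
    by (rule wronskian_zero_prop[where P = HP and Q = HQ and m = Hm and ?x0.0 = "2" and ?f1.0 = "si1 (1/30) (9/10)" and ?g1.0 = "si1 (2/15) (11/10)"])
       (use W in \<open>auto intro!: si_sol Hm_deriv[simplified] connected_Ioo connected_Ioi simp: Hm_nz si_pos\<close>)
  then obtain k where k: "\<And>z. z \<in> {1<..} \<Longrightarrow> sv z = k * su z" by blast
  let ?u = "\<lambda>z. hgf (1/30) (1/30 + 1/2) (9/10) (inverse z)" and ?v = "\<lambda>z. hgf (2/15) (2/15 + 1/2) (11/10) (inverse z)"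
  have "((\<lambda>z. k * ?u z) \<longlongrightarrow> k * 1) at_top" by (intro tendsto_mult tendsto_const si_lim) auto
  moreover have "((\<lambda>z. k * ?u z) \<longlongrightarrow> 0) at_top"
  proof (rule Lim_transform_eventually)
    have "((\<lambda>z. z powr (-1/10) * ?v z) \<longlongrightarrow> 0 * 1) at_top"
      by (intro tendsto_mult si_lim) (real_asymp, simp)
    thus "((\<lambda>z. z powr (-1/10) * ?v z) \<longlongrightarrow> 0) at_top" by simp
    show "eventually (\<lambda>z. z powr (-1/10) * ?v z = k * ?u z) at_top"
      using eventually_gt_at_top[of 1]
    proof eventually_elim
      case (elim z)
      have p: "z powr (-(2/15)) = z powr (-(1/30)) * z powr (-1/10)" by (simp flip: powr_add)
      have "z powr (-(1/30)) * (z powr (-1/10) * ?v z) = z powr (-(1/30)) * (k * ?u z)"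
        using k[of z] elim unfolding si_def p by (simp add: mult_ac)
      thus ?case using elim by simp
    qed
  qed
  ultimately have "k = 0" using tendsto_unique[OF trivial_limit_at_top_linorder] by fastforce
  thus False using k[of 2] si_pos[of 2 "2/15" "11/10"] by simp
qed

lemma wronskian_su_sv: assumes "z > 1" shows "su z * sv1 z - su1 z * sv z \<noteq> 0"
proof -
  have "Hm z * (su z * sv1 z - su1 z * sv z) = Hm 2 * (su 2 * sv1 2 - su1 2 * sv 2)"
    by (rule wronskian_const[where I = "{1<..}" and P = HP and Q = HQ]) (use assms in \<open>auto intro!: si_sol Hm_deriv[simplified]\<close>)
  moreover have "Hm 2 * (su 2 * sv1 2 - su1 2 * sv 2) \<noteq> 0" using wronskian_su_sv_2 Hm_nz[of 2] by simp
  ultimately show ?thesis by auto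
qed

lemma pq_indep:
  assumes "eventually (\<lambda>z. a * sp z + b * sq z = c * sp z + d * sq z) F" "F = at_left 1 \<or> F = at_right 1"
  shows "a = c" "b = d"
proof -
  have nt: "F \<noteq> bot"
    using assms(2) trivial_limit_at_left_real[of 1] trivial_limit_at_right_real[of 1] by metis
  have le: "F \<le> at 1" using assms(2) by (auto intro: at_le)
  have "((\<lambda>z. a * sp z + b * sq z) \<longlongrightarrow> a * 1 + b * 0) F"
    by (intro tendsto_intros tendsto_mono[OF le sp_lim] tendsto_mono[OF le sq_lim])
  moreover have "((\<lambda>z. c * sp z + d * sq z) \<longlongrightarrow> c * 1 + d * 0) F"
    by (intro tendsto_intros tendsto_mono[OF le sp_lim] tendsto_mono[OF le sq_lim])
  hence "((\<lambda>z. a * sp z + b * sq z) \<longlongrightarrow> c * 1 + d * 0) F"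
    by (rule Lim_transform_eventually) (use assms(1) in \<open>auto elim!: eventually_mono\<close>)
  ultimately show ac: "a = c" using tendsto_unique[OF nt] by fastforce
  have "eventually (\<lambda>z. sq z > 0) F" using sq_nz_near_1 le by (rule filter_leD[rotated])
  with assms(1) have "eventually (\<lambda>z. b = d) F" by eventually_elim (auto simp: ac)
  thus "b = d" using nt by simp
qed

text \<open>\<open>pe\<close> and \<open>e1\<close> are obtained as limits at 0 and at 1, where
  \<open>so\<close> and \<open>sq\<close> vanish and \<open>sp\<close> and \<open>se\<close> tend to
  Gauss values. The remaining entries are controlled by the two matrices being inverse to each
  other.\<close>

lemma connection_0_1:
  obtains pe po qe qo e1 e2 n1 n2 where
    "\<And>z. 0 < z \<Longrightarrow> z < 1 \<Longrightarrow> sp z = pe * se z + po * so z"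
    "\<And>z. 0 < z \<Longrightarrow> z < 1 \<Longrightarrow> sq z = qe * se z + qo * so z"
    "\<And>z. 0 < z \<Longrightarrow> z < 1 \<Longrightarrow> se z = e1 * sp z + e2 * sq z"
    "\<And>z. 0 < z \<Longrightarrow> z < 1 \<Longrightarrow> so z = n1 * sp z + n2 * sq z"
    "pe = hgf_sum1 (1/30) (2/15) (2/3)" "e1 = hgf_sum1 (1/30) (2/15) (1/2)"
    "pe * e1 + po * n1 = 1" "pe * e2 + po * n2 = 0" "qe * e1 + qo * n1 = 0" "qe * e2 + qo * n2 = 1"
    "e1 * pe + e2 * qe = 1"
proof -
  have "\<exists>a b. \<forall>z\<in>{0<..<1}. sp z = a * se z + b * so z \<and> sp1 z = a * se1 z + b * so1 z"
    by (rule ode_sol_span[where P = HP and Q = HQ and m = Hm and ?x0.0 = "1/2"])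
       (use wronskian_se_so in \<open>auto intro!: se_sol so_sol sp_sol sq_sol Hm_deriv[simplified] connected_Ioo simp: Hm_nz\<close>)
  then obtain pe po where p: "\<forall>z\<in>{0<..<1}. sp z = pe * se z + po * so z" by blast
  have "\<exists>a b. \<forall>z\<in>{0<..<1}. sq z = a * se z + b * so z \<and> sq1 z = a * se1 z + b * so1 z"
    by (rule ode_sol_span[where P = HP and Q = HQ and m = Hm and ?x0.0 = "1/2"])
       (use wronskian_se_so in \<open>auto intro!: se_sol so_sol sp_sol sq_sol Hm_deriv[simplified] connected_Ioo simp: Hm_nz\<close>)
  then obtain qe qo where q: "\<forall>z\<in>{0<..<1}. sq z = qe * se z + qo * so z" by blast
  have "\<exists>a b. \<forall>z\<in>{0<..<1}. se z = a * sp z + b * sq z \<and> se1 z = a * sp1 z + b * sq1 z"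
    by (rule ode_sol_span[where P = HP and Q = HQ and m = Hm and ?x0.0 = "1/2"])
       (use wronskian_sp_sq in \<open>auto intro!: se_sol so_sol sp_sol sq_sol Hm_deriv[simplified] connected_Ioo simp: Hm_nz\<close>)
  then obtain e1 e2 where e: "\<forall>z\<in>{0<..<1}. se z = e1 * sp z + e2 * sq z" by blast
  have "\<exists>a b. \<forall>z\<in>{0<..<1}. so z = a * sp z + b * sq z \<and> so1 z = a * sp1 z + b * sq1 z"
    by (rule ode_sol_span[where P = HP and Q = HQ and m = Hm and ?x0.0 = "1/2"])
       (use wronskian_sp_sq in \<open>auto intro!: se_sol so_sol sp_sol sq_sol Hm_deriv[simplified] connected_Ioo simp: Hm_nz\<close>)
  then obtain n1 n2 where n: "\<forall>z\<in>{0<..<1}. so z = n1 * sp z + n2 * sq z" by blast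
  have "((\<lambda>z. pe * se z + po * so z) \<longlongrightarrow> pe * 1 + po * 0) (at_right 0)"
    by (intro tendsto_intros se_lim so_lim)
  hence "(sp \<longlongrightarrow> pe * 1 + po * 0) (at_right 0)"
    by (rule Lim_transform_eventually) (use eventually_at_right_0_Ioo p in \<open>auto elim!: eventually_mono\<close>)
  hence pe: "pe = hgf_sum1 (1/30) (2/15) (2/3)" using sp_lim_0 tendsto_unique[OF trivial_limit_at_right_real] by fastforce
  have "((\<lambda>z. e1 * sp z + e2 * sq z) \<longlongrightarrow> e1 * 1 + e2 * 0) (at_left 1)"
    by (intro tendsto_intros tendsto_mono[OF at_le sp_lim] tendsto_mono[OF at_le sq_lim]) auto
  hence "(se \<longlongrightarrow> e1 * 1 + e2 * 0) (at_left 1)"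
    by (rule Lim_transform_eventually) (use eventually_at_left_1_Ioo e in \<open>auto elim!: eventually_mono\<close>)
  hence e1: "e1 = hgf_sum1 (1/30) (2/15) (1/2)" using se_lim_1 tendsto_unique[OF trivial_limit_at_left_real] by fastforce
  have "eventually (\<lambda>z. (pe * e1 + po * n1) * sp z + (pe * e2 + po * n2) * sq z = 1 * sp z + 0 * sq z) (at_left 1)"
    using eventually_at_left_1_Ioo by eventually_elim (use p e n in \<open>auto simp: algebra_simps\<close>)
  note P = pq_indep[OF this]
  have "eventually (\<lambda>z. (qe * e1 + qo * n1) * sp z + (qe * e2 + qo * n2) * sq z = 0 * sp z + 1 * sq z) (at_left 1)"
    using eventually_at_left_1_Ioo by eventually_elim (use q e n in \<open>auto simp: algebra_simps\<close>)
  note Q = pq_indep[OF this]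
  have f: "pe * e1 + po * n1 = 1" "pe * e2 + po * n2 = 0" "qe * e1 + qo * n1 = 0" "qe * e2 + qo * n2 = 1"
    using P Q by auto
  \<comment> \<open>An entry of the product in the opposite order: a right inverse of a square
    matrix is a left inverse.\<close>
  have E: "e1 * pe + e2 * qe = 1" using f by algebra
  show ?thesis
  proof (rule that[of pe po qe qo e1 e2 n1 n2, OF _ _ _ _ pe e1 f E])
    fix z :: real assume "0 < z" "z < 1"
    hence z: "z \<in> {0<..<1}" by simp
    show "sp z = pe * se z + po * so z" "sq z = qe * se z + qo * so z"
      "se z = e1 * sp z + e2 * sq z" "so z = n1 * sp z + n2 * sq z"
      using z p q e n by blast+
  qed
qed

text \<open>Invertibility is enough, as this matrix will enter as a conjugating matrix. A vanishing
  determinant would produce a nontrivial relation between \<open>sp\<close> and \<open>sq\<close>,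
  against \<open>pq_indep\<close>.\<close>

lemma connection_1_inf:
  obtains t11 t12 t21 t22 where
    "\<And>z. 1 < z \<Longrightarrow> z < 2 \<Longrightarrow> sp z = t11 * su z + t12 * sv z"
    "\<And>z. 1 < z \<Longrightarrow> z < 2 \<Longrightarrow> sq z = t21 * su z + t22 * sv z"
    "t11 * t22 - t12 * t21 \<noteq> 0"
proof -
  have W: "su (3/2) * sv1 (3/2) - su1 (3/2) * sv (3/2) \<noteq> 0" by (rule wronskian_su_sv) simp
  have "\<exists>a b. \<forall>z\<in>{1<..<2}. sp z = a * su z + b * sv z \<and> sp1 z = a * su1 z + b * sv1 z"
    by (rule ode_sol_span[where P = HP and Q = HQ and m = Hm and ?x0.0 = "3/2"])
       (use W in \<open>auto intro!: si_sol sp_sol sq_sol Hm_deriv[simplified] connected_Ioo simp: Hm_nz\<close>)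
  then obtain a b where p: "\<forall>z\<in>{1<..<2}. sp z = a * su z + b * sv z" by blast
  have "\<exists>a b. \<forall>z\<in>{1<..<2}. sq z = a * su z + b * sv z \<and> sq1 z = a * su1 z + b * sv1 z"
    by (rule ode_sol_span[where P = HP and Q = HQ and m = Hm and ?x0.0 = "3/2"])
       (use W in \<open>auto intro!: si_sol sp_sol sq_sol Hm_deriv[simplified] connected_Ioo simp: Hm_nz\<close>)
  then obtain c d where q: "\<forall>z\<in>{1<..<2}. sq z = c * su z + d * sv z" by blast
  have ev: "eventually (\<lambda>z::real. z \<in> {1<..<2}) (at_right 1)" by (rule eventually_at_rightI[of _ 2]) auto
  have "a * d - b * c \<noteq> 0"
  proof
    assume 0: "a * d - b * c = 0"
    have "eventually (\<lambda>z. d * sp z + (- b) * sq z = 0 * sp z + 0 * sq z) (at_right 1)"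
      using ev
    proof eventually_elim
      case (elim z)
      have "d * (a * su z + b * sv z) + (- b) * (c * su z + d * sv z) = (a * d - b * c) * su z"
        by (simp add: algebra_simps)
      thus ?case using p q elim 0 by simp
    qed
    from pq_indep[OF this] have bd: "d = 0" "b = 0" by auto
    have "eventually (\<lambda>z. c * sp z + (- a) * sq z = 0 * sp z + 0 * sq z) (at_right 1)"
      using ev by eventually_elim (use p q bd in \<open>auto simp: algebra_simps\<close>)
    from pq_indep[OF this] have a0: "a = 0" by auto
    have "eventually (\<lambda>z. 1 * sp z + 0 * sq z = 0 * sp z + 0 * sq z) (at_right 1)"
      using ev by eventually_elim (use p bd a0 in auto)
    from pq_indep[OF this] show False by auto
  qed
  show ?thesis
  proof (rule that[of a b c d, OF _ _ \<open>a * d - b * c \<noteq> 0\<close>])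
    fix z :: real assume "1 < z" "z < 2"
    hence z: "z \<in> {1<..<2}" by simp
    show "sp z = a * su z + b * sv z" "sq z = c * su z + d * sv z"
      using z p q by blast+
  qed
qed

section \<open>Pullbacks as solutions of the Lame equation, branch by branch\<close>

lemma pullback_wronskian:
  "pullback s S X * pullback' s T T1 X - pullback' s S S1 X * pullback s T X =
   (gg X (Yc s X) powr (-1/12))\<^sup>2 * zz' s X * (S (zz s X) * T1 (zz s X) - S1 (zz s X) * T (zz s X))"
  unfolding pullback_def pullback'_def by algebra

lemma pullback_linear:
  "S (zz s X) = a * T (zz s X) + b * R (zz s X) \<Longrightarrow> pullback s S X = a * pullback s T X + b * pullback s R X"
  unfolding pullback_def by (simp add: algebra_simps)

text \<open>For the Lame equation y itself is the weight of Abel's identity, which reflects that D =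
  y d/dX has no first-order term in D^2 f = q f.\<close>

lemma Yc_weight: assumes "X > 0" shows "(Yc 1 has_real_derivative - LP X * Yc 1 X) (at X)"
proof (rule DERIV_cong[OF Yc_deriv])
  have y: "Yc 1 X \<noteq> 0" using Yc_nz assms by simp
  have "- LP X * Yc 1 X = cubic' X * (inverse (Yc 1 X) * Yc 1 X) * inverse (Yc 1 X) / 2"
    unfolding LPQ_inverse(1)[of 1, OF _ assms, simplified] by (simp add: power2_eq_square)
  thus "cubic' X * inverse (Yc 1 X) / 2 = - LP X * Yc 1 X" using y by simp
qed (use assms in auto)

lemma pullback1_su_sv:
  assumes "0 < X" "rr X (Yc (-1) X) > 0" "hh X (Yc (-1) X) \<noteq> 0"
    "(\<alpha>, c) \<in> {(1/30, 9/10), (2/15, 11/10)}"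
  shows "lame (pullback (-1) (si \<alpha> c)) (pullback' (-1) (si \<alpha> c) (si1 \<alpha> c)) X"
proof (rule pullback_sol)
  show "hsol (si \<alpha> c) (si1 \<alpha> c) (zz (-1) X)"
    by (intro si_sol zz_gt_1 gg1_pos assms) (use assms in auto)
qed (use assms gg1_pos[of X] in auto)

lemma pullback2_su_sv:
  assumes "0 < X" "X \<noteq> 81"
    "(\<alpha>, c) \<in> {(1/30, 9/10), (2/15, 11/10)}"
  shows "lame (pullback 1 (si \<alpha> c)) (pullback' 1 (si \<alpha> c) (si1 \<alpha> c)) X"
proof (rule pullback_sol)
  show "hsol (si \<alpha> c) (si1 \<alpha> c) (zz 1 X)"
    by (intro si_sol zz_gt_1 gg2_pos rr2_pos assms) (use assms in auto)
  show "rr X (Yc 1 X) \<noteq> 0" using rr2_pos[OF assms(1,2)] by simp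
qed (use assms gg2_pos[of X] hh2_nz in auto)

lemma pullback1_sp_sq:
  assumes "0 < X" "rr X (Yc (-1) X) \<noteq> 0" "hh X (Yc (-1) X) \<noteq> 0" "zz (-1) X < 2"
  shows "lame (pullback (-1) sp) (pullback' (-1) sp sp1) X" "lame (pullback (-1) sq) (pullback' (-1) sq sq1) X"
proof -
  have g: "gg X (Yc (-1) X) > 0" using assms gg1_pos by simp
  have z: "zz (-1) X \<noteq> 1" using zz_one[of "-1" X] assms g by auto
  have "zz (-1) X > 0" by (rule zz_pos[OF g assms(3)])
  thus "lame (pullback (-1) sp) (pullback' (-1) sp sp1) X" "lame (pullback (-1) sq) (pullback' (-1) sq sq1) X"
    using assms g z by (auto intro!: pullback_sol sp_sol sq_sol)
qed

lemma pullback1_se_so: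
  assumes "0 < X" "rr X (Yc (-1) X) < 0" "hh X (Yc (-1) X) \<noteq> 0"
  shows "lame (pullback (-1) se) (pullback' (-1) se se1) X" "lame (pullback (-1) so) (pullback' (-1) so so1) X"
proof -
  have g: "gg X (Yc (-1) X) > 0" using assms gg1_pos by simp
  have "zz (-1) X < 1" by (rule zz_lt_1) (use assms g in auto)
  moreover have "zz (-1) X > 0" by (rule zz_pos[OF g assms(3)])
  ultimately show "lame (pullback (-1) se) (pullback' (-1) se se1) X" "lame (pullback (-1) so) (pullback' (-1) so so1) X"
    using assms g by (auto intro!: pullback_sol se_sol so_sol)
qed

lemma zz'_nz:
  assumes "s\<^sup>2 = 1" "X > 0" "gg X (Yc s X) > 0" "hh X (Yc s X) \<noteq> 0" "rr X (Yc s X) \<noteq> 0"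
  shows "zz' s X \<noteq> 0"
  unfolding zz'_def using assms Yc_nz[of s X] by simp

lemma pullback1_wronskian_nz:
  assumes "0 < X" "rr X (Yc (-1) X) > 0" "hh X (Yc (-1) X) \<noteq> 0"
  shows "pullback (-1) su X * pullback' (-1) sv sv1 X - pullback' (-1) su su1 X * pullback (-1) sv X \<noteq> 0"
proof -
  have g: "gg X (Yc (-1) X) > 0" using assms gg1_pos by simp
  have "zz (-1) X > 1" by (rule zz_gt_1) (use assms g in auto)
  moreover have "zz' (-1) X \<noteq> 0" by (rule zz'_nz) (use assms g in auto)
  ultimately show ?thesis unfolding pullback_wronskian using wronskian_su_sv[of "zz (-1) X"] g by simp
qed

lemma pullback2_wronskian_nz:
  assumes "0 < X" "X \<noteq> 81"
  shows "pullback 1 su X * pullback' 1 sv sv1 X - pullback' 1 su su1 X * pullback 1 sv X \<noteq> 0"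
proof -
  have g: "gg X (Yc 1 X) > 0" using assms gg2_pos by simp
  have r: "rr X (Yc 1 X) > 0" using assms rr2_pos by simp
  have "zz 1 X > 1" by (rule zz_gt_1) (use assms g r in auto)
  moreover have "zz' 1 X \<noteq> 0" by (rule zz'_nz) (use assms g r hh2_nz in auto)
  ultimately show ?thesis unfolding pullback_wronskian using wronskian_su_sv[of "zz 1 X"] g by simp
qed

subsection \<open>Smooth continuation of the pullbacks\<close>

text \<open>
  Over z = 1 and z = 0 the multivalued factors (1 - z) powr (1/3) and sqrt z become, up to sign, rr and
  hh times powers of gg; dropping the absolute value gives sq_signed and so_signed, which are
  differentiable there. The functions su_ext and sv_ext play the same role at X = 81.
\<close>

lemma zz_differentiable:
  assumes "s\<^sup>2 = 1" "X > 0" "gg X (Yc s X) > 0"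
  shows "zz s differentiable at X"
proof -
  have "(\<lambda>X. gg X (Yc s X)) differentiable at X" "(\<lambda>X. hh X (Yc s X)) differentiable at X"
    using gY_deriv[OF assms(1,2)] hY_deriv[OF assms(1,2)] real_differentiable_def by blast+
  thus ?thesis unfolding zz_def[abs_def] using assms(3)
    by (intro differentiable_mult differentiable_power differentiable_inverse) auto
qed

lemma hgf_differentiable: "c > 0 \<Longrightarrow> \<bar>x\<bar> < 1 \<Longrightarrow> hgf a b c differentiable at x"
  using hgf_deriv real_differentiable_def by blast

lemma differentiable_comp_real:
  fixes f g :: "real \<Rightarrow> real"
  shows "f differentiable at (g x) \<Longrightarrow> g differentiable at x \<Longrightarrow> (\<lambda>x. f (g x)) differentiable at x"
  using differentiable_chain_at[of g x f] by (simp add: o_def)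

lemma powr_differentiable:
  fixes f :: "real \<Rightarrow> real"
  assumes "f differentiable at x" "f x > 0"
  shows "(\<lambda>x. f x powr e) differentiable at x"
  using assms DERIV_fun_powr real_differentiable_def by blast

lemma gpow_differentiable:
  assumes "s\<^sup>2 = 1" "X > 0" "gg X (Yc s X) > 0"
  shows "(\<lambda>X. gg X (Yc s X) powr e) differentiable at X"
  by (rule powr_differentiable) (use gY_deriv[OF assms(1,2)] assms(3) real_differentiable_def in blast)+

definition sq_signed :: "real \<Rightarrow> real" where
  "sq_signed X = 5000 powr (1/3) * rr X (Yc (-1) X) * gg X (Yc (-1) X) powr (-17/12) * hgf (11/30) (7/15) (4/3) (1 - zz (-1) X)"

definition so_signed :: "real \<Rightarrow> real" where
  "so_signed X = - hh X (Yc (-1) X) * gg X (Yc (-1) X) powr (-19/12) * hgf (8/15) (19/30) (3/2) (zz (-1) X)"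

lemma hgf_comp_differentiable:
  fixes g :: "real \<Rightarrow> real"
  assumes "c > 0" "\<bar>g x\<bar> < 1" "g differentiable at x"
  shows "(\<lambda>x. hgf a b c (g x)) differentiable at x"
  by (rule differentiable_comp_real[where f = "hgf a b c" and g = g, OF hgf_differentiable[OF assms(1,2)] assms(3)])

context
  fixes X :: real
  assumes X: "X > 0"
begin

lemma zz1_differentiable: "zz (-1) differentiable at X"
  by (rule zz_differentiable) (use X gg1_pos[of X] in auto)

lemma gp1_differentiable: "(\<lambda>X. gg X (Yc (-1) X) powr e) differentiable at X"
  by (rule gpow_differentiable) (use X gg1_pos[of X] in auto)

lemma rr1_differentiable: "(\<lambda>X. rr X (Yc (-1) X)) differentiable at X"
  using rY_deriv[of "-1" X] X real_differentiable_def by fastforce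

lemma hh1_differentiable: "(\<lambda>X. hh X (Yc (-1) X)) differentiable at X"
  using hY_deriv[of "-1" X] X real_differentiable_def by fastforce

lemma pullback_sp_differentiable:
  assumes "\<bar>1 - zz (-1) X\<bar> < 1"
  shows "pullback (-1) sp differentiable at X"
  unfolding pullback_def[abs_def] sp_def
  by (rule differentiable_mult[OF gp1_differentiable hgf_comp_differentiable])
     (use assms differentiable_diff[OF differentiable_const zz1_differentiable] in auto)

lemma sq_signed_differentiable:
  assumes "\<bar>1 - zz (-1) X\<bar> < 1"
  shows "sq_signed differentiable at X"
  unfolding sq_signed_def[abs_def]
  by (rule differentiable_mult[OF differentiable_mult[OF differentiable_mult[OF differentiable_const rr1_differentiable] gp1_differentiable] hgf_comp_differentiable])
     (use assms differentiable_diff[OF differentiable_const zz1_differentiable] in auto)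

lemma pullback_se_differentiable:
  assumes "\<bar>zz (-1) X\<bar> < 1"
  shows "pullback (-1) se differentiable at X"
  unfolding pullback_def[abs_def] se_def
  by (rule differentiable_mult[OF gp1_differentiable hgf_comp_differentiable])
     (use assms zz1_differentiable in auto)

lemma so_signed_differentiable:
  assumes "\<bar>zz (-1) X\<bar> < 1"
  shows "so_signed differentiable at X"
  unfolding so_signed_def[abs_def]
  by (rule differentiable_mult[OF differentiable_mult[OF differentiable_minus[OF hh1_differentiable] gp1_differentiable] hgf_comp_differentiable])
     (use assms zz1_differentiable in auto)

end

text \<open>By \<open>zz_one\<close> the factor |1 - z|^(1/3) is 5000^(1/3) |r| g^(-4/3), and -4/3 -
  1/12 = -17/12. The absolute value of r is thus all that distinguishes this pullback from
  \<open>sq_signed\<close>.\<close>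

lemma pullback_sq_eq:
  assumes s: "s\<^sup>2 = 1" and X: "X \<ge> 0" and g: "gg X (Yc s X) > 0"
  shows "pullback s sq X = 5000 powr (1/3) * \<bar>rr X (Yc s X)\<bar> * gg X (Yc s X) powr (-17/12) * hgf (11/30) (7/15) (4/3) (1 - zz s X)"
proof -
  let ?g = "gg X (Yc s X)" and ?r = "rr X (Yc s X)"
  have "\<bar>1 - zz s X\<bar> = \<bar>zz s X - 1\<bar>" by simp
  also have "\<dots> = 5000 * (\<bar>?r\<bar> ^ 3 * inverse ?g ^ 4)"
    unfolding zz_one[OF assms] using g by (simp add: abs_mult power_abs)
  finally have z: "\<bar>1 - zz s X\<bar> = 5000 * (\<bar>?r\<bar> ^ 3 * inverse ?g ^ 4)" .
  have r3: "(\<bar>?r\<bar> ^ 3) powr (1/3) = \<bar>?r\<bar>"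
  proof (cases "?r = 0")
    case False
    hence "\<bar>?r\<bar> ^ 3 = \<bar>?r\<bar> powr 3" by simp
    hence "(\<bar>?r\<bar> ^ 3) powr (1/3) = (\<bar>?r\<bar> powr 3) powr (1/3)" by (simp only:)
    also have "\<dots> = \<bar>?r\<bar>" unfolding powr_powr by simp
    finally show ?thesis .
  qed simp
  have g4: "(inverse ?g ^ 4) powr (1/3) = ?g powr (-4/3)"
  proof -
    have "inverse ?g ^ 4 = ?g powr (-4)" using g by (simp add: powr_minus power_inverse)
    hence "(inverse ?g ^ 4) powr (1/3) = (?g powr (-4)) powr (1/3)" by (simp only:)
    thus ?thesis unfolding powr_powr by simp
  qed
  have "\<bar>1 - zz s X\<bar> powr (1/3) = 5000 powr (1/3) * (\<bar>?r\<bar> * ?g powr (-4/3))"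
    unfolding z using g by (simp add: powr_mult r3 g4)
  moreover have "?g powr (-1/12) * ?g powr (-4/3) = ?g powr (-17/12)" by (simp flip: powr_add)
  ultimately show ?thesis unfolding pullback_def sq_def by (simp add: mult_ac)
qed

lemma pullback_so_eq:
  assumes g: "gg X (Yc s X) > 0"
  shows "pullback s so X = \<bar>hh X (Yc s X)\<bar> * gg X (Yc s X) powr (-19/12) * hgf (8/15) (19/30) (3/2) (zz s X)"
proof -
  let ?g = "gg X (Yc s X)" and ?h = "hh X (Yc s X)"
  have "inverse ?g ^ 3 = ?g powr (-3)" using g by (simp add: powr_minus power_inverse)
  hence "sqrt (inverse ?g ^ 3) = (?g powr (-3)) powr (1/2)"
    by (simp only: powr_half_sqrt powr_ge_zero)
  hence "sqrt (inverse ?g ^ 3) = ?g powr (-3/2)"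
    unfolding powr_powr by simp
  hence "sqrt (zz s X) = \<bar>?h\<bar> * ?g powr (-3/2)"
    unfolding zz_def by (simp add: real_sqrt_mult)
  moreover have "?g powr (-1/12) * ?g powr (-3/2) = ?g powr (-19/12)" by (simp flip: powr_add)
  ultimately show ?thesis unfolding pullback_def so_def by (simp add: mult_ac)
qed

section \<open>The second pullback near the pole X = 81\<close>

definition inv_zz :: "real \<Rightarrow> real" where
  "inv_zz X = (X - 81) ^ 10 * inverse (gg X (Yc (-1) X) ^ 3 * (hh_cofactor X)\<^sup>2)"
definition su_ext :: "real \<Rightarrow> real" where
  "su_ext X = hh_cofactor X powr (-1/15) * gg X (Yc (-1) X) powr (-1/60) * hgf (1/30) (1/30 + 1/2) (9/10) (inv_zz X)"
definition sv_ext :: "real \<Rightarrow> real" where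
  "sv_ext X = (81 - X) * (hh_cofactor X powr (-4/15) * gg X (Yc (-1) X) powr (-19/60)) * hgf (2/15) (2/15 + 1/2) (11/10) (inv_zz X)"

text \<open>By \<open>gg_conj\<close> and \<open>hh_eq_cofactor\<close> the vanishing factors of 1/z
  collect in (X - 81)^10. In the prefactors the powers of |X - 81| add up to -1/3 + 10/30 = 0 for
  \<open>su\<close> and -1/3 + 10 * 2/15 = 1 for \<open>sv\<close>; replacing |X - 81| by 81 - X
  gives the differentiable \<open>sv_ext\<close>.\<close>

lemma index2_near_81:
  assumes "X > 0" "X \<noteq> 81"
  defines "d \<equiv> \<bar>X - 81\<bar>"
  shows "inverse (zz 1 X) = inv_zz X"
    and "gg X (Yc 1 X) powr (-1/12) * zz 1 X powr (-(1/30)) = hh_cofactor X powr (-1/15) * gg X (Yc (-1) X) powr (-1/60)"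
    and "gg X (Yc 1 X) powr (-1/12) * zz 1 X powr (-(2/15)) = d * (hh_cofactor X powr (-4/15) * gg X (Yc (-1) X) powr (-19/60))"
proof -
  define G where "G = gg X (Yc (-1) X)"
  define B where "B = hh_cofactor X"
  have d: "d > 0" using assms by (simp add: d_def)
  have G: "G > 0" using assms gg1_pos by (simp add: G_def)
  have B: "B > 0" using hh_cofactor_pos assms by (simp add: B_def)
  have "gg X (Yc 1 X) * G = d ^ 4"
    unfolding G_def Yc_minus gg_conj[OF Yc_sq1[OF less_imp_le[OF assms(1)]]] d_def by simp
  hence g: "gg X (Yc 1 X) = d ^ 4 / G" using G by (simp add: field_simps)
  have h: "(hh X (Yc 1 X))\<^sup>2 = d\<^sup>2 * B\<^sup>2"
    unfolding hh_eq_cofactor[OF assms(1)] B_def d_def by (simp add: power_mult_distrib)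
  have z: "zz 1 X = B\<^sup>2 * G ^ 3 / d ^ 10"
    unfolding zz_def g h using d G by (simp add: field_simps flip: power_add)
  have d10: "(X - 81) ^ 10 = d ^ 10" by (simp add: d_def)
  show "inverse (zz 1 X) = inv_zz X"
    unfolding z inv_zz_def d10 G_def[symmetric] B_def[symmetric] by (simp add: field_simps)
  have gp: "gg X (Yc 1 X) = d powr 4 * G powr (-1)"
    unfolding g using d G by (simp add: powr_minus field_simps)
  have zp: "zz 1 X = B powr 2 * G powr 3 * d powr (-10)"
    unfolding z using d G B by (simp add: powr_minus field_simps)
  have m2: "(x powr a * y powr b) powr c = x powr (a * c) * y powr (b * c)" for x y a b c :: real
    by (simp only: powr_mult powr_ge_zero powr_powr)
  have m3: "(x powr a * y powr b * w powr e) powr c = x powr (a * c) * y powr (b * c) * w powr (e * c)" for x y w a b c e :: real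
    by (simp only: powr_mult powr_ge_zero powr_powr mult_nonneg_nonneg)
  have 1: "gg X (Yc 1 X) powr (-1/12) = d powr (-1/3) * G powr (1/12)"
    unfolding gp m2 by simp
  have 2: "zz 1 X powr (-(1/30)) = B powr (-1/15) * G powr (-1/10) * d powr (1/3)"
    unfolding zp m3 by simp
  have 3: "zz 1 X powr (-(2/15)) = B powr (-4/15) * G powr (-2/5) * d powr (4/3)"
    unfolding zp m3 by simp
  have e: "d powr (-1/3) * d powr (1/3) = 1" "d powr (-1/3) * d powr (4/3) = d"
    "G powr (1/12) * G powr (-1/10) = G powr (-1/60)" "G powr (1/12) * G powr (-2/5) = G powr (-19/60)"
    using d G by (simp_all flip: powr_add)
  have "gg X (Yc 1 X) powr (-1/12) * zz 1 X powr (-(1/30)) =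
     (d powr (-1/3) * d powr (1/3)) * (B powr (-1/15) * (G powr (1/12) * G powr (-1/10)))"
    unfolding 1 2 by (simp only: mult_ac)
  thus "gg X (Yc 1 X) powr (-1/12) * zz 1 X powr (-(1/30)) = hh_cofactor X powr (-1/15) * gg X (Yc (-1) X) powr (-1/60)"
    by (simp only: e mult_1 G_def[symmetric] B_def[symmetric])
  have "gg X (Yc 1 X) powr (-1/12) * zz 1 X powr (-(2/15)) =
     (d powr (-1/3) * d powr (4/3)) * (B powr (-4/15) * (G powr (1/12) * G powr (-2/5)))"
    unfolding 1 3 by (simp only: mult_ac)
  thus "gg X (Yc 1 X) powr (-1/12) * zz 1 X powr (-(2/15)) = d * (hh_cofactor X powr (-4/15) * gg X (Yc (-1) X) powr (-19/60))"
    by (simp only: e mult_1 G_def[symmetric] B_def[symmetric])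
qed

lemma pullback_su_2: "X > 0 \<Longrightarrow> X \<noteq> 81 \<Longrightarrow> pullback 1 su X = su_ext X"
  unfolding pullback_def si_def su_ext_def using index2_near_81[of X] by (simp flip: mult.assoc)

lemma pullback_sv_2: assumes "X > 0" "X \<noteq> 81" shows "pullback 1 sv X = (if X < 81 then sv_ext X else - sv_ext X)"
proof -
  have "pullback 1 sv X = \<bar>X - 81\<bar> * (hh_cofactor X powr (-4/15) * gg X (Yc (-1) X) powr (-19/60)) * hgf (2/15) (2/15 + 1/2) (11/10) (inv_zz X)"
    unfolding pullback_def si_def index2_near_81(1)[OF assms] index2_near_81(3)[OF assms, symmetric] by (simp only: mult.assoc)
  moreover have "\<bar>X - 81\<bar> = (if X < 81 then 81 - X else - (81 - X))" by auto
  ultimately show ?thesis unfolding sv_ext_def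
    by (cases "X < 81") (simp_all only: if_True if_False mult_minus_left not_False_eq_True)
qed

lemma hh_cofactor_differentiable: assumes "X > 0" shows "hh_cofactor differentiable at X"
proof -
  have Y: "Yc 1 differentiable at X" using Yc_deriv[of 1 X] assms real_differentiable_def by fastforce
  have n: "Yc 1 X + 8 * X \<noteq> 0" using Yc_nonneg[of X] assms by simp
  obtain D where D: "(Yc 1 has_real_derivative D) (at X)" using Y real_differentiable_def by blast
  have "\<exists>D. (hh_cofactor has_real_derivative D) (at X)" unfolding hh_cofactor_def[abs_def]
    by (rule exI, (rule derivative_eq_intros D refl n)+)
  thus ?thesis by (simp add: real_differentiable_def)
qed

lemma su_sv_ext_differentiable: "su_ext differentiable at 81" "sv_ext differentiable at 81"
proof -
  have g: "(\<lambda>X. gg X (Yc (-1) X)) differentiable at 81"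
    using gY_deriv[of "-1" 81] real_differentiable_def by fastforce
  have gp: "gg 81 (Yc (-1) 81) > 0" using gg1_pos[of 81] by simp
  have B: "hh_cofactor differentiable at 81" by (rule hh_cofactor_differentiable) simp
  have Bp: "hh_cofactor 81 > 0" by (rule hh_cofactor_pos) simp
  have l: "(\<lambda>X. X - 81) differentiable at (81::real)" "(\<lambda>X. 81 - X) differentiable at (81::real)"
    by (simp_all add: differentiable_diff)
  have z: "inv_zz differentiable at 81"
    unfolding inv_zz_def[abs_def]
    by (rule differentiable_mult[OF differentiable_power[OF l(1)] differentiable_inverse[OF differentiable_mult[OF differentiable_power[OF g] differentiable_power[OF B]]]])
       (use gp Bp in auto)
  have zz_at_0: "inv_zz 81 = 0" by (simp add: inv_zz_def)
  have H: "(\<lambda>X. hgf a b c (inv_zz X)) differentiable at 81" if "c > 0" for a b c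
    by (rule hgf_comp_differentiable) (use that zz_at_0 z in auto)
  note P = powr_differentiable[OF B Bp] powr_differentiable[OF g gp]
  show "su_ext differentiable at 81"
    unfolding su_ext_def[abs_def]
    by (rule differentiable_mult[OF differentiable_mult[OF P] H]) simp
  show "sv_ext differentiable at 81"
    unfolding sv_ext_def[abs_def]
    by (rule differentiable_mult[OF differentiable_mult[OF l(2) differentiable_mult[OF P]] H]) simp
qed

subsection \<open>Behaviour at infinity\<close>

text \<open>From y ~ s X^(3/2)/sqrt 5, r ~ X y and g ~ X^2 one gets z - 1 ~ s \<open>zz_rate\<close>
  X^(-1/2).\<close>

definition zz_rate :: real where "zz_rate = 5000 * ((1/5) powr (1/2)) ^ 3"

lemma zz_rate_pos: "zz_rate > 0" by (simp add: zz_rate_def)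

lemma gg_asymptotics: "((\<lambda>X. X powr (1/6) * gg X (Yc s X) powr (-1/12)) \<longlongrightarrow> 1) at_top"
  if "s = 1 \<or> s = -1"
  using that unfolding gg_def cubic_def Yc_def by (elim disjE; hypsubst) real_asymp+

lemma rr_gg_asymptotics: "((\<lambda>X. X powr (1/2) * (5000 * rr X (Yc s X) ^ 3 * inverse (gg X (Yc s X)) ^ 4)) \<longlongrightarrow> s * zz_rate) at_top"
  if s: "s = 1 \<or> s = -1"
proof -
  have "((\<lambda>X. X powr (1/2) * (5000 * rr X (1 * sqrt (cubic X)) ^ 3 * inverse (gg X (1 * sqrt (cubic X))) ^ 4)) \<longlongrightarrow> zz_rate) at_top"
    unfolding gg_def rr_def cubic_def zz_rate_def by real_asymp
  moreover have "((\<lambda>X. X powr (1/2) * (5000 * rr X (-1 * sqrt (cubic X)) ^ 3 * inverse (gg X (-1 * sqrt (cubic X))) ^ 4)) \<longlongrightarrow> - zz_rate) at_top"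
    unfolding gg_def rr_def cubic_def zz_rate_def by real_asymp
  ultimately show ?thesis using s unfolding Yc_def by (elim disjE) simp_all
qed

text \<open>The two values of g differ by 160 y, of order X^(3/2), so their powers differ by order
  X^(-2/3).\<close>

lemma gg_conj_asymptotics: "((\<lambda>X. X powr (1/3) * (gg X (Yc (-1) X) powr (-1/12) - gg X (Yc 1 X) powr (-1/12))) \<longlongrightarrow> 0) at_top"
  unfolding gg_def cubic_def Yc_def by real_asymp

context
  fixes s :: real
  assumes s: "s = 1 \<or> s = -1"
begin

lemma gg_pos_large: "X > 81 \<Longrightarrow> gg X (Yc s X) > 0"
  using s gg1_pos[of X] gg2_pos[of X] by auto

lemma zz_asymptotics: "((\<lambda>X. X powr (1/2) * (zz s X - 1)) \<longlongrightarrow> s * zz_rate) at_top"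
proof (rule Lim_transform_eventually[OF rr_gg_asymptotics[OF s]])
  show "eventually (\<lambda>X. X powr (1/2) * (5000 * rr X (Yc s X) ^ 3 * inverse (gg X (Yc s X)) ^ 4) = X powr (1/2) * (zz s X - 1)) at_top"
    using eventually_gt_at_top[of 81]
  proof eventually_elim
    case (elim X)
    have "s\<^sup>2 = 1" using s by auto
    thus ?case using zz_one[of s X] gg_pos_large[OF elim] elim by simp
  qed
qed

lemma powr_neg_lim: "a < 0 \<Longrightarrow> ((\<lambda>X::real. X powr a) \<longlongrightarrow> 0) at_top"
  by real_asymp

lemma zz_lim: "(zz s \<longlongrightarrow> 1) at_top"
proof -
  have "((\<lambda>X. X powr (-1/2) * (X powr (1/2) * (zz s X - 1)) + 1) \<longlongrightarrow> 0 * (s * zz_rate) + 1) at_top"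
    by (intro tendsto_intros zz_asymptotics powr_neg_lim) simp
  hence L: "((\<lambda>X. X powr (-1/2) * (X powr (1/2) * (zz s X - 1)) + 1) \<longlongrightarrow> 1) at_top" by simp
  show ?thesis
  proof (rule Lim_transform_eventually[OF L])
    show "eventually (\<lambda>X. X powr (-1/2) * (X powr (1/2) * (zz s X - 1)) + 1 = zz s X) at_top"
      using eventually_gt_at_top[of 0]
    proof eventually_elim
      case (elim X)
      have "X powr (-1/2) * X powr (1/2) = 1" using elim by (simp flip: powr_add)
      thus ?case by (simp flip: mult.assoc)
    qed
  qed
qed

lemma zz_lt_2_large: "eventually (\<lambda>X. zz s X < 2) at_top"
  by (rule order_tendstoD(2)[OF zz_lim]) simp

lemma sp_1: "isCont sp 1" "sp 1 = 1"
  using sp_lim by (auto simp: isCont_def sp_def)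

lemma sp_zz_lim: "((\<lambda>X. sp (zz s X)) \<longlongrightarrow> 1) at_top"
  using isCont_tendsto_compose[OF sp_1(1) zz_lim] sp_1(2) by simp

lemma pullback_sp_asymptotics: "((\<lambda>X. X powr (1/6) * pullback s sp X) \<longlongrightarrow> 1) at_top"
  using tendsto_mult[OF gg_asymptotics[OF s] sp_zz_lim] by (simp add: pullback_def mult.assoc)

lemma pullback_sq_asymptotics: "((\<lambda>X. X powr (1/3) * pullback s sq X) \<longlongrightarrow> zz_rate powr (1/3)) at_top"
proof -
  have Fq: "((\<lambda>X. hgf (11/30) (7/15) (4/3) (1 - zz s X)) \<longlongrightarrow> 1) at_top"
  proof -
    have "((\<lambda>X. 1 - zz s X) \<longlongrightarrow> 1 - 1) at_top" by (intro tendsto_intros zz_lim)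
    hence "((\<lambda>X. hgf (11/30) (7/15) (4/3) (1 - zz s X)) \<longlongrightarrow> hgf (11/30) (7/15) (4/3) 0) at_top"
      by (intro isCont_tendsto_compose[OF hgf_cont]) auto
    thus ?thesis by simp
  qed
  have "((\<lambda>X. \<bar>X powr (1/2) * (zz s X - 1)\<bar> powr (1/3)) \<longlongrightarrow> \<bar>s * zz_rate\<bar> powr (1/3)) at_top"
    by (intro tendsto_powr' tendsto_rabs zz_asymptotics tendsto_const) (use s zz_rate_pos in auto)
  moreover have "\<bar>s * zz_rate\<bar> = zz_rate" using s zz_rate_pos by auto
  ultimately have A: "((\<lambda>X. \<bar>X powr (1/2) * (zz s X - 1)\<bar> powr (1/3)) \<longlongrightarrow> zz_rate powr (1/3)) at_top" by simp
  have L: "((\<lambda>X. X powr (1/6) * gg X (Yc s X) powr (-1/12) * (\<bar>X powr (1/2) * (zz s X - 1)\<bar> powr (1/3) * hgf (11/30) (7/15) (4/3) (1 - zz s X)))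
      \<longlongrightarrow> zz_rate powr (1/3)) at_top"
    using tendsto_mult[OF gg_asymptotics[OF s] tendsto_mult[OF A Fq]] by simp
  show ?thesis
  proof (rule Lim_transform_eventually[OF L])
    show "eventually (\<lambda>X. X powr (1/6) * gg X (Yc s X) powr (-1/12) * (\<bar>X powr (1/2) * (zz s X - 1)\<bar> powr (1/3) * hgf (11/30) (7/15) (4/3) (1 - zz s X))
        = X powr (1/3) * pullback s sq X) at_top"
      using eventually_gt_at_top[of 0]
    proof eventually_elim
      case (elim X)
      have "\<bar>X powr (1/2) * (zz s X - 1)\<bar> = X powr (1/2) * \<bar>1 - zz s X\<bar>"
        by (simp add: abs_mult abs_minus_commute)
      hence 1: "\<bar>X powr (1/2) * (zz s X - 1)\<bar> powr (1/3) = X powr (1/6) * \<bar>1 - zz s X\<bar> powr (1/3)"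
        by (simp add: powr_mult powr_powr)
      have 2: "X powr (1/6) * X powr (1/6) = X powr (1/3)" by (simp flip: powr_add)
      show ?case unfolding 1 pullback_def sq_def 2[symmetric] by (simp only: mult_ac)
    qed
  qed
qed

lemma pullback_sq_asymptotics_0: "((\<lambda>X. X powr (1/6) * pullback s sq X) \<longlongrightarrow> 0) at_top"
proof -
  have L: "((\<lambda>X. X powr (-1/6) * (X powr (1/3) * pullback s sq X)) \<longlongrightarrow> 0) at_top"
    using tendsto_mult[OF powr_neg_lim[of "-1/6"] pullback_sq_asymptotics] by simp
  have e: "X powr (-1/6) * X powr (1/3) = X powr (1/6)" for X :: real by (simp flip: powr_add)
  have "X powr (-1/6) * (X powr (1/3) * pullback s sq X) = X powr (1/6) * pullback s sq X" for X
    unfolding e[symmetric] by (simp only: mult.assoc)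
  thus ?thesis using L by (simp only:)
qed

text \<open>Differentiability of \<open>sp\<close> at 1 bounds the difference by the order X^(-1/2)
  of z - 1; \<open>k\<close> is Caratheodory's slope function.\<close>

lemma sp_zz_diff: "((\<lambda>X. X powr (1/6) * (sp (zz s X) - 1)) \<longlongrightarrow> 0) at_top"
proof -
  have "(sp has_real_derivative - hgf' (1/30) (2/15) (2/3) 0) (at 1)"
  proof -
    have "((\<lambda>z::real. 1 - z) has_real_derivative -1) (at 1)" by (auto intro!: derivative_eq_intros)
    from DERIV_chain2[OF _ this, of "hgf (1/30) (2/15) (2/3)"] show ?thesis
      using hgf_deriv[of "2/3" 0 "1/30" "2/15"] by (simp add: sp_def[abs_def])
  qed
  then obtain k where k: "\<And>z. sp z - sp 1 = k z * (z - 1)" "isCont k 1"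
    using CARAT_DERIV[of sp _ 1] by blast
  have "((\<lambda>X. X powr (-1/3) * (k (zz s X) * (X powr (1/2) * (zz s X - 1)))) \<longlongrightarrow> 0 * (k 1 * (s * zz_rate))) at_top"
    by (intro tendsto_mult powr_neg_lim zz_asymptotics isCont_tendsto_compose[OF k(2) zz_lim]) simp
  moreover have "X powr (-1/3) * (k (zz s X) * (X powr (1/2) * (zz s X - 1))) = X powr (1/6) * (sp (zz s X) - 1)" for X
  proof -
    have "X powr (-1/3) * X powr (1/2) = X powr (1/6)" by (simp flip: powr_add)
    moreover have "X powr (-1/3) * (k (zz s X) * (X powr (1/2) * (zz s X - 1))) = (X powr (-1/3) * X powr (1/2)) * (k (zz s X) * (zz s X - 1))"
      by (simp only: mult_ac)
    ultimately show ?thesis using k(1)[of "zz s X"] sp_1(2) by simp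
  qed
  ultimately show ?thesis by simp
qed

lemma pullback_sp_asymptoticsmptotics2: "((\<lambda>X. X powr (1/3) * (pullback s sp X - gg X (Yc s X) powr (-1/12))) \<longlongrightarrow> 0) at_top"
proof -
  have "((\<lambda>X. X powr (1/6) * gg X (Yc s X) powr (-1/12) * (X powr (1/6) * (sp (zz s X) - 1))) \<longlongrightarrow> 1 * 0) at_top"
    by (intro tendsto_mult gg_asymptotics[OF s] sp_zz_diff)
  moreover have "X powr (1/6) * gg X (Yc s X) powr (-1/12) * (X powr (1/6) * (sp (zz s X) - 1)) = X powr (1/3) * (pullback s sp X - gg X (Yc s X) powr (-1/12))" for X
  proof -
    have 2: "X powr (1/6) * X powr (1/6) = X powr (1/3)" by (simp flip: powr_add)
    show ?thesis unfolding 2[symmetric] pullback_def by (simp add: algebra_simps)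
  qed
  ultimately show ?thesis by simp
qed

end

lemma pullback_sp_diff_asymptotics: "((\<lambda>X. X powr (1/3) * (pullback (-1) sp X - pullback 1 sp X)) \<longlongrightarrow> 0) at_top"
proof -
  have "((\<lambda>X. X powr (1/3) * (pullback (-1) sp X - gg X (Yc (-1) X) powr (-1/12)) - X powr (1/3) * (pullback 1 sp X - gg X (Yc 1 X) powr (-1/12))
     + X powr (1/3) * (gg X (Yc (-1) X) powr (-1/12) - gg X (Yc 1 X) powr (-1/12))) \<longlongrightarrow> 0 - 0 + 0) at_top"
    by (intro tendsto_add tendsto_diff pullback_sp_asymptoticsmptotics2 gg_conj_asymptotics) auto
  thus ?thesis by (simp add: algebra_simps)
qed

text \<open>The pullbacks of \<open>sp\<close> and \<open>sq\<close> decay like X^(-1/6) and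
  X^(-1/3). The first order determines a; for b the leading terms must cancel to o(X^(-1/3)), which
  is \<open>pullback_sp_diff_asymptotics\<close>.\<close>

lemma infinity_match_sp:
  assumes "eventually (\<lambda>X. pullback (-1) sp X = a * pullback 1 sp X + b * pullback 1 sq X) at_top"
  shows "a = 1" "b = 0"
proof -
  have "((\<lambda>X. a * (X powr (1/6) * pullback 1 sp X) + b * (X powr (1/6) * pullback 1 sq X)) \<longlongrightarrow> a * 1 + b * 0) at_top"
    by (intro tendsto_intros pullback_sp_asymptotics pullback_sq_asymptotics_0) auto
  hence "((\<lambda>X. X powr (1/6) * pullback (-1) sp X) \<longlongrightarrow> a * 1 + b * 0) at_top"
    by (rule Lim_transform_eventually) (use assms in \<open>auto elim!: eventually_mono simp: algebra_simps\<close>)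
  moreover have "((\<lambda>X. X powr (1/6) * pullback (-1) sp X) \<longlongrightarrow> 1) at_top" by (rule pullback_sp_asymptotics) auto
  ultimately have "1 = a * 1 + b * 0" by (metis tendsto_unique trivial_limit_at_top_linorder)
  thus a: "a = 1" by simp
  have "((\<lambda>X. b * (X powr (1/3) * pullback 1 sq X)) \<longlongrightarrow> b * zz_rate powr (1/3)) at_top"
    by (intro tendsto_intros pullback_sq_asymptotics) auto
  hence "((\<lambda>X. X powr (1/3) * (pullback (-1) sp X - pullback 1 sp X)) \<longlongrightarrow> b * zz_rate powr (1/3)) at_top"
    by (rule Lim_transform_eventually) (use assms in \<open>auto elim!: eventually_mono simp: a algebra_simps\<close>)
  hence "0 = b * zz_rate powr (1/3)" using pullback_sp_diff_asymptotics by (metis tendsto_unique trivial_limit_at_top_linorder)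
  thus "b = 0" using zz_rate_pos by simp
qed

text \<open>Both branches give \<open>sq\<close> the same leading coefficient, because it depends on
  |1 - z|.\<close>

lemma infinity_match_sq:
  assumes "eventually (\<lambda>X. pullback (-1) sq X = a * pullback 1 sp X + b * pullback 1 sq X) at_top"
  shows "a = 0" "b = 1"
proof -
  have "((\<lambda>X. a * (X powr (1/6) * pullback 1 sp X) + b * (X powr (1/6) * pullback 1 sq X)) \<longlongrightarrow> a * 1 + b * 0) at_top"
    by (intro tendsto_intros pullback_sp_asymptotics pullback_sq_asymptotics_0) auto
  hence "((\<lambda>X. X powr (1/6) * pullback (-1) sq X) \<longlongrightarrow> a * 1 + b * 0) at_top"
    by (rule Lim_transform_eventually) (use assms in \<open>auto elim!: eventually_mono simp: algebra_simps\<close>)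
  moreover have "((\<lambda>X. X powr (1/6) * pullback (-1) sq X) \<longlongrightarrow> 0) at_top" by (rule pullback_sq_asymptotics_0) auto
  ultimately have "0 = a * 1 + b * 0" by (metis tendsto_unique trivial_limit_at_top_linorder)
  thus a: "a = 0" by simp
  have "((\<lambda>X. b * (X powr (1/3) * pullback 1 sq X)) \<longlongrightarrow> b * zz_rate powr (1/3)) at_top"
    by (intro tendsto_intros pullback_sq_asymptotics) auto
  hence "((\<lambda>X. X powr (1/3) * pullback (-1) sq X) \<longlongrightarrow> b * zz_rate powr (1/3)) at_top"
    by (rule Lim_transform_eventually) (use assms in \<open>auto elim!: eventually_mono simp: a algebra_simps\<close>)
  moreover have "((\<lambda>X. X powr (1/3) * pullback (-1) sq X) \<longlongrightarrow> zz_rate powr (1/3)) at_top" by (rule pullback_sq_asymptotics) auto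
  ultimately have "zz_rate powr (1/3) = b * zz_rate powr (1/3)" by (metis tendsto_unique trivial_limit_at_top_linorder)
  thus "b = 1" using zz_rate_pos by simp
qed

subsection \<open>Comparison of the two pullbacks\<close>

lemma Yc_lim_0: "(Yc s \<longlongrightarrow> 0) (at_right 0)"
proof -
  have "isCont cubic 0" by (rule DERIV_isCont[OF cubic_deriv])
  hence "(cubic \<longlongrightarrow> cubic 0) (at 0)" by (simp add: isCont_def)
  moreover have "cubic 0 = 0" by (simp add: cubic_def)
  ultimately have c: "(cubic \<longlongrightarrow> 0) (at 0)" by simp
  have "(cubic \<longlongrightarrow> 0) (at_right 0)" by (rule tendsto_mono[OF at_le c]) simp
  hence "((\<lambda>X. s * sqrt (cubic X)) \<longlongrightarrow> s * sqrt 0) (at_right 0)"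
    by (intro tendsto_mult tendsto_real_sqrt tendsto_const)
  thus ?thesis by (simp add: Yc_def[abs_def])
qed

lemma gg_lim_0: "((\<lambda>X. gg X (Yc s X)) \<longlongrightarrow> 6561) (at_right 0)"
    and hh_lim_0: "((\<lambda>X. hh X (Yc s X)) \<longlongrightarrow> -16933941) (at_right 0)"
    and rr_lim_0: "((\<lambda>X. rr X (Yc s X)) \<longlongrightarrow> 72171) (at_right 0)"
proof -
  have X: "((\<lambda>X::real. X) \<longlongrightarrow> 0) (at_right 0)" by (rule tendsto_ident_at)
  have "((\<lambda>X. gg X (Yc s X)) \<longlongrightarrow> 0\<^sup>2 + 478 * 0 + 6561 - 80 * 0) (at_right 0)"
    unfolding gg_def by (intro tendsto_intros X Yc_lim_0)
  thus "((\<lambda>X. gg X (Yc s X)) \<longlongrightarrow> 6561) (at_right 0)" by simp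
  have "((\<lambda>X. hh X (Yc s X)) \<longlongrightarrow> 0^3 + 697 * 0\<^sup>2 - 157957 * 0 - 16933941 + (380 * 0 + 7220) * 0) (at_right 0)"
    unfolding hh_def by (intro tendsto_intros X Yc_lim_0)
  thus "((\<lambda>X. hh X (Yc s X)) \<longlongrightarrow> -16933941) (at_right 0)" by simp
  have "((\<lambda>X. rr X (Yc s X)) \<longlongrightarrow> 3 * 0\<^sup>2 + 722 * 0 + 72171 + (0 - 313) * 0) (at_right 0)"
    unfolding rr_def by (intro tendsto_intros X Yc_lim_0)
  thus "((\<lambda>X. rr X (Yc s X)) \<longlongrightarrow> 72171) (at_right 0)" by simp
qed

text \<open>Common value of z on both branches at the 2-torsion point (0, 0).\<close>

definition zz_at_0 :: real where "zz_at_0 = (-16933941)\<^sup>2 * inverse 6561 ^ 3"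

lemma zz_at_0_gt_1: "zz_at_0 > 1" by (simp add: zz_at_0_def power_divide)

lemma zz_lim_0: "(zz s \<longlongrightarrow> zz_at_0) (at_right 0)"
  unfolding zz_def[abs_def] zz_at_0_def by (intro tendsto_intros gg_lim_0 hh_lim_0) auto

lemma su_sv_cont:
  "isCont su zz_at_0" "isCont sv zz_at_0" "isCont su1 zz_at_0" "isCont sv1 zz_at_0"
  using si_sol[OF zz_at_0_gt_1, of "1/30" "9/10"] si_sol[OF zz_at_0_gt_1, of "2/15" "11/10"]
  unfolding ode_sol_def by (auto intro: DERIV_isCont)

lemma gpow_lim_0: "((\<lambda>X. gg X (Yc s X) powr (-1/12)) \<longlongrightarrow> 6561 powr (-1/12)) (at_right 0)"
  by (intro tendsto_powr gg_lim_0 tendsto_const) auto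

lemma pullback_lim_0:
  assumes "isCont S zz_at_0" shows "(pullback s S \<longlongrightarrow> 6561 powr (-1/12) * S zz_at_0) (at_right 0)"
  unfolding pullback_def[abs_def]
  by (intro tendsto_mult gpow_lim_0 isCont_tendsto_compose[OF assms zz_lim_0])

text \<open>The Wronskian without its factor 1/y. The remaining part has one limit at X = 0 for both
  branches, so the opposite signs of the Wronskians are those of y.\<close>

definition wronskian_factor :: "real \<Rightarrow> real \<Rightarrow> real" where
  "wronskian_factor s X = (gg X (Yc s X) powr (-1/12))\<^sup>2 * (- 500 * hh X (Yc s X) * (rr X (Yc s X))\<^sup>2 * inverse (gg X (Yc s X)) ^ 4)
     * (su (zz s X) * sv1 (zz s X) - su1 (zz s X) * sv (zz s X))"

lemma pullback_wronskian_factor: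
  "pullback s su X * pullback' s sv sv1 X - pullback' s su su1 X * pullback s sv X = wronskian_factor s X * inverse (Yc s X)"
  unfolding pullback_wronskian wronskian_factor_def zz'_def by (simp only: mult_ac)

lemma wronskian_factor_lim_0: "\<exists>K. K \<noteq> 0 \<and> (\<forall>s. (wronskian_factor s \<longlongrightarrow> K) (at_right 0))"
proof (intro exI conjI allI)
  let ?K = "(6561 powr (-1/12))\<^sup>2 * (- 500 * (-16933941) * (72171)\<^sup>2 * inverse 6561 ^ 4) * (su zz_at_0 * sv1 zz_at_0 - su1 zz_at_0 * sv zz_at_0)"
  show "?K \<noteq> 0" using wronskian_su_sv[OF zz_at_0_gt_1] by simp
  show "(wronskian_factor s \<longlongrightarrow> ?K) (at_right 0)" for s
    unfolding wronskian_factor_def[abs_def]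
    by (intro tendsto_mult tendsto_diff tendsto_power tendsto_const tendsto_inverse gpow_lim_0 hh_lim_0 rr_lim_0 gg_lim_0
          isCont_tendsto_compose[OF _ zz_lim_0] su_sv_cont) auto
qed

text \<open>
  At X = 0 (where y = 0) the two pullbacks agree and their Wronskians are opposite, so the transition matrix
  has an eigenvalue 1 and determinant -1; hence its trace is 0.
\<close>

lemma involution_at_0:
  obtains l m l' where
    "\<And>X. 0 < X \<Longrightarrow> X < 81 \<Longrightarrow> pullback 1 su X = l * pullback (-1) su X + m * pullback (-1) sv X"
    "\<And>X. 0 < X \<Longrightarrow> X < 81 \<Longrightarrow> pullback 1 sv X = l' * pullback (-1) su X - l * pullback (-1) sv X"
    "l\<^sup>2 + m * l' = 1"
proof -
  obtain T1 T2 where T: "313 < T1" "T1 < T2"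
    and r: "\<And>X. 0 < X \<Longrightarrow> X < T1 \<Longrightarrow> rr X (Yc (-1) X) > 0"
    and h: "\<And>X. 0 < X \<Longrightarrow> X < T2 \<Longrightarrow> hh X (Yc (-1) X) < 0"
    by (rule crossing_points) blast
  let ?I = "{0<..<81::real}"
  have I: "open ?I" "connected ?I" "1 \<in> ?I" by auto
  have rI: "rr X (Yc (-1) X) > 0" and hI: "hh X (Yc (-1) X) \<noteq> 0" if "X \<in> ?I" for X
    using r[of X] h[of X] that T by auto
  have U1: "lame (pullback (-1) su) (pullback' (-1) su su1) X" and V1: "lame (pullback (-1) sv) (pullback' (-1) sv sv1) X"
    and U2: "lame (pullback 1 su) (pullback' 1 su su1) X" and V2: "lame (pullback 1 sv) (pullback' 1 sv sv1) X"
    and wt: "(Yc 1 has_real_derivative - LP X * Yc 1 X) (at X)" "Yc 1 X \<noteq> 0" if "X \<in> ?I" for X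
    using that rI[OF that] hI[OF that] by (auto intro!: pullback1_su_sv pullback2_su_sv Yc_weight[simplified] simp: Yc_nz)
  have W: "pullback (-1) su 1 * pullback' (-1) sv sv1 1 - pullback' (-1) su su1 1 * pullback (-1) sv 1 \<noteq> 0"
    by (rule pullback1_wronskian_nz) (use rI[of 1] hI[of 1] in auto)
  obtain l m where lm: "\<And>X. X \<in> ?I \<Longrightarrow> pullback 1 su X = l * pullback (-1) su X + m * pullback (-1) sv X"
     "\<And>X. X \<in> ?I \<Longrightarrow> pullback' 1 su su1 X = l * pullback' (-1) su su1 X + m * pullback' (-1) sv sv1 X"
    using ode_sol_span[OF I U1 V1 U2 wt W] by blast
  obtain l' m' where lm': "\<And>X. X \<in> ?I \<Longrightarrow> pullback 1 sv X = l' * pullback (-1) su X + m' * pullback (-1) sv X"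
     "\<And>X. X \<in> ?I \<Longrightarrow> pullback' 1 sv sv1 X = l' * pullback' (-1) su su1 X + m' * pullback' (-1) sv sv1 X"
    using ode_sol_span[OF I U1 V1 V2 wt W] by blast
  have ev: "eventually (\<lambda>X::real. X \<in> ?I) (at_right 0)" by (rule eventually_at_rightI[of _ 81]) auto
  obtain K where K: "K \<noteq> 0" "\<And>s. (wronskian_factor s \<longlongrightarrow> K) (at_right 0)" using wronskian_factor_lim_0 by blast
  have "wronskian_factor 1 X = - (l * m' - m * l') * wronskian_factor (-1) X" if X: "X \<in> ?I" for X
  proof -
    have "wronskian_factor 1 X * inverse (Yc 1 X) = (l * m' - m * l') * (wronskian_factor (-1) X * inverse (Yc (-1) X))"
      unfolding pullback_wronskian_factor[symmetric] lm[OF X] lm'[OF X] by algebra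
    hence "wronskian_factor 1 X * inverse (Yc 1 X) = (- (l * m' - m * l') * wronskian_factor (-1) X) * inverse (Yc 1 X)"
      by (simp only: Yc_minus inverse_minus_eq mult_minus_right mult_minus_left mult.assoc)
    thus ?thesis using wt(2)[OF X] by (metis mult_right_cancel nonzero_imp_inverse_nonzero)
  qed
  hence "eventually (\<lambda>X. - (l * m' - m * l') * wronskian_factor (-1) X = wronskian_factor 1 X) (at_right 0)"
    using ev by (auto elim!: eventually_mono)
  hence "(wronskian_factor 1 \<longlongrightarrow> - (l * m' - m * l') * K) (at_right 0)"
    by (rule Lim_transform_eventually[rotated]) (intro tendsto_intros K)
  hence "K = - (l * m' - m * l') * K" using K(2)[of 1] tendsto_unique trivial_limit_at_right_real by blast
  hence det: "l * m' - m * l' = -1" using K(1) by simp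
  define u v where "u = 6561 powr (-1/12) * su zz_at_0" and "v = 6561 powr (-1/12) * sv zz_at_0"
  have Lu: "(pullback s su \<longlongrightarrow> u) (at_right 0)" and Lv: "(pullback s sv \<longlongrightarrow> v) (at_right 0)" for s
    unfolding u_def v_def by (intro pullback_lim_0 su_sv_cont)+
  have "u > 0" unfolding u_def using si_pos[OF zz_at_0_gt_1] by simp
  have "(pullback 1 su \<longlongrightarrow> l * u + m * v) (at_right 0)"
    by (rule Lim_transform_eventually[of "\<lambda>X. l * pullback (-1) su X + m * pullback (-1) sv X"])
       (use ev lm(1) in \<open>auto intro!: tendsto_intros Lu Lv elim!: eventually_mono\<close>)
  hence 1: "u = l * u + m * v" using Lu[of 1] tendsto_unique trivial_limit_at_right_real by blast
  have "(pullback 1 sv \<longlongrightarrow> l' * u + m' * v) (at_right 0)"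
    by (rule Lim_transform_eventually[of "\<lambda>X. l' * pullback (-1) su X + m' * pullback (-1) sv X"])
       (use ev lm'(1) in \<open>auto intro!: tendsto_intros Lu Lv elim!: eventually_mono\<close>)
  hence 2: "v = l' * u + m' * v" using Lv[of 1] tendsto_unique trivial_limit_at_right_real by blast
  have "((1 - l) * (1 - m') - m * l') * u = 0" using 1 2 by algebra
  hence "(1 - l) * (1 - m') - m * l' = 0" using \<open>u > 0\<close> by simp
  hence m': "m' = - l" using det by algebra
  have "l\<^sup>2 + m * l' = 1" using det unfolding m' by algebra
  thus ?thesis using that lm(1) lm'(1) m' by force
qed

section \<open>Passing X = 81\<close>

lemma differentiable_realD: "f differentiable at x \<Longrightarrow> \<exists>D. (f has_real_derivative D) (at x)" for x :: real
  by (simp add: real_differentiable_def)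

text \<open>Beyond 81 the pullback of \<open>sv\<close> is minus its smooth continuation, so the
  second row of the involution changes sign. The matrix then has determinant 1 and trace 2 l, and
  the two equations state its inverse.\<close>

lemma crossing_81:
  assumes T1: "313 < T1"
    and r: "\<And>X. 0 < X \<Longrightarrow> X < T1 \<Longrightarrow> rr X (Yc (-1) X) > 0"
    and h: "\<And>X. 0 < X \<Longrightarrow> X < T1 \<Longrightarrow> hh X (Yc (-1) X) < 0"
  obtains l m l' where
    "\<And>X. 81 < X \<Longrightarrow> X < T1 \<Longrightarrow> pullback (-1) su X = l * pullback 1 su X - m * pullback 1 sv X"
    "\<And>X. 81 < X \<Longrightarrow> X < T1 \<Longrightarrow> pullback (-1) sv X = l' * pullback 1 su X + l * pullback 1 sv X"
    "l\<^sup>2 + m * l' = 1" "pullback (-1) su 81 = l * su_ext 81"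
proof -
  obtain l m l' where L:
    "\<And>X. 0 < X \<Longrightarrow> X < 81 \<Longrightarrow> pullback 1 su X = l * pullback (-1) su X + m * pullback (-1) sv X"
    "\<And>X. 0 < X \<Longrightarrow> X < 81 \<Longrightarrow> pullback 1 sv X = l' * pullback (-1) su X - l * pullback (-1) sv X"
    and ml: "l\<^sup>2 + m * l' = 1"
    by (rule involution_at_0) blast
  let ?I = "{81<..<T1}"
  define x0 where "x0 = (82::real)"
  have I: "open ?I" "connected ?I" "x0 \<in> ?I" using T1 by (auto simp: x0_def)
  have h': "hh X (Yc (-1) X) \<noteq> 0" if "0 < X" "X < T1" for X using h[OF that] by simp
  have U1: "lame (pullback (-1) su) (pullback' (-1) su su1) X" and V1: "lame (pullback (-1) sv) (pullback' (-1) sv sv1) X"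
    if "0 < X" "X < T1" for X
    using r[OF that] h'[OF that] that by (auto intro!: pullback1_su_sv)
  have I1: "lame (pullback (-1) su) (pullback' (-1) su su1) X" "lame (pullback (-1) sv) (pullback' (-1) sv sv1) X"
    "lame (pullback 1 su) (pullback' 1 su su1) X" "lame (pullback 1 sv) (pullback' 1 sv sv1) X"
    "(Yc 1 has_real_derivative - LP X * Yc 1 X) (at X)" "Yc 1 X \<noteq> 0" if "X \<in> ?I" for X
    using that U1[of X] V1[of X] by (auto intro!: pullback2_su_sv Yc_weight[simplified] simp: Yc_nz)
  have W: "pullback (-1) su X * pullback' (-1) sv sv1 X - pullback' (-1) su su1 X * pullback (-1) sv X \<noteq> 0" if "0 < X" "X < T1" for X
    by (rule pullback1_wronskian_nz) (use r[OF that] h'[OF that] that in auto)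
  have W0: "pullback (-1) su x0 * pullback' (-1) sv sv1 x0 - pullback' (-1) su su1 x0 * pullback (-1) sv x0 \<noteq> 0"
    by (rule W) (use T1 in \<open>auto simp: x0_def\<close>)
  obtain a b where ab: "\<And>X. X \<in> ?I \<Longrightarrow> pullback 1 su X = a * pullback (-1) su X + b * pullback (-1) sv X"
    using ode_sol_span[OF I I1(1) I1(2) I1(3) I1(5,6) W0] by blast
  obtain a' b' where ab': "\<And>X. X \<in> ?I \<Longrightarrow> pullback 1 sv X = a' * pullback (-1) su X + b' * pullback (-1) sv X"
    using ode_sol_span[OF I I1(1) I1(2) I1(4) I1(5,6) W0] by blast
  have D: "(pullback (-1) su has_real_derivative pullback' (-1) su su1 81) (at 81)"
     "(pullback (-1) sv has_real_derivative pullback' (-1) sv sv1 81) (at 81)"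
    using U1[of 81] V1[of 81] T1 by (auto simp: ode_sol_def)
  obtain du dv where d: "(su_ext has_real_derivative du) (at 81)" "(sv_ext has_real_derivative dv) (at 81)"
    using su_sv_ext_differentiable differentiable_realD by blast
  have "0 < (81::real)" "81 < T1" using T1 by auto
  note cr = ode_sol_cross[OF this D _ W[OF this]]
  have A: "l = a \<and> m = b \<and> su_ext 81 = l * pullback (-1) su 81 + m * pullback (-1) sv 81"
    by (rule cr[OF d(1)]) (use L(1) ab pullback_su_2 in auto)
  have B: "l' = - a' \<and> - l = - b' \<and> sv_ext 81 = l' * pullback (-1) su 81 + - l * pullback (-1) sv 81"
  proof (rule cr[OF d(2)])
    show "sv_ext X = l' * pullback (-1) su X + - l * pullback (-1) sv X" if "0 < X" "X < 81" for X
      using L(2)[OF that] pullback_sv_2[of X] that by simp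
    show "sv_ext X = - a' * pullback (-1) su X + - b' * pullback (-1) sv X" if "81 < X" "X < T1" for X
    proof -
      have "- sv_ext X = a' * pullback (-1) su X + b' * pullback (-1) sv X"
        using ab'[of X] pullback_sv_2[of X] that by simp
      thus ?thesis by (simp only: mult_minus_left)
    qed
  qed
  \<comment> \<open>The simple zero of \<open>sv_ext\<close> at 81; together with l^2 + m l' = 1 it
    leaves only l in the value of \<open>su\<close>.\<close>
  have v0: "l' * pullback (-1) su 81 = l * pullback (-1) sv 81" 
  proof -
    have "sv_ext 81 = l' * pullback (-1) su 81 + - l * pullback (-1) sv 81" using B by blast
    thus ?thesis by (simp add: sv_ext_def)
  qed
  have 81: "pullback (-1) su 81 = l * su_ext 81"
  proof -
    have "l * su_ext 81 = l\<^sup>2 * pullback (-1) su 81 + m * (l * pullback (-1) sv 81)" using A by (simp add: power2_eq_square algebra_simps)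
    also have "\<dots> = (l\<^sup>2 + m * l') * pullback (-1) su 81" unfolding v0[symmetric] by (simp add: algebra_simps)
    finally show ?thesis by (simp add: ml)
  qed
  show ?thesis
  proof (rule that[OF _ _ ml 81])
    fix X assume "81 < X" "X < T1"
    hence X: "X \<in> ?I" by simp
    define U V where "U = pullback (-1) su X" and "V = pullback (-1) sv X"
    have 1: "pullback 1 su X = l * U + m * V" using ab[OF X] A by (simp add: U_def V_def)
    have 2: "pullback 1 sv X = - l' * U + l * V" using ab'[OF X] B by (simp add: U_def V_def)
    show "pullback (-1) su X = l * pullback 1 su X - m * pullback 1 sv X"
      unfolding 1 2 U_def[symmetric] using ml by algebra
    show "pullback (-1) sv X = l' * pullback 1 su X + l * pullback 1 sv X"
      unfolding 1 2 V_def[symmetric] using ml by algebra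
  qed
qed

section \<open>Transport to infinity and comparison of traces\<close>

text \<open>With N = [[l, -m], [l', l]], the two rows of [[t11, t12], [t21, t22]] satisfy t = J t N, where J has trace 2 j.\<close>

lemma trace_identity:
  fixes l m l' t11 t12 t21 t22 j k j' p1 p2 q1 q2 :: real
  assumes "l\<^sup>2 + m * l' = 1" "t11 * t22 - t12 * t21 \<noteq> 0"
    and "p1 = t11 * l + t12 * l'" "p2 = - t11 * m + t12 * l"
    and "q1 = t21 * l + t22 * l'" "q2 = - t21 * m + t22 * l"
    and "t11 = j * p1 - k * q1" "t12 = j * p2 - k * q2"
    and "t21 = j' * p1 + j * q1" "t22 = j' * p2 + j * q2"
  shows "l = j"
proof -
  have D: "p1 * q2 - p2 * q1 = t11 * t22 - t12 * t21" using assms(1,3-6) by algebra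
  \<comment> \<open>Polarised determinant of t and w = t N, where w has rows (p1, p2) and (q1, q2):
    read with w = t N it is tr N det t, read with t = J w it is tr J det w, and det w = det
    t.\<close>
  have "t11 * q2 - t12 * q1 = j * (p1 * q2 - p2 * q1)" using assms(7,8) by algebra
  moreover have "p1 * t22 - p2 * t21 = j * (p1 * q2 - p2 * q1)" using assms(9,10) by algebra
  moreover have "t11 * q2 - t12 * q1 + (p1 * t22 - p2 * t21) = 2 * l * (t11 * t22 - t12 * t21)"
    using assms(3-6) by algebra
  ultimately have "2 * l * (t11 * t22 - t12 * t21) = 2 * j * (t11 * t22 - t12 * t21)" unfolding D by algebra
  hence "2 * l = 2 * j" using mult_right_cancel[OF assms(2)] by blast
  thus ?thesis by simp
qed

lemma cramer_2:
  fixes D W :: real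
  shows "D \<noteq> 0 \<Longrightarrow> D * W = a * p + b * q \<Longrightarrow> W = a / D * p + b / D * q"
  by (simp add: field_simps)

text \<open>All solutions are written in the basis \<open>?U\<close>, \<open>?V\<close>, which is
  regular for X > 81. The coordinates (p1, p2) and (q1, q2) belong to the first pullbacks of
  \<open>sp\<close> and \<open>sq\<close> just before \<open>T1\<close>; each crossing only changes
  signs.\<close>

lemma pullback_su_81:
  "pullback (-1) su 81 = (2 * hgf_sum1 (1/30) (2/15) (2/3) * hgf_sum1 (1/30) (2/15) (1/2) - 1) * su_ext 81"
proof -
  obtain T1 T2 where T: "313 < T1" "T1 < T2"
    and rp: "\<And>X. 0 < X \<Longrightarrow> X < T1 \<Longrightarrow> rr X (Yc (-1) X) > 0"
    and rn: "\<And>X. T1 < X \<Longrightarrow> rr X (Yc (-1) X) < 0" and r0: "rr T1 (Yc (-1) T1) = 0"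
    and hn: "\<And>X. 0 < X \<Longrightarrow> X < T2 \<Longrightarrow> hh X (Yc (-1) X) < 0"
    and hp: "\<And>X. T2 < X \<Longrightarrow> hh X (Yc (-1) X) > 0" and h0: "hh T2 (Yc (-1) T2) = 0"
    by (rule crossing_points) blast
  have g1: "X > 0 \<Longrightarrow> gg X (Yc (-1) X) > 0" for X by (simp add: gg1_pos)
  have hn1: "hh X (Yc (-1) X) < 0" if "0 < X" "X < T1" for X using hn[of X] that T by simp
  obtain l m l' where
    UV: "\<And>X. 81 < X \<Longrightarrow> X < T1 \<Longrightarrow> pullback (-1) su X = l * pullback 1 su X - m * pullback 1 sv X"
    "\<And>X. 81 < X \<Longrightarrow> X < T1 \<Longrightarrow> pullback (-1) sv X = l' * pullback 1 su X + l * pullback 1 sv X"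
    and ml: "l\<^sup>2 + m * l' = 1" and at81: "pullback (-1) su 81 = l * su_ext 81"
    by (rule crossing_81[OF T(1) rp hn1]) blast+
  obtain t11 t12 t21 t22 where
    t: "\<And>z. 1 < z \<Longrightarrow> z < 2 \<Longrightarrow> sp z = t11 * su z + t12 * sv z"
    "\<And>z. 1 < z \<Longrightarrow> z < 2 \<Longrightarrow> sq z = t21 * su z + t22 * sv z"
    and tD: "t11 * t22 - t12 * t21 \<noteq> 0"
    by (rule connection_1_inf) blast
  obtain pe po qe qo e1 e2 n1 n2 where
    c: "\<And>z. 0 < z \<Longrightarrow> z < 1 \<Longrightarrow> sp z = pe * se z + po * so z"
    "\<And>z. 0 < z \<Longrightarrow> z < 1 \<Longrightarrow> sq z = qe * se z + qo * so z"
    "\<And>z. 0 < z \<Longrightarrow> z < 1 \<Longrightarrow> se z = e1 * sp z + e2 * sq z"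
    "\<And>z. 0 < z \<Longrightarrow> z < 1 \<Longrightarrow> so z = n1 * sp z + n2 * sq z"
    and pe: "pe = hgf_sum1 (1/30) (2/15) (2/3)" and e1: "e1 = hgf_sum1 (1/30) (2/15) (1/2)"
    and cc: "pe * e1 + po * n1 = 1" "pe * e2 + po * n2 = 0" "qe * e1 + qo * n1 = 0" "qe * e2 + qo * n2 = 1"
    "e1 * pe + e2 * qe = 1"
    by (rule connection_0_1) blast
  define p1 p2 q1 q2 where "p1 = t11 * l + t12 * l'" and "p2 = - t11 * m + t12 * l"
    and "q1 = t21 * l + t22 * l'" and "q2 = - t21 * m + t22 * l"
  let ?U = "pullback 1 su" and ?V = "pullback 1 sv"
  have lU: "lame ?U (pullback' 1 su su1) X" and lV: "lame ?V (pullback' 1 sv sv1) X"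
    and wt: "(Yc 1 has_real_derivative - LP X * Yc 1 X) (at X)" "Yc 1 X \<noteq> 0" if "81 < X" for X
    using that by (auto intro!: pullback2_su_sv Yc_weight[simplified] simp: Yc_nz)
  have W: "?U X * pullback' 1 sv sv1 X - pullback' 1 su su1 X * ?V X \<noteq> 0" if "81 < X" for X
    by (rule pullback2_wronskian_nz) (use that in auto)
  have span: "\<exists>a b. \<forall>X\<in>I. f X = a * ?U X + b * ?V X"
    if I: "open I" "connected I" "x0 \<in> I" and I81: "\<And>X. X \<in> I \<Longrightarrow> 81 < X"
      and f: "\<And>X. X \<in> I \<Longrightarrow> lame f f1 X" for f f1 I x0
    using ode_sol_span[OF I lU[OF I81] lV[OF I81] f wt(1)[OF I81] wt(2)[OF I81] W[OF I81[OF I(3)]]] by blast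
  have cross: "a = a' \<and> b = b'"
    if "L < C" "C < R" "81 < C" and f: "f differentiable at C"
      and "\<And>X. L < X \<Longrightarrow> X < C \<Longrightarrow> f X = a * ?U X + b * ?V X"
      and "\<And>X. C < X \<Longrightarrow> X < R \<Longrightarrow> f X = a' * ?U X + b' * ?V X" for f L C R a b a' b'
  proof -
    obtain D where D: "(f has_real_derivative D) (at C)" using differentiable_realD[OF f] by blast
    have "(?U has_real_derivative pullback' 1 su su1 C) (at C)" "(?V has_real_derivative pullback' 1 sv sv1 C) (at C)"
      using lU[OF that(3)] lV[OF that(3)] by (auto simp: ode_sol_def)
    from ode_sol_cross[OF that(1,2) this D W[OF that(3)] that(5,6)] show ?thesis by blast
  qed
  \<comment> \<open>T1 lies over z = 1 with ramification index 3, so sq continues to - sq\<close>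
  have zT1: "zz (-1) T1 = 1" using zz_one[of "-1" T1] r0 g1[of T1] T by simp
  have "isCont (zz (-1)) T1"
    by (rule differentiable_imp_continuous_within[OF zz1_differentiable]) (use T in simp)
  hence "\<exists>d>0. \<forall>X. \<bar>X - T1\<bar> < d \<longrightarrow> \<bar>zz (-1) X - 1\<bar> < 1"
    unfolding continuous_at_eps_delta using zT1 by (metis dist_real_def zero_less_one)
  then obtain d where d: "d > 0" "\<And>X. \<bar>X - T1\<bar> < d \<Longrightarrow> \<bar>zz (-1) X - 1\<bar> < 1" by blast
  \<comment> \<open>On this interval z < 2, as the connection between 1 and infinity requires, and X
    > 81, as \<open>UV\<close> requires.\<close>
  define t1 where "t1 = max 81 (T1 - d)"
  have t1: "81 \<le> t1" "t1 < T1" using T d(1) by (auto simp: t1_def)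
  have left: "pullback (-1) sp X = p1 * ?U X + p2 * ?V X" "sq_signed X = q1 * ?U X + q2 * ?V X" if "t1 < X" "X < T1" for X
  proof -
    have X: "81 < X" using that t1 by simp
    have "\<bar>zz (-1) X - 1\<bar> < 1" by (rule d(2)) (use that in \<open>auto simp: t1_def\<close>)
    hence z2: "zz (-1) X < 2" by simp
    have z1: "zz (-1) X > 1" by (rule zz_gt_1) (use X that g1 rp[of X] in auto)
    have "pullback (-1) sp X = t11 * pullback (-1) su X + t12 * pullback (-1) sv X"
      by (rule pullback_linear) (rule t(1)[OF z1 z2])
    thus "pullback (-1) sp X = p1 * ?U X + p2 * ?V X"
      unfolding UV(1)[OF X that(2)] UV(2)[OF X that(2)] p1_def p2_def by (simp add: algebra_simps)
    have "sq_signed X = pullback (-1) sq X"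
      using rp[of X] X that g1[of X] by (subst pullback_sq_eq) (auto simp: sq_signed_def)
    also have "pullback (-1) sq X = t21 * pullback (-1) su X + t22 * pullback (-1) sv X"
      by (rule pullback_linear) (rule t(2)[OF z1 z2])
    finally show "sq_signed X = q1 * ?U X + q2 * ?V X"
      unfolding UV(1)[OF X that(2)] UV(2)[OF X that(2)] q1_def q2_def by (simp add: algebra_simps)
  qed
  have zr: "zz (-1) X < 1" if "T1 < X" for X
    by (rule zz_lt_1) (use that T rn[of X] g1[of X] in auto)
  have zpos: "zz (-1) X > 0" if "T1 < X" "X \<noteq> T2" for X
    by (rule zz_pos) (use that T g1[of X] hn[of X] hp[of X] in \<open>auto simp: neq_iff\<close>)
  let ?M = "{T1<..<T2}"
  define x1 where "x1 = (T1 + T2) / 2"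
  have M: "open ?M" "connected ?M" "x1 \<in> ?M" "\<And>X. X \<in> ?M \<Longrightarrow> 81 < X" using T by (auto simp: x1_def)
  have lM: "lame (pullback (-1) sp) (pullback' (-1) sp sp1) X" "lame (pullback (-1) sq) (pullback' (-1) sq sq1) X" if "X \<in> ?M" for X
    using pullback1_sp_sq[of X] that T rn[of X] hn[of X] zr[of X] by auto
  obtain a b where ab: "\<And>X. X \<in> ?M \<Longrightarrow> pullback (-1) sp X = a * ?U X + b * ?V X"
    using span[OF M lM(1)] by blast
  obtain a' b' where ab': "\<And>X. X \<in> ?M \<Longrightarrow> pullback (-1) sq X = a' * ?U X + b' * ?V X"
    using span[OF M lM(2)] by blast
  have T1': "81 < T1" using T by simp
  have "p1 = a \<and> p2 = b"
    by (rule cross[OF t1(2) T(2) T1' pullback_sp_differentiable]) (use T zT1 left ab in auto)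
  hence Msp: "pullback (-1) sp X = p1 * ?U X + p2 * ?V X" if "X \<in> ?M" for X using ab[OF that] by simp
  have qr: "sq_signed X = - pullback (-1) sq X" if "T1 < X" for X
    using rn[of X] T that g1[of X] by (subst pullback_sq_eq) (auto simp: sq_signed_def)
  have "q1 = - a' \<and> q2 = - b'"
    by (rule cross[OF t1(2) T(2) T1' sq_signed_differentiable]) (use T zT1 left ab' qr in auto)
  hence Msq: "pullback (-1) sq X = - q1 * ?U X - q2 * ?V X" if "X \<in> ?M" for X using ab'[OF that] by simp
  \<comment> \<open>T2 lies over z = 0 with ramification index 2, so so continues to - so\<close>
  have Mse: "pullback (-1) se X = (e1 * p1 - e2 * q1) * ?U X + (e1 * p2 - e2 * q2) * ?V X"
    and Mso: "so_signed X = (n1 * p1 - n2 * q1) * ?U X + (n1 * p2 - n2 * q2) * ?V X" if X: "X \<in> ?M" for X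
  proof -
    have z: "0 < zz (-1) X" "zz (-1) X < 1" using X zr[of X] zpos[of X] by auto
    have "pullback (-1) se X = e1 * pullback (-1) sp X + e2 * pullback (-1) sq X" by (rule pullback_linear) (rule c(3)[OF z])
    thus "pullback (-1) se X = (e1 * p1 - e2 * q1) * ?U X + (e1 * p2 - e2 * q2) * ?V X"
      unfolding Msp[OF X] Msq[OF X] by (simp add: algebra_simps)
    have "so_signed X = pullback (-1) so X"
      using hn[of X] X T g1[of X] by (subst pullback_so_eq) (auto simp: so_signed_def)
    also have "pullback (-1) so X = n1 * pullback (-1) sp X + n2 * pullback (-1) sq X" by (rule pullback_linear) (rule c(4)[OF z])
    finally show "so_signed X = (n1 * p1 - n2 * q1) * ?U X + (n1 * p2 - n2 * q2) * ?V X"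
      unfolding Msp[OF X] Msq[OF X] by (simp add: algebra_simps)
  qed
  let ?R = "{T2<..}"
  have R: "open ?R" "connected ?R" "T2 + 1 \<in> ?R" "\<And>X. X \<in> ?R \<Longrightarrow> 81 < X" using T by auto
  have lR: "lame (pullback (-1) se) (pullback' (-1) se se1) X" "lame (pullback (-1) so) (pullback' (-1) so so1) X" if "X \<in> ?R" for X
    using pullback1_se_so[of X] that T rn[of X] hp[of X] by auto
  obtain f1 f2 where f: "\<And>X. X \<in> ?R \<Longrightarrow> pullback (-1) se X = f1 * ?U X + f2 * ?V X"
    using span[OF R lR(1)] by blast
  obtain f1' f2' where f': "\<And>X. X \<in> ?R \<Longrightarrow> pullback (-1) so X = f1' * ?U X + f2' * ?V X"
    using span[OF R lR(2)] by blast
  have T2: "T2 < T2 + 1" "81 < T2" "0 < T2" using T by auto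
  have zT2: "\<bar>zz (-1) T2\<bar> < 1" using h0 by (simp add: zz_def)
  have F: "e1 * p1 - e2 * q1 = f1 \<and> e1 * p2 - e2 * q2 = f2"
    by (rule cross[OF T(2) T2(1,2) pullback_se_differentiable[OF T2(3) zT2]]) (use Mse f in auto)
  have orr: "so_signed X = - pullback (-1) so X" if "T2 < X" for X
    using hp[of X] T that g1[of X] by (subst pullback_so_eq) (auto simp: so_signed_def)
  have F': "n1 * p1 - n2 * q1 = - f1' \<and> n1 * p2 - n2 * q2 = - f2'"
    by (rule cross[OF T(2) T2(1,2) so_signed_differentiable[OF T2(3) zT2]]) (use Mso f' orr in auto)
  define j k j' where "j = pe * e1 - po * n1" and "k = pe * e2 - po * n2" and "j' = qe * e1 - qo * n1"
  \<comment> \<open>The reflection fixing \<open>se\<close> and negating \<open>so\<close> has trace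
    0 in the basis \<open>sp\<close>, \<open>sq\<close>, so its diagonal entries are j and -j;
    negating \<open>sq\<close> as well makes both equal to j.\<close>
  have j: "j = 2 * pe * e1 - 1" and j2: "qe * e2 - qo * n2 = - j"
    using cc unfolding j_def by algebra+
  have Rsp: "pullback (-1) sp X = (j * p1 - k * q1) * ?U X + (j * p2 - k * q2) * ?V X"
    and Rsq: "pullback (-1) sq X = (j' * p1 + j * q1) * ?U X + (j' * p2 + j * q2) * ?V X" if X: "X \<in> ?R" for X
  proof -
    have z: "0 < zz (-1) X" "zz (-1) X < 1" using X T zr[of X] zpos[of X] by auto
    have e: "pullback (-1) se X = (e1 * p1 - e2 * q1) * ?U X + (e1 * p2 - e2 * q2) * ?V X"
      using f[OF X] F by simp
    have o: "pullback (-1) so X = - (n1 * p1 - n2 * q1) * ?U X - (n1 * p2 - n2 * q2) * ?V X"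
      using f'[OF X] F' by simp
    have "pullback (-1) sp X = pe * pullback (-1) se X + po * pullback (-1) so X" by (rule pullback_linear) (rule c(1)[OF z])
    thus "pullback (-1) sp X = (j * p1 - k * q1) * ?U X + (j * p2 - k * q2) * ?V X"
      unfolding e o j_def k_def by (simp add: algebra_simps)
    have "pullback (-1) sq X = qe * pullback (-1) se X + qo * pullback (-1) so X" by (rule pullback_linear) (rule c(2)[OF z])
    also have "\<dots> = (j' * p1 - (qe * e2 - qo * n2) * q1) * ?U X + (j' * p2 - (qe * e2 - qo * n2) * q2) * ?V X"
      unfolding e o j'_def by (simp add: algebra_simps)
    finally show "pullback (-1) sq X = (j' * p1 + j * q1) * ?U X + (j' * p2 + j * q2) * ?V X"
      unfolding j2 by simp
  qed
  define D where "D = t11 * t22 - t12 * t21"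
  have D0: "D \<noteq> 0" using tD by (simp add: D_def)
  \<comment> \<open>Cramer's rule inverts the connection matrix for the second pullback, so that the
    orders of \<open>sp\<close> and \<open>sq\<close> at infinity can be compared.\<close>
  have inf: "eventually (\<lambda>X. x * ?U X + y * ?V X = (x * t22 - y * t21) / D * pullback 1 sp X + (t11 * y - t12 * x) / D * pullback 1 sq X) at_top" for x y
    using zz_lt_2_large[of 1, simplified] eventually_gt_at_top[of 81]
  proof eventually_elim
    case (elim X)
    have z1: "zz 1 X > 1" by (rule zz_gt_1) (use elim gg2_pos rr2_pos in auto)
    have s: "pullback 1 sp X = t11 * ?U X + t12 * ?V X" "pullback 1 sq X = t21 * ?U X + t22 * ?V X"
      by (rule pullback_linear, rule t(1)[OF z1 elim(1)], rule pullback_linear, rule t(2)[OF z1 elim(1)])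
    define U V where "U = ?U X" and "V = ?V X"
    have "D * (x * U + y * V) = (x * t22 - y * t21) * (t11 * U + t12 * V) + (t11 * y - t12 * x) * (t21 * U + t22 * V)"
      unfolding D_def by algebra
    thus ?case unfolding s U_def[symmetric] V_def[symmetric] by (rule cramer_2[OF D0])
  qed
  have evR: "eventually (\<lambda>X. X \<in> ?R) at_top" using eventually_gt_at_top[of T2] by simp
  define x y where "x = j * p1 - k * q1" and "y = j * p2 - k * q2"
  have "eventually (\<lambda>X. pullback (-1) sp X = (x * t22 - y * t21) / D * pullback 1 sp X + (t11 * y - t12 * x) / D * pullback 1 sq X) at_top"
    using inf[of x y] evR by eventually_elim (use Rsp in \<open>auto simp: x_def y_def\<close>)
  from infinity_match_sp[OF this] have "x * t22 - y * t21 = D" "t11 * y - t12 * x = 0" using D0 by auto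
  hence "(x - t11) * D = 0" "(y - t12) * D = 0" unfolding D_def by algebra+
  hence 1: "t11 = j * p1 - k * q1" "t12 = j * p2 - k * q2" using D0 by (auto simp: x_def y_def)
  define x' y' where "x' = j' * p1 + j * q1" and "y' = j' * p2 + j * q2"
  have "eventually (\<lambda>X. pullback (-1) sq X = (x' * t22 - y' * t21) / D * pullback 1 sp X + (t11 * y' - t12 * x') / D * pullback 1 sq X) at_top"
    using inf[of x' y'] evR by eventually_elim (use Rsq in \<open>auto simp: x'_def y'_def\<close>)
  from infinity_match_sq[OF this] have "x' * t22 - y' * t21 = 0" "t11 * y' - t12 * x' = D" using D0 by auto
  hence "(x' - t21) * D = 0" "(y' - t22) * D = 0" unfolding D_def by algebra+
  hence 2: "t21 = j' * p1 + j * q1" "t22 = j' * p2 + j * q2" using D0 by (auto simp: x'_def y'_def)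
  have "l = j" by (rule trace_identity[OF ml tD p1_def p2_def q1_def q2_def 1 2])
  thus ?thesis using at81 unfolding j pe e1 by simp
qed

section \<open>Evaluation of the algebraic factor\<close>

lemma hgf_value:
  "hgf (1/30) (8/15) (9/10) (20736/45125) =
     1/6 * sqrt 2 * root 10 3 * root 10 5 * root 15 19 * sqrt (5 + sqrt 5)"
proof -
  have g: "gg 81 (Yc (-1) 81) = 103680" and h: "hh 81 (Yc (-1) 81) = -49248000" and B: "hh_cofactor 81 = 524880"
    unfolding Yc_minus Yc_81 gg_def hh_def hh_cofactor_def by simp_all
  have z: "zz (-1) 81 = 45125 / 20736" unfolding zz_def g h by (simp add: power_divide)
  define H where "H = hgf (1/30) (8/15) (9/10) (20736/45125)"
  define L where "L = sqrt 2 * sqrt (5 + sqrt 5) / (2 * sqrt 3)"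
  have "103680 powr (-1/12) * ((45125/20736) powr (-(1/30)) * hgf (1/30) (8/15) (9/10) (20736/45125)) =
     L * (524880 powr (-1/15) * 103680 powr (-1/60))"
    using pullback_su_81 unfolding connection_value L_def[symmetric] pullback_def si_def su_ext_def g B z by (simp add: inv_zz_def)
  moreover have f: "103680 = 2 powr 8 * 3 powr 4 * 5 powr (1::real)" "45125/20736 = 2 powr (-8) * 3 powr (-4) * 5 powr 3 * 19 powr (2::real)"
     "524880 = 2 powr 4 * 3 powr 8 * 5 powr (1::real)"
    by (simp_all add: powr_minus)
  \<comment> \<open>All bases are products of 2, 3, 5 and 19, so in logarithms the powers become
    linear forms. The power of 2 cancels and 3^(-2/5) 5^(1/10) 19^(1/15) remains.\<close>
  define a b c e where "a = ln (2::real)" and "b = ln (3::real)" and "c = ln (5::real)" and "e = ln (19::real)"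
  have p: "(103680::real) powr x = exp (x * (8 * a + 4 * b + c))"
     "(45125/20736::real) powr x = exp (x * (- 8 * a - 4 * b + 3 * c + 2 * e))"
     "(524880::real) powr x = exp (x * (4 * a + 8 * b + c))" for x
    unfolding f by (simp_all add: powr_def ln_mult a_def b_def c_def e_def algebra_simps flip: exp_add)
  ultimately have "exp (-1/12 * (8 * a + 4 * b + c)) * (exp (-(1/30) * (- 8 * a - 4 * b + 3 * c + 2 * e)) * hgf (1/30) (8/15) (9/10) (20736/45125)) =
     L * (exp (-1/15 * (4 * a + 8 * b + c)) * exp (-1/60 * (8 * a + 4 * b + c)))"
    by (simp only: p)
  hence eq: "exp (-1/12 * (8 * a + 4 * b + c)) * (exp (-(1/30) * (- 8 * a - 4 * b + 3 * c + 2 * e)) * H) =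
     L * (exp (-1/15 * (4 * a + 8 * b + c)) * exp (-1/60 * (8 * a + 4 * b + c)))"
    by (simp only: H_def)
  have "H = exp (1/12 * (8 * a + 4 * b + c)) * exp (1/30 * (- 8 * a - 4 * b + 3 * c + 2 * e)) *
    (exp (-1/12 * (8 * a + 4 * b + c)) * (exp (-(1/30) * (- 8 * a - 4 * b + 3 * c + 2 * e)) * H))"
    by (simp flip: mult.assoc exp_add)
  also have "\<dots> = L * (exp (1/12 * (8 * a + 4 * b + c)) * exp (1/30 * (- 8 * a - 4 * b + 3 * c + 2 * e)) *
     exp (-1/15 * (4 * a + 8 * b + c)) * exp (-1/60 * (8 * a + 4 * b + c)))"
    unfolding eq by (simp only: mult_ac)
  also have "\<dots> = L * exp (-2/5 * b + 1/10 * c + 1/15 * e)"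
    unfolding mult_exp_exp by (rule arg_cong[where f = "\<lambda>t. L * exp t"]) (simp add: field_simps)
  finally have H: "H = L * exp (-2/5 * b + 1/10 * c + 1/15 * e)" .
  have rt: "root 10 3 = exp (b / 10)" "root 10 5 = exp (c / 10)" "root 15 19 = exp (e / 15)" "sqrt 3 = exp (b / 2)"
    by (simp_all add: root_powr_inverse powr_half_sqrt[symmetric] powr_def a_def b_def c_def e_def)
  have "exp b = 3" by (simp add: b_def)
  hence E: "exp (-2/5 * b + 1/10 * c + 1/15 * e) = exp (b / 2) * exp (b / 10) * exp (c / 10) * exp (e / 15) / 3"
  proof -
    \<comment> \<open>-2/5 = 1/2 + 1/10 - 1: the part 1/2 cancels the sqrt 3 in the denominator of
      \<open>L\<close>.\<close>
    have "exp (-2/5 * b + 1/10 * c + 1/15 * e) * exp b = exp (b / 2) * exp (b / 10) * exp (c / 10) * exp (e / 15)"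
      unfolding mult_exp_exp by (rule arg_cong[where f = exp]) (simp add: field_simps)
    thus ?thesis using \<open>exp b = 3\<close> by simp
  qed
  have "H = sqrt 2 * sqrt (5 + sqrt 5) / (2 * exp (b / 2)) * (exp (b / 2) * exp (b / 10) * exp (c / 10) * exp (e / 15) / 3)"
    unfolding H E L_def rt ..
  also have "\<dots> = 1/6 * sqrt 2 * root 10 3 * root 10 5 * root 15 19 * sqrt (5 + sqrt 5)"
    unfolding rt by simp
  finally show ?thesis unfolding H_def .
qed

theorem mainTheorem4:
  shows "hyp2F1 (1 / 30) (8 / 15) (9 / 10) (20736 / 45125) =
    complex_of_real (1 / 6 * sqrt 2 * root 10 3 * root 10 5 * root 15 19 * sqrt (5 + sqrt 5))"
proof -
  have "hyp2F1 (of_real (1/30)) (of_real (8/15)) (of_real (9/10)) (of_real (20736/45125)) =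
      complex_of_real (hgf (1/30) (8/15) (9/10) (20736/45125))"
    by (rule hyp2F1_of_real) auto
  thus ?thesis unfolding hgf_value by simp
qed

end
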